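(* Let $N\ge2$ and let $U_1$ and $U_2$ be two distinct primes such that $U_1,U_2\in[N^{1/4},N^{3/4}]$. Set $U=U_1U_2$. Let $S$ be a nonempty subset of the primes of $\{N^{1/4},\ldots,N\}$ (that is, primes $p$ with $N^{1/4}\le p\le N$) and let $A\ge1$ be given. Set $K=N/(|S|\log N)$. For $i\in\{1,2\}$, there exists $\mathcal{D}_i\subset\mathbb{Z}/U_i\mathbb{Z}$ of cardinality at most $30A^2\log(8K)e^{U/N}$ such that $$\biggl\{u\in\mathbb{Z}/U\mathbb{Z}:\ \Bigl|\sum_{p\in S}e(pu/U)\Bigr|\ge |S|/A\biggr\}\subset\prod_{i=1}^2\biggl\{\sum_{a\in\mathcal{D}_i}\epsilon(a)a:\ (\epsilon(a))\in\{0,\pm1\}^{\mathcal{D}_i}\biggr\},$$ where $\mathbb{Z}/U\mathbb{Z}$ is identified with $\mathbb{Z}/U_1\mathbb{Z}\times\mathbb{Z}/U_2\mathbb{Z}$ by the Chinese Remainder Theorem map $u\mapsto(u\bmod U_1,u\bmod U_2)$.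
   Context: Notation: $e(y)=\exp(2i\pi y)$; $|S|$ is the cardinality of $S$; the letter $p$ denotes a prime. *)

theory Defs
  imports Complex_Main "HOL-Number_Theory.Residues"
begin

definition e :: "real \<Rightarrow> complex" where
  "e y = exp (2 * \<i> * of_real pi * of_real y)"

(* Here and below, Z/mZ is the carrier {0..m-1} of the library's residue_ring m. *)

definition large_spectrum :: "nat set \<Rightarrow> real \<Rightarrow> nat \<Rightarrow> int set" where
  "large_spectrum S A U =
     {u \<in> carrier (residue_ring (int U)).
        cmod (\<Sum>p\<in>S. e (real p * real_of_int u / real U)) \<ge> real (card S) / A}"

definition signed_sums :: "nat \<Rightarrow> int set \<Rightarrow> int set" where
  "signed_sums m D = {(\<Sum>a\<in>D. \<epsilon> a * a) mod int m | \<epsilon>. \<epsilon> \<in> D \<rightarrow> {-1, 0, 1}}"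

definition crt_map :: "nat \<Rightarrow> nat \<Rightarrow> int \<Rightarrow> int \<times> int" where
  "crt_map U\<^sub>1 U\<^sub>2 u = (u mod int U\<^sub>1, u mod int U\<^sub>2)"

end

theory Submission
  imports Defs "HOL-Analysis.Analysis"
begin

text \<open>
  A maximal dissociated subset of the projection of the spectrum to \<open>\<int>/U\<^sub>i\<int>\<close> has the required
  signed sums, so it suffices to bound the size \<open>L\<close> of a dissociated subset \<open>X\<close> of the spectrum
  itself. With \<open>f n = (\<Sum>u\<in>X. cos (2 \<pi> (n u / U + \<phi> u)))\<close> for suitable phases, the average of \<open>f\<close>
  over \<open>S\<close> is at least \<open>L / A\<close>, and \<open>exp (t f)\<close> is at most \<open>exp (t\<^sup>2 L / 2)\<close> times a Riesz
  product \<open>R \<ge> 0\<close>.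

  Bounding the sum of \<open>R\<close> over \<open>S\<close> by its sum over all integers up to \<open>N\<close> loses a factor
  \<open>ln N\<close>, which the constant \<open>30\<close> absorbs unless \<open>ln (ln N) > 21\<close> and
  \<open>ln (8 K) e\<^bsup>U/N\<^esup>\<close> is smaller than \<open>ln (ln N) / 14\<close>.

  In the remaining range \<open>R\<close> is weighted by a sieve majorant of the primes, whose Fourier transform
  is about \<open>N / (\<phi>(q) ln N)\<close> near \<open>a / q\<close>. Dissociativity bounds the mass that the degree \<open>k\<close>
  part of \<open>R\<close>, with its coefficients of size \<open>(t / 2)\<^sup>k\<close>, can place near one fraction by
  \<open>t\<^sup>k\<close>, while its total mass is at most \<open>(t L)\<^sup>k / k!\<close>. Since there are only about \<open>Q\<^sup>2\<close>
  fractions with denominator up to \<open>Q\<close>, the two bounds together show that degree \<open>k\<close> contributes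
  at most a constant times \<open>((t\<^sup>2 L)\<^sup>k / k!)\<^bsup>1/2\<^esup>\<close>, and no logarithm is lost.
\<close>

section \<open>Exponential sums and Riesz products\<close>

text \<open>Summing the Riesz product over all integers ignores that S consists of primes; that is
  the source of the lost ln ln N. With a majorant of the primes the danger is that frequencies of
  degree k cluster near fractions with small denominator, where the majorant has its large Fourier
  coefficients. The total mass alone would cost exp(t L), no less than the gain exp(t L / A). The
  geometric mean of the two mass bounds replaces t L by t^2 L, the scale of the unavoidable loss
  exp(t^2 L / 2): summing over k costs exp(3 t^2 L / 4). Hence t = 2 / (5 A), which maximises t / A
  - 5 t^2 / 4 with value 1 / (5 A^2). Since 30 / 5 = 6, a dissociated set with more than 30 A^2 ln(8
  K) e^(U/N) elements forces (8 K)^6 \<le> 5331 K, which fails for K \<ge> 1/2. The factor e^(U/N)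
  pays for the step from N to N + U when frequencies are only known modulo U; the geometric mean
  sees just its square root.\<close>

lemma e_cis: "e x = cis (2 * pi * x)"
  by (simp add: e_def cis_conv_exp mult_ac)

lemma e_add: "e (x + y) = e x * e y"
  by (simp add: e_def algebra_simps exp_add)

lemma e_0 [simp]: "e 0 = 1"
  by (simp add: e_def)

lemma norm_e [simp]: "cmod (e x) = 1"
  by (simp add: e_cis)

lemma e_minus: "e (- x) = cnj (e x)"
  by (simp add: e_cis cis_cnj)

lemma e_of_int [simp]: "e (of_int n) = 1"
  by (auto simp: e_cis cis.ctr complex_eq_iff cos_int_2pin sin_int_2pin)

lemma e_mult_of_nat: "e (of_nat m * x) = e x ^ m"
  by (induction m) (simp_all add: algebra_simps e_add)

lemma e_sum: "finite A \<Longrightarrow> e (\<Sum>i\<in>A. f i) = (\<Prod>i\<in>A. e (f i))"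
  by (induction A rule: finite_induct) (simp_all add: e_add)

lemma e_eq_1_iff: "e x = 1 \<longleftrightarrow> x \<in> \<int>"
proof
  assume "e x = 1"
  then obtain n :: int where "2 * pi * x = of_int (2 * n) * pi"
    by (auto simp: e_def exp_eq_1)
  hence "x = of_int n" by simp
  thus "x \<in> \<int>" by simp
next
  assume "x \<in> \<int>"
  thus "e x = 1" by (auto elim!: Ints_cases)
qed

lemma sum_e_orthogonal:
  fixes n :: int
  assumes "d > 0"
  shows "(\<Sum>a<d. e (of_int n * real a / real d)) = (if int d dvd n then of_nat d else 0)"
proof (cases "int d dvd n")
  case True
  then obtain k where "n = int d * k" by auto
  hence "e (of_int n * real a / real d) = 1" for a
    using assms e_of_int[of "k * int a"] by (simp add: field_simps)
  thus ?thesis using True by simp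
next
  case False
  let ?z = "e (of_int n / real d)"
  have "of_int n / real d \<notin> \<int>"
  proof
    assume "of_int n / real d \<in> \<int>"
    then obtain k :: int where "of_int n / real d = of_int k" by (auto elim!: Ints_cases)
    hence "real_of_int n = of_int (int d * k)" using assms by (simp add: field_simps)
    hence "n = int d * k" by (simp only: of_int_eq_iff)
    with False show False by auto
  qed
  hence z: "?z \<noteq> 1" by (simp add: e_eq_1_iff)
  have "?z ^ d = 1"
    using e_mult_of_nat[of d "of_int n / real d"] assms by simp
  have "(\<Sum>a<d. e (of_int n * real a / real d)) = (\<Sum>a<d. ?z ^ a)"
    by (intro sum.cong refl) (simp flip: e_mult_of_nat add: mult_ac)
  also have "\<dots> = 0"
    using z \<open>?z ^ d = 1\<close> by (simp add: geometric_sum)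
  finally show ?thesis using False by simp
qed

lemma sum_e_orthogonal':
  fixes n :: int
  assumes "d > 0"
  shows "(\<Sum>a=1..d. e (of_int n * real a / real d)) = (if int d dvd n then of_nat d else 0)"
proof -
  let ?f = "\<lambda>a. e (of_int n * real a / real d)"
  have "(\<Sum>a=1..d. ?f a) = (\<Sum>a\<in>{1..<d}. ?f a) + ?f d"
    using assms by (cases d) (simp_all add: sum.atLeastLessThan_Suc atLeastLessThanSuc_atLeastAtMost[symmetric] del: sum.op_ivl_Suc of_nat_Suc)
  also have "?f d = ?f 0" using assms by simp
  also have "(\<Sum>a\<in>{1..<d}. ?f a) + ?f 0 = (\<Sum>a\<in>{0..<d}. ?f a)"
    using assms by (simp add: sum.atLeast_Suc_lessThan)
  also have "\<dots> = (\<Sum>a<d. ?f a)" by (simp add: atLeast0LessThan)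
  finally show ?thesis using sum_e_orthogonal[OF assms, of n] by simp
qed

text \<open>Reduction to lowest terms matches the numerators with the Farey fractions whose
  denominator divides d. Numerators run from 1 to d because \<open>totatives 1 = {1}\<close>: the
  integer point is represented by 1/1.\<close>

lemma sum_fractions_reduced:
  fixes h :: "real \<Rightarrow> 'a::comm_monoid_add"
  assumes "d > 0"
  shows "(\<Sum>a=1..d. h (real a / real d)) = (\<Sum>q | q dvd d. \<Sum>a\<in>totatives q. h (real a / real q))"
proof -
  have "(\<Sum>a=1..d. h (real a / real d)) =
        (\<Sum>(q, a)\<in>(SIGMA q:{q. q dvd d}. totatives q). h (real a / real q))"
  proof (rule sum.reindex_bij_witness
      [where i = "\<lambda>(q, a). a * (d div q)" and j = "\<lambda>a. (d div gcd a d, a div gcd a d)"], goal_cases)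
    case (1 a)
    have "d div (d div gcd a d) = gcd a d"
    proof -
      have *: "(d div gcd a d) * gcd a d = d" by simp
      hence "d div gcd a d \<noteq> 0" using assms by (intro notI) simp
      thus ?thesis by (metis * nonzero_mult_div_cancel_left)
    qed
    moreover have "a div gcd a d * gcd a d = a" by simp
    ultimately show ?case by simp
  next
    case (2 a)
    hence a: "a > 0" "a \<le> d" by auto
    have "coprime (a div gcd a d) (d div gcd a d)"
      using a by (intro div_gcd_coprime) auto
    moreover have "a div gcd a d \<le> d div gcd a d" using a by (simp add: div_le_mono)
    moreover have "a div gcd a d > 0" using a
      by (simp add: div_greater_zero_iff)
    moreover have "d div gcd a d dvd d" by (metis dvdI dvd_div_mult_self gcd_dvd2)
    ultimately show ?case by (auto simp: in_totatives_iff)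
  next
    case (3 p)
    then obtain q a where p: "p = (q, a)" "q dvd d" "a \<in> totatives q" by auto
    then obtain k where k: "d = q * k" by auto
    have "q > 0" "k > 0" using k assms by (auto intro: gr0I)
    have "gcd (a * k) (q * k) = k"
      using p gcd_mult_distrib_nat[of k a q] by (simp add: in_totatives_iff coprime_iff_gcd_eq_1 mult.commute)
    thus ?case using p k \<open>q > 0\<close> \<open>k > 0\<close> by simp
  next
    case (4 p)
    then obtain q a where p: "p = (q, a)" "q dvd d" "a \<in> totatives q" by auto
    then obtain k where k: "d = q * k" by auto
    thus ?case using p assms by (auto simp: in_totatives_iff)
  next
    case (5 a)
    hence "real a / real d = (real (a div gcd a d) * real (gcd a d)) / (real (d div gcd a d) * real (gcd a d))"
      by (simp flip: of_nat_mult)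
    also have "\<dots> = real (a div gcd a d) / real (d div gcd a d)"
      using assms by simp
    finally show ?case by simp
  qed
  also have "\<dots> = (\<Sum>q | q dvd d. \<Sum>a\<in>totatives q. h (real a / real q))"
    using assms by (subst sum.Sigma) auto
  finally show ?thesis .
qed

section \<open>Dissociated sets and the Fourier expansion of Riesz products\<close>

definition dissociated :: "int \<Rightarrow> int set \<Rightarrow> bool" where
  "dissociated m X \<longleftrightarrow>
     (\<forall>A\<subseteq>X. \<forall>\<sigma>\<in>A \<rightarrow> {-1, 1}. m dvd (\<Sum>u\<in>A. \<sigma> u * u) \<longrightarrow> A = {})"

lemma dissociatedD:
  "dissociated m X \<Longrightarrow> A \<subseteq> X \<Longrightarrow> \<sigma> \<in> A \<rightarrow> {-1, 1} \<Longrightarrow> m dvd (\<Sum>u\<in>A. \<sigma> u * u) \<Longrightarrow> A = {}"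
  unfolding dissociated_def by blast

lemma dissociated_subset: "dissociated m X \<Longrightarrow> Y \<subseteq> X \<Longrightarrow> dissociated m Y"
  by (auto simp: dissociated_def)

text \<open>Relations with coefficients in {-1, 0, 1}, stored as a support and its signs, so that
  \<open>card (fst p)\<close> is the degree of the term in the Riesz product. Extensional functions
  make each relation occur once.\<close>

definition signings :: "int set \<Rightarrow> (int set \<times> (int \<Rightarrow> int)) set" where
  "signings X = (SIGMA A:Pow X. A \<rightarrow>\<^sub>E {-1, 1})"

definition freq :: "int set \<times> (int \<Rightarrow> int) \<Rightarrow> int" where
  "freq p = (\<Sum>u\<in>fst p. snd p u * u)"

definition riesz :: "nat \<Rightarrow> int set \<Rightarrow> real \<Rightarrow> (int \<Rightarrow> real) \<Rightarrow> int \<Rightarrow> real" where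
  "riesz U X s \<phi> n = (\<Prod>u\<in>X. 1 + s * cos (2 * pi * (of_int (n * u) / real U + \<phi> u)))"

lemma finite_signings [simp]: "finite X \<Longrightarrow> finite (signings X)"
  unfolding signings_def by (intro finite_SigmaI) (auto intro: finite_PiE finite_subset)

text \<open>Each cosine is half of e(\<theta>) + e(-\<theta>); multiplying out chooses a support and
  a sign for each of its elements. The phases enter only as unimodular factors.\<close>

lemma riesz_expansion:
  assumes "finite X" "U > 0"
  shows "complex_of_real (riesz U X s \<phi> n) =
    (\<Sum>p\<in>signings X. of_real ((s / 2) ^ card (fst p)) * e (\<Sum>u\<in>fst p. of_int (snd p u) * \<phi> u) *
        e (of_int (n * freq p) / real U))"
proof -
  define \<theta> where "\<theta> u = of_int (n * u) / real U + \<phi> u" for u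
  have fac: "complex_of_real (1 + s * cos (2 * pi * \<theta> u)) =
      (\<Sum>x\<in>{-1, 1::int}. of_real (s / 2) * e (of_int x * \<theta> u)) + 1" for u
    by (simp add: e_minus complex_eq_iff) (simp add: e_cis)
  have "complex_of_real (riesz U X s \<phi> n) =
      (\<Prod>u\<in>X. (\<Sum>x\<in>{-1, 1::int}. of_real (s / 2) * e (of_int x * \<theta> u)) + 1)"
    unfolding riesz_def of_real_prod by (intro prod.cong refl, subst fac[symmetric]) (simp add: \<theta>_def)
  also have "\<dots> = (\<Sum>A\<in>Pow X. \<Prod>u\<in>A. \<Sum>x\<in>{-1, 1::int}. of_real (s / 2) * e (of_int x * \<theta> u))"
    using assms by (simp only: prod_add prod.neutral_const mult_1_right)
  also have "\<dots> = (\<Sum>A\<in>Pow X. \<Sum>\<sigma>\<in>A \<rightarrow>\<^sub>E {-1, 1}. \<Prod>u\<in>A. of_real (s / 2) * e (of_int (\<sigma> u) * \<theta> u))"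
    using assms by (intro sum.cong refl prod_sum_PiE) (auto intro: finite_subset)
  also have "\<dots> = (\<Sum>p\<in>signings X. \<Prod>u\<in>fst p. of_real (s / 2) * e (of_int (snd p u) * \<theta> u))"
    using assms unfolding signings_def
    by (subst sum.Sigma) (auto intro: finite_subset finite_PiE simp: case_prod_unfold)
  also have "\<dots> = (\<Sum>p\<in>signings X. of_real ((s / 2) ^ card (fst p)) *
      e (\<Sum>u\<in>fst p. of_int (snd p u) * \<phi> u) * e (of_int (n * freq p) / real U))"
  proof (intro sum.cong refl)
    fix p assume "p \<in> signings X"
    hence fin: "finite (fst p)" using assms by (auto simp: signings_def dest: finite_subset)
    have "(\<Sum>u\<in>fst p. of_int (snd p u) * \<theta> u) =
        (\<Sum>u\<in>fst p. of_int (snd p u) * \<phi> u) + of_int (n * freq p) / real U"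
      by (simp add: \<theta>_def freq_def sum.distrib sum_distrib_left sum_divide_distrib algebra_simps)
    thus "(\<Prod>u\<in>fst p. of_real (s / 2) * e (of_int (snd p u) * \<theta> u)) =
        of_real ((s / 2) ^ card (fst p)) * e (\<Sum>u\<in>fst p. of_int (snd p u) * \<phi> u) *
        e (of_int (n * freq p) / real U)"
      using fin by (simp only: prod.distrib e_sum[OF fin, symmetric] e_add prod_constant of_real_power mult.assoc)
  qed
  finally show ?thesis .
qed

lemma riesz_nonneg: "0 \<le> s \<Longrightarrow> s \<le> 1 \<Longrightarrow> riesz U X s \<phi> n \<ge> 0"
  unfolding riesz_def
proof (intro prod_nonneg)
  fix u assume s: "0 \<le> s" "s \<le> 1"
  have "\<bar>s * cos (2 * pi * (of_int (n * u) / real U + \<phi> u))\<bar> \<le> 1 * 1"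
    unfolding abs_mult using s by (intro mult_mono) auto
  thus "0 \<le> 1 + s * cos (2 * pi * (of_int (n * u) / real U + \<phi> u))" by linarith
qed

lemma dissociated_freq:
  assumes "dissociated m X" "p \<in> signings X" "m dvd freq p"
  shows "p = ({}, \<lambda>_. undefined)"
proof -
  obtain A \<sigma> where p: "p = (A, \<sigma>)" "A \<subseteq> X" "\<sigma> \<in> A \<rightarrow>\<^sub>E {-1, 1}"
    using assms by (auto simp: signings_def)
  hence "A = {}"
    using assms unfolding dissociated_def freq_def by (auto simp: PiE_def)
  with p show ?thesis by auto
qed

lemma empty_signing: "({}, \<lambda>_. undefined) \<in> signings X"
  by (auto simp: signings_def)

lemma sum_riesz_coeff:
  fixes \<xi> :: int
  assumes "finite X" "U > 0"
  shows "(\<Sum>n<U. of_real (riesz U X s \<phi> (int n)) * e (- (of_int \<xi> * real n / real U))) =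
    of_nat U * (\<Sum>p | p \<in> signings X \<and> int U dvd freq p - \<xi>.
        of_real ((s / 2) ^ card (fst p)) * e (\<Sum>u\<in>fst p. of_int (snd p u) * \<phi> u))"
    (is "_ = of_nat U * sum ?c _")
proof -
  have "(\<Sum>n<U. of_real (riesz U X s \<phi> (int n)) * e (- (of_int \<xi> * real n / real U))) =
     (\<Sum>n<U. \<Sum>p\<in>signings X. ?c p * e (of_int (freq p - \<xi>) * real n / real U))"
  proof -
    have "e (of_int (int n * freq p) / real U) * e (- (of_int \<xi> * real n / real U)) =
        e (of_int (freq p - \<xi>) * real n / real U)" for n p
    proof -
      have "of_int (int n * freq p) / real U + - (of_int \<xi> * real n / real U) =
          of_int (freq p - \<xi>) * real n / real U"
        by (simp add: algebra_simps diff_divide_distrib)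
      thus ?thesis by (simp only: e_add[symmetric])
    qed
    thus ?thesis unfolding riesz_expansion[OF assms] sum_distrib_right by (simp only: mult.assoc)
  qed
  also have "\<dots> = (\<Sum>p\<in>signings X. ?c p * (\<Sum>n<U. e (of_int (freq p - \<xi>) * real n / real U)))"
    by (subst sum.swap) (simp only: sum_distrib_left)
  also have "\<dots> = (\<Sum>p\<in>signings X. if int U dvd freq p - \<xi> then of_nat U * ?c p else 0)"
    unfolding sum_e_orthogonal[OF assms(2)] by (intro sum.cong refl) (simp add: mult.commute)
  also have "\<dots> = (\<Sum>p | p \<in> signings X \<and> int U dvd freq p - \<xi>. of_nat U * ?c p)"
    using assms by (intro sum.inter_filter[symmetric]) simp
  also have "\<dots> = of_nat U * (\<Sum>p | p \<in> signings X \<and> int U dvd freq p - \<xi>. ?c p)"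
    by (rule sum_distrib_left[symmetric])
  finally show ?thesis .
qed

text \<open>Only the empty relation has a frequency divisible by U, so the constant term 1 is the
  mean value, whatever s and the phases are.\<close>

lemma sum_riesz:
  assumes "finite X" "U > 0" "dissociated (int U) X"
  shows "(\<Sum>n<U. riesz U X s \<phi> (int n)) = real U"
proof -
  have "{p \<in> signings X. int U dvd freq p - 0} = {({}, \<lambda>_. undefined)}"
    using dissociated_freq[OF assms(3)] empty_signing by (auto simp: freq_def)
  with sum_riesz_coeff[OF assms(1,2), of s \<phi> 0]
  have "(\<Sum>n<U. complex_of_real (riesz U X s \<phi> (int n))) = of_nat U" by simp
  hence "complex_of_real (\<Sum>n<U. riesz U X s \<phi> (int n)) = complex_of_real (real U)"
    by (simp only: of_real_sum of_real_of_nat_eq)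
  thus ?thesis by (simp only: of_real_eq_iff)
qed

text \<open>The sum is a Fourier coefficient of a Riesz product with mean value 1.\<close>

lemma sum_signings_freq_le:
  assumes "finite X" "U > 0" "dissociated (int U) X"
  shows "(\<Sum>p | p \<in> signings X \<and> int U dvd freq p - \<xi>. (1 / 2) ^ card (fst p)) \<le> (1::real)"
    (is "?S \<le> 1")
proof -
  have "real U * ?S = cmod (of_nat U * (\<Sum>p | p \<in> signings X \<and> int U dvd freq p - \<xi>.
        of_real ((1 / 2) ^ card (fst p)) * e (\<Sum>u\<in>fst p. of_int (snd p u) * 0)))"
  proof -
    have "(\<Sum>p | p \<in> signings X \<and> int U dvd freq p - \<xi>.
        of_real ((1 / 2) ^ card (fst p)) * e (\<Sum>u\<in>fst p. of_int (snd p u) * 0)) = complex_of_real ?S"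
      by simp
    thus ?thesis by (simp only: norm_mult norm_of_real norm_of_nat) (simp add: sum_nonneg)
  qed
  also have "\<dots> \<le> (\<Sum>n<U. cmod (of_real (riesz U X 1 (\<lambda>_. 0) (int n)) * e (- (of_int \<xi> * real n / real U))))"
    unfolding sum_riesz_coeff[OF assms(1,2), of 1 "\<lambda>_. 0" \<xi>, symmetric] by (rule norm_sum)
  also have "\<dots> = (\<Sum>n<U. riesz U X 1 (\<lambda>_. 0) (int n))"
    by (intro sum.cong refl) (simp add: norm_mult riesz_nonneg)
  also have "\<dots> = real U" by (rule sum_riesz[OF assms])
  finally show ?thesis using assms(2) by simp
qed

lemma sum_signings_power:
  assumes "finite X"
  shows "(\<Sum>p | p \<in> signings X \<and> card (fst p) = k. (1::real)) = 2 ^ k * real (card X choose k)"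
proof -
  have "{p \<in> signings X. card (fst p) = k} = (SIGMA A:{A. A \<subseteq> X \<and> card A = k}. A \<rightarrow>\<^sub>E {-1, 1})"
    by (auto simp: signings_def)
  hence "card {p \<in> signings X. card (fst p) = k} = (\<Sum>A | A \<subseteq> X \<and> card A = k. card (A \<rightarrow>\<^sub>E {-1, 1::int}))"
    using assms by (simp only:, subst card_SigmaI) (auto intro: finite_PiE finite_subset)
  also have "\<dots> = (\<Sum>A | A \<subseteq> X \<and> card A = k. 2 ^ k)"
    using assms by (intro sum.cong refl) (auto simp: card_PiE finite_subset numeral_2_eq_2)
  also have "\<dots> = (card X choose k) * 2 ^ k"
    using assms by (simp add: n_subsets)
  finally show ?thesis by simp
qed

text \<open>A support of size k carries 2^k sign patterns, so the weights (1/2)^k add up to 1 per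
  support. Each residue class modulo U receives at most 1 of this mass.\<close>

lemma power_two_card_le:
  assumes "finite X" "U > 0" "dissociated (int U) X"
  shows "2 ^ card X \<le> real U"
proof -
  have "2 ^ card X = (\<Sum>A\<in>Pow X. \<Sum>\<sigma>\<in>A \<rightarrow>\<^sub>E {-1, 1::int}. (1 / 2) ^ card A :: real)"
  proof -
    have "(\<Sum>A\<in>Pow X. \<Sum>\<sigma>\<in>A \<rightarrow>\<^sub>E {-1, 1::int}. (1 / 2) ^ card A :: real) = (\<Sum>A\<in>Pow X. 1)"
      using assms by (intro sum.cong refl) (auto simp: card_PiE finite_subset power_one_over)
    thus ?thesis using assms by (simp add: card_Pow)
  qed
  also have "\<dots> = (\<Sum>p\<in>signings X. (1 / 2) ^ card (fst p))"
    using assms unfolding signings_def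
    by (subst sum.Sigma) (auto intro: finite_subset finite_PiE simp: case_prod_unfold)
  also have "\<dots> = (\<Sum>\<xi><U. \<Sum>p | p \<in> signings X \<and> nat (freq p mod int U) = \<xi>. (1 / 2) ^ card (fst p))"
    using assms by (intro sum.group[symmetric]) (auto simp: nat_less_iff)
  also have "\<dots> \<le> (\<Sum>\<xi><U. 1)"
  proof (intro sum_mono)
    fix \<xi> assume "\<xi> \<in> {..<U}"
    have "{p \<in> signings X. nat (freq p mod int U) = \<xi>} \<subseteq> {p \<in> signings X. int U dvd freq p - int \<xi>}"
      using assms by (auto simp: mod_eq_dvd_iff[symmetric])
    hence "(\<Sum>p | p \<in> signings X \<and> nat (freq p mod int U) = \<xi>. (1 / 2) ^ card (fst p))
      \<le> (\<Sum>p | p \<in> signings X \<and> int U dvd freq p - int \<xi>. (1 / 2) ^ card (fst p) :: real)"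
      using assms by (intro sum_mono2) auto
    also have "\<dots> \<le> 1" by (rule sum_signings_freq_le[OF assms])
    finally show "(\<Sum>p | p \<in> signings X \<and> nat (freq p mod int U) = \<xi>. (1 / 2) ^ card (fst p)) \<le> (1::real)" .
  qed
  finally show ?thesis by simp
qed

section \<open>Fejer means and fractions\<close>

lemma norm_e_minus_1: "cmod (e x - 1) = 2 * \<bar>sin (pi * x)\<bar>"
  using dist_exp_i_1[of "2 * pi * x"] by (simp add: e_def mult_ac)

lemma sin_ge_half:
  fixes x :: real
  assumes "0 \<le> x" "x \<le> pi / 2"
  shows "sin x \<ge> x / 2"
proof -
  have "\<bar>sin x - (\<Sum>m<3. sin_coeff m * x ^ m)\<bar> \<le> inverse (fact 3) * \<bar>x\<bar> ^ 3"
    by (rule Maclaurin_sin_bound)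
  moreover have "(\<Sum>m<3. sin_coeff m * x ^ m) = x"
    by (simp add: numeral_3_eq_3 sin_coeff_def)
  ultimately have "\<bar>sin x - x\<bar> \<le> x ^ 3 / 6"
    using assms by (simp add: fact_numeral divide_simps)
  moreover have "x ^ 3 \<le> 3 * x"
  proof -
    have "x \<le> 16 / 10" using assms pi_less_4 pi_approx by simp
    hence "x * x \<le> (16 / 10) * (16 / 10)" using assms by (intro mult_mono) auto
    hence "x * x \<le> 3" by simp
    hence "(x * x) * x \<le> 3 * x" using assms by (intro mult_right_mono) auto
    thus ?thesis by (simp add: power3_eq_cube)
  qed
  ultimately show ?thesis by linarith
qed

lemma norm_e_fraction_minus_1_ge:
  fixes c :: int
  assumes "M > 0" "\<not> int M dvd c"
  shows "cmod (e (of_int c / real M) - 1) \<ge> 2 / real M"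
proof -
  define r where "r = c mod int M"
  have "r \<noteq> 0" using assms unfolding r_def by (simp add: mod_eq_0_iff_dvd)
  moreover have "r \<ge> 0" "r < int M" using assms by (simp_all add: r_def)
  ultimately have r: "r > 0" "r < int M" by auto
  have "c = int M * (c div int M) + r" by (simp add: r_def)
  hence "real_of_int c = real M * of_int (c div int M) + of_int r"
    by (metis of_int_add of_int_mult of_int_of_nat_eq)
  hence "of_int c / real M = of_int (c div int M) + of_int r / real M"
    using assms by (simp add: add_divide_distrib)
  hence "cmod (e (of_int c / real M) - 1) = cmod (e (of_int r / real M) - 1)"
    by (simp add: e_add)
  also have "\<dots> = 2 * \<bar>sin (pi * (of_int r / real M))\<bar>"
    by (rule norm_e_minus_1)
  also have "\<dots> \<ge> 2 / real M"
  proof (cases "2 * r \<le> int M")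
    case True
    have "real_of_int r * 2 \<le> real M" using True by (metis mult.commute of_int_le_iff of_int_mult of_int_numeral of_int_of_nat_eq)
    hence "pi * (of_int r / real M) \<le> pi / 2"
      using assms by (simp add: field_simps)
    hence "sin (pi * (of_int r / real M)) \<ge> pi * (of_int r / real M) / 2"
      using r by (intro sin_ge_half) auto
    moreover have "pi * (of_int r / real M) \<ge> 2 * (1 / real M)"
      using r assms pi_gt3 by (intro mult_mono divide_right_mono) auto
    ultimately show ?thesis by simp
  next
    case False
    have "real_of_int r * 2 \<ge> real M" using False by (metis linorder_linear mult.commute of_int_le_iff of_int_mult of_int_numeral of_int_of_nat_eq)
    hence "pi * (1 - of_int r / real M) \<le> pi / 2"
      using assms by (simp add: field_simps)
    moreover have "real_of_int r + 1 \<le> real M" using r by linarith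
    hence *: "1 - of_int r / real M \<ge> 1 / real M"
      using assms by (simp add: field_simps)
    moreover have "0 \<le> pi * (1 - of_int r / real M)"
    proof (intro mult_nonneg_nonneg)
      have "0 \<le> 1 / real M" by simp
      with * show "0 \<le> 1 - of_int r / real M" by linarith
    qed simp
    ultimately have "sin (pi * (1 - of_int r / real M)) \<ge> pi * (1 - of_int r / real M) / 2"
      by (intro sin_ge_half)
    moreover have "sin (pi * (1 - of_int r / real M)) = sin (pi * (of_int r / real M))"
      using sin_pi_minus[of "pi * (of_int r / real M)"] by (simp add: algebra_simps)
    moreover have "pi * (1 - of_int r / real M) \<ge> 2 * (1 / real M)"
      using * assms pi_gt3 by (intro mult_mono) auto
    ultimately show ?thesis by simp
  qed
  finally show ?thesis .
qed

section \<open>Fejer kernel and Cesaro sums\<close>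

definition fejer :: "nat \<Rightarrow> real \<Rightarrow> real" where
  "fejer T x = (cmod (\<Sum>m<T. e (real m * x)))\<^sup>2 / real T"

text \<open>Grouped by n = m - m', this is the sum of (1 - |n| / T) h(n) over |n| < T. The double
  sum makes the value at an exponential a squared modulus, hence nonnegative.\<close>

definition cesaro :: "nat \<Rightarrow> (int \<Rightarrow> 'a::real_normed_field) \<Rightarrow> 'a" where
  "cesaro T h = (\<Sum>m<T. \<Sum>m'<T. h (int m - int m')) / of_nat T"

lemma cesaro_e: "cesaro T (\<lambda>n. e (of_int n * x)) = of_real (fejer T x)"
proof -
  let ?z = "\<Sum>m<T. e (real m * x)"
  have "(\<Sum>m<T. \<Sum>m'<T. e (of_int (int m - int m') * x)) = (\<Sum>m<T. \<Sum>m'<T. e (real m * x) * cnj (e (real m' * x)))"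
    by (intro sum.cong refl) (simp add: left_diff_distrib flip: e_minus e_add)
  also have "\<dots> = ?z * cnj ?z"
    by (simp add: sum_product)
  also have "\<dots> = of_real ((cmod ?z)\<^sup>2)"
    by (simp only: complex_norm_square)
  finally show ?thesis by (simp add: cesaro_def fejer_def)
qed

lemma cesaro_sum: "cesaro T (\<lambda>n. \<Sum>i\<in>I. h i n) = (\<Sum>i\<in>I. cesaro T (h i))"
proof -
  have "(\<Sum>m<T. \<Sum>m'<T. \<Sum>i\<in>I. h i (int m - int m')) = (\<Sum>i\<in>I. \<Sum>m<T. \<Sum>m'<T. h i (int m - int m'))"
  proof -
    have "(\<Sum>m<T. \<Sum>m'<T. \<Sum>i\<in>I. h i (int m - int m')) = (\<Sum>m<T. \<Sum>i\<in>I. \<Sum>m'<T. h i (int m - int m'))"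
      by (intro sum.cong refl sum.swap)
    also have "\<dots> = (\<Sum>i\<in>I. \<Sum>m<T. \<Sum>m'<T. h i (int m - int m'))"
      by (rule sum.swap)
    finally show ?thesis .
  qed
  thus ?thesis by (simp add: cesaro_def sum_divide_distrib)
qed

lemma cesaro_cmult: "cesaro T (\<lambda>n. c * h n) = c * cesaro T h"
  by (simp add: cesaro_def sum_distrib_left)

lemma cesaro_of_real: "cesaro T (\<lambda>n. complex_of_real (h n)) = of_real (cesaro T h)"
  by (simp add: cesaro_def)

text \<open>Each n in 1..N arises as m - m' at least T - N \<ge> T / 2 times, so its weight is at
  least 1/2.\<close>

lemma cesaro_ge:
  fixes h :: "int \<Rightarrow> real"
  assumes "\<And>n. h n \<ge> 0" "2 * N \<le> T"
  shows "(\<Sum>n=1..N. h (int n)) \<le> 2 * cesaro T h"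
proof (cases "T = 0")
  case False
  have "(\<Sum>m<T. \<Sum>m'<T. h (int m - int m')) = (\<Sum>m'<T. \<Sum>m<T. h (int m - int m'))"
    by (rule sum.swap)
  also have "\<dots> \<ge> (\<Sum>m'<T - N. \<Sum>m<T. h (int m - int m'))"
    using assms by (intro sum_mono2 sum_nonneg) auto
  moreover have "(\<Sum>m'<T - N. \<Sum>m<T. h (int m - int m')) \<ge> (\<Sum>m'<T - N. \<Sum>n=1..N. h (int n))"
  proof (intro sum_mono)
    fix m' assume m': "m' \<in> {..<T - N}"
    have "(\<Sum>n=1..N. h (int n)) = (\<Sum>m\<in>{m'+1..m'+N}. h (int m - int m'))"
      by (rule sum.reindex_bij_witness[where i = "\<lambda>m. m - m'" and j = "\<lambda>n. n + m'"]) auto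
    also have "\<dots> \<le> (\<Sum>m<T. h (int m - int m'))"
      using assms m' by (intro sum_mono2) auto
    finally show "(\<Sum>n=1..N. h (int n)) \<le> (\<Sum>m<T. h (int m - int m'))" .
  qed
  moreover have "real T / 2 * (\<Sum>n=1..N. h (int n)) \<le> real (T - N) * (\<Sum>n=1..N. h (int n))"
    using assms by (intro mult_right_mono sum_nonneg) auto
  ultimately have "real T / 2 * (\<Sum>n=1..N. h (int n)) \<le> (\<Sum>m<T. \<Sum>m'<T. h (int m - int m'))"
    by simp
  thus ?thesis using False by (simp add: cesaro_def field_simps)
next
  case True
  thus ?thesis using assms by (simp add: cesaro_def)
qed

lemma fejer_nonneg: "fejer T x \<ge> 0"
  by (simp add: fejer_def)

lemma fejer_le: "fejer T x \<le> real T"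
proof -
  have "cmod (\<Sum>m<T. e (real m * x)) \<le> real T"
    using norm_sum[of "\<lambda>m. e (real m * x)" "{..<T}"] by simp
  hence "(cmod (\<Sum>m<T. e (real m * x)))\<^sup>2 \<le> (real T)\<^sup>2" by (intro power_mono) auto
  thus ?thesis by (cases "T = 0") (simp_all add: fejer_def divide_simps power2_eq_square)
qed

lemma fejer_le_far:
  assumes "\<delta> > 0" "cmod (e x - 1) \<ge> \<delta>"
  shows "fejer T x \<le> (2 / \<delta>)\<^sup>2 / real T"
proof -
  have "e x \<noteq> 1" using assms by auto
  hence "(\<Sum>m<T. e (real m * x)) = (e x ^ T - 1) / (e x - 1)"
    by (simp add: e_mult_of_nat geometric_sum)
  hence "cmod (\<Sum>m<T. e (real m * x)) = cmod (e x ^ T - 1) / cmod (e x - 1)"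
    by (simp add: norm_divide)
  also have "\<dots> \<le> 2 / \<delta>"
  proof (intro frac_le)
    show "cmod (e x ^ T - 1) \<le> 2"
      using norm_triangle_ineq4[of "e x ^ T" 1] by (simp add: norm_power)
  qed (use assms in auto)
  finally show ?thesis
    unfolding fejer_def by (intro divide_right_mono power_mono) auto
qed

lemma card_cong_less:
  fixes m U T :: nat
  assumes "U > 0"
  shows "real (card {m'. m' < T \<and> int U dvd int m - int m'}) \<le> real T / real U + 1"
proof -
  let ?M = "{m'. m' < T \<and> int U dvd int m - int m'}"
  have eq: "m' mod U = m mod U" if "m' \<in> ?M" for m'
  proof -
    have "int m mod int U = int m' mod int U" using that by (simp add: mod_eq_dvd_iff)
    thus ?thesis by (metis nat_int zmod_int)
  qed
  have "inj_on (\<lambda>m'. m' div U) ?M"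
    by (intro inj_onI) (metis eq div_mod_decomp)
  moreover have "(\<lambda>m'. m' div U) ` ?M \<subseteq> {..T div U}"
    by (auto intro: div_le_mono)
  ultimately have "card ?M \<le> card {..T div U}"
    by (intro card_inj_on_le) auto
  hence "real (card ?M) \<le> real (T div U) + 1" by simp
  also have "real (T div U) \<le> real T / real U" by (rule of_nat_div_le_of_nat)
  finally show ?thesis by simp
qed

text \<open>Summing over the U translates keeps only the n divisible by U, and for each m at most T
  / U + 1 of the m' are congruent to it. The summand U is the origin of the factor e^(U/N).\<close>

lemma sum_fejer_translates:
  assumes "U > 0"
  shows "(\<Sum>\<xi><U. fejer T (real \<xi> / real U + \<alpha>)) \<le> real T + real U"
proof (cases "T = 0")
  case False
  have "complex_of_real (\<Sum>\<xi><U. fejer T (real \<xi> / real U + \<alpha>)) =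
      (\<Sum>\<xi><U. cesaro T (\<lambda>n. e (of_int n * (real \<xi> / real U + \<alpha>))))"
    by (simp add: cesaro_e)
  also have "\<dots> = cesaro T (\<lambda>n. \<Sum>\<xi><U. e (of_int n * (real \<xi> / real U + \<alpha>)))"
    by (rule cesaro_sum[symmetric])
  also have "(\<lambda>n. \<Sum>\<xi><U. e (of_int n * (real \<xi> / real U + \<alpha>))) =
      (\<lambda>n. e (of_int n * \<alpha>) * (if int U dvd n then of_nat U else 0))"
    unfolding sum_e_orthogonal[OF assms, symmetric] sum_distrib_left
    by (intro ext sum.cong refl) (simp add: distrib_left e_add)
  finally have "(\<Sum>\<xi><U. fejer T (real \<xi> / real U + \<alpha>)) =
      cmod (cesaro T (\<lambda>n. e (of_int n * \<alpha>) * (if int U dvd n then of_nat U else 0)))"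
    by (metis abs_of_nonneg fejer_nonneg norm_of_real sum_nonneg)
  also have "\<dots> \<le> (\<Sum>m<T. \<Sum>m'<T. if int U dvd int m - int m' then real U else 0) / real T"
    unfolding cesaro_def norm_divide norm_of_nat
    by (intro divide_right_mono sum_norm_le) (auto simp: norm_mult)
  also have "\<dots> = (\<Sum>m<T. real U * real (card {m'. m' < T \<and> int U dvd int m - int m'})) / real T"
  proof -
    have "(\<Sum>m'<T. if int U dvd int m - int m' then real U else 0) =
        real U * real (card {m'. m' < T \<and> int U dvd int m - int m'})" for m
    proof -
      have "{m' \<in> {..<T}. int U dvd int m - int m'} = {m'. m' < T \<and> int U dvd int m - int m'}" by auto
      thus ?thesis by (simp add: sum.inter_filter[symmetric])
    qed
    thus ?thesis by simp
  qed
  also have "\<dots> \<le> (\<Sum>m<T. real U * (real T / real U + 1)) / real T"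
    using card_cong_less[OF assms] by (intro divide_right_mono sum_mono mult_left_mono) auto
  also have "\<dots> = real T + real U"
    using assms False by (simp add: field_simps)
  finally show ?thesis .
qed (simp add: fejer_def)

text \<open>Points at chord distance 2 \<delta> leave at most one within \<delta> of 1, bounded by
  the peak T of the kernel; the others are bounded by its decay.\<close>

lemma sum_fejer_separated:
  assumes "finite I" "\<delta> > 0"
    and "\<And>i j. i \<in> I \<Longrightarrow> j \<in> I \<Longrightarrow> i \<noteq> j \<Longrightarrow> cmod (e (f i) - e (f j)) \<ge> 2 * \<delta>"
  shows "(\<Sum>i\<in>I. fejer T (x + f i)) \<le> real T + real (card I) * ((2 / \<delta>)\<^sup>2 / real T)"
proof -
  define near where "near = {i\<in>I. cmod (e (x + f i) - 1) < \<delta>}"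
  have "card near \<le> 1"
  proof -
    have "i = j" if "i \<in> near" "j \<in> near" for i j
    proof (rule ccontr)
      assume "i \<noteq> j"
      have "cmod (e (f i) - e (f j)) = cmod (e (x + f i) - e (x + f j))"
        by (simp add: e_add norm_mult flip: right_diff_distrib)
      also have "\<dots> \<le> cmod (e (x + f i) - 1) + cmod (e (x + f j) - 1)"
        using norm_triangle_ineq4[of "e (x + f i) - 1" "e (x + f j) - 1"] by simp
      also have "\<dots> < 2 * \<delta>" using that by (simp add: near_def)
      finally show False using assms(3)[of i j] that \<open>i \<noteq> j\<close> by (auto simp: near_def)
    qed
    hence "near = {} \<or> (\<exists>i. near = {i})" by blast
    thus ?thesis by auto
  qed
  have "(\<Sum>i\<in>I. fejer T (x + f i)) = (\<Sum>i\<in>near. fejer T (x + f i)) + (\<Sum>i\<in>I - near. fejer T (x + f i))"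
    using sum.subset_diff[of near I "\<lambda>i. fejer T (x + f i)"] assms by (auto simp: near_def)
  also have "(\<Sum>i\<in>near. fejer T (x + f i)) \<le> real (card near) * real T"
    using sum_mono[of near "\<lambda>i. fejer T (x + f i)" "\<lambda>_. real T"] fejer_le by simp
  also have "\<dots> \<le> 1 * real T"
    using \<open>card near \<le> 1\<close> by (intro mult_right_mono) auto
  also have "(\<Sum>i\<in>I - near. fejer T (x + f i)) \<le> (\<Sum>i\<in>I - near. (2 / \<delta>)\<^sup>2 / real T)"
    using assms by (intro sum_mono fejer_le_far) (auto simp: near_def)
  also have "\<dots> \<le> (\<Sum>i\<in>I. (2 / \<delta>)\<^sup>2 / real T)"
    using assms by (intro sum_mono2) auto
  finally show ?thesis by simp
qed

lemma norm_e_fractions_ge: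
  assumes "a \<in> totatives q" "a' \<in> totatives q'" "(q, a) \<noteq> (q', a')" "q \<le> D" "q' \<le> D"
  shows "cmod (e (real a / real q) - e (real a' / real q')) \<ge> 2 / real D ^ 2"
proof -
  have a: "0 < a" "a \<le> q" "coprime a q" and a': "0 < a'" "a' \<le> q'" "coprime a' q'"
    using assms by (auto simp: in_totatives_iff)
  have q: "q > 0" "q' > 0" using a a' by auto
  \<comment> \<open>Both fractions lie in (0, 1], so the numerator c of their difference over q q'
    satisfies |c| < q q'. A multiple of q q' would thus be 0, and equal reduced fractions
    coincide.\<close>
  define c where "c = int a * int q' - int a' * int q"
  have "\<not> int (q * q') dvd c"
  proof
    assume dvd: "int (q * q') dvd c"
    have "c < int (q * q')"
    proof -
      have "int a * int q' \<le> int q * int q'" using a by (intro mult_right_mono) auto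
      moreover have "0 < int a' * int q" using a' q by simp
      ultimately show ?thesis by (simp add: c_def)
    qed
    moreover have "- c < int (q * q')"
    proof -
      have "int a' * int q \<le> int q' * int q" using a' by (intro mult_right_mono) auto
      moreover have "0 < int a * int q'" using a q by simp
      ultimately show ?thesis by (simp add: c_def mult.commute)
    qed
    ultimately have "\<bar>c\<bar> < int (q * q')" by simp
    with dvd have "c = 0" by (metis dvd_imp_le_int abs_of_nat linorder_not_less)
    hence eq: "a * q' = a' * q" unfolding c_def by (metis eq_iff_diff_eq_0 of_nat_eq_iff of_nat_mult)
    have "q dvd q'" using eq a by (metis coprime_commute coprime_dvd_mult_right_iff dvd_triv_right)
    moreover have "q' dvd q" using eq a' by (metis coprime_commute coprime_dvd_mult_right_iff dvd_triv_right)
    ultimately have "q = q'" by (rule dvd_antisym)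
    with eq q assms(3) show False by simp
  qed
  hence "cmod (e (of_int c / real (q * q')) - 1) \<ge> 2 / real (q * q')"
    using q by (intro norm_e_fraction_minus_1_ge) auto
  also have "real_of_int c / real (q * q') = real a / real q - real a' / real q'"
    using q by (simp add: c_def field_simps)
  also have "cmod (e (real a / real q - real a' / real q') - 1) =
      cmod (e (real a' / real q')) * cmod (e (real a / real q - real a' / real q') - 1)"
    by simp
  also have "\<dots> = cmod (e (real a / real q) - e (real a' / real q'))"
    by (simp add: right_diff_distrib flip: norm_mult e_add del: norm_e)
  finally have "cmod (e (real a / real q) - e (real a' / real q')) \<ge> 2 / real (q * q')" .
  moreover have "2 / real D ^ 2 \<le> 2 / real (q * q')"
  proof (intro divide_left_mono)
    have "q * q' \<le> D * D" using assms by (intro mult_mono) auto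
    thus "real (q * q') \<le> real D ^ 2" unfolding power2_eq_square by (metis of_nat_le_iff of_nat_mult)
  qed (use q assms in auto)
  ultimately show ?thesis by linarith
qed

definition farey :: "nat set \<Rightarrow> (nat \<times> nat) set" where
  "farey Q = (SIGMA q:Q. totatives q)"

lemma finite_farey [simp]: "finite Q \<Longrightarrow> finite (farey Q)"
  by (auto simp: farey_def)

text \<open>There are at most D^2 fractions, at chord distance at least 2 / D^2. With \<delta> = 1 /
  D^2 the decay term is 4 D^6 / T, which is at most T once D^3 \<le> T / 2.\<close>

lemma sum_fejer_farey:
  assumes "Q \<subseteq> {1..D}"
  shows "(\<Sum>(q, a)\<in>farey Q. fejer T (x + real a / real q)) \<le> real T + 4 * real D ^ 6 / real T"
proof -
  have fin: "finite Q" using assms finite_subset by blast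
  have sub: "farey Q \<subseteq> {1..D} \<times> {1..D}"
    using assms by (force simp: farey_def in_totatives_iff)
  have card: "card (farey Q) \<le> D ^ 2"
    using card_mono[OF _ sub] by (simp add: card_cartesian_product power2_eq_square)
  show ?thesis
  proof (cases "D = 0")
    case True
    hence "farey Q = {}" using sub by auto
    thus ?thesis by simp
  next
    case False
    have "(\<Sum>p\<in>farey Q. fejer T (x + real (snd p) / real (fst p))) \<le>
        real T + real (card (farey Q)) * ((2 / (1 / real D ^ 2))\<^sup>2 / real T)"
    proof (intro sum_fejer_separated)
      fix i j assume "i \<in> farey Q" "j \<in> farey Q" "i \<noteq> j"
      moreover obtain q a q' a' where ij: "i = (q, a)" "j = (q', a')" by force
      ultimately have "cmod (e (real a / real q) - e (real a' / real q')) \<ge> 2 / real D ^ 2"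
        using assms by (intro norm_e_fractions_ge) (auto simp: farey_def)
      thus "2 * (1 / real D ^ 2) \<le> cmod (e (real (snd i) / real (fst i)) - e (real (snd j) / real (fst j)))"
        by (simp add: ij)
    qed (use fin False in auto)
    also have "\<dots> \<le> real T + real (D ^ 2) * ((2 / (1 / real D ^ 2))\<^sup>2 / real T)"
      using card by (intro add_left_mono mult_right_mono of_nat_mono) auto
    also have "\<dots> = real T + 4 * real D ^ 6 / real T"
      by (simp add: power_mult_distrib flip: power_mult power_add)
    finally show ?thesis by (simp add: case_prod_unfold)
  qed
qed

section \<open>Riesz products against a divisor sum\<close>

lemma fejer_add_of_int: "fejer T (x + of_int k) = fejer T x"
proof -
  have "e (real m * (x + of_int k)) = e (real m * x)" for m
    using e_of_int[of "int m * k"] by (simp add: distrib_left e_add)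
  thus ?thesis by (simp add: fejer_def)
qed

text \<open>By dissociativity at most 2^k signings of degree k share a frequency modulo U. The
  kernel depends only on that residue, and its sum over all residues is at most T + U.\<close>

lemma sum_signings_fejer_le:
  assumes "finite X" "U > 0" "dissociated (int U) X"
  shows "(\<Sum>p | p \<in> signings X \<and> card (fst p) = k. fejer T (of_int (freq p) / real U + \<alpha>))
    \<le> 2 ^ k * (real T + real U)"
proof -
  define P where "P = {p \<in> signings X. card (fst p) = k}"
  have fin: "finite P" using assms by (simp add: P_def)
  have "(\<Sum>p\<in>P. fejer T (of_int (freq p) / real U + \<alpha>)) =
      (\<Sum>\<xi><U. \<Sum>p | p \<in> P \<and> nat (freq p mod int U) = \<xi>. fejer T (of_int (freq p) / real U + \<alpha>))"
    using assms fin by (intro sum.group[symmetric]) (auto simp: nat_less_iff)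
  also have "\<dots> = (\<Sum>\<xi><U. \<Sum>p | p \<in> P \<and> nat (freq p mod int U) = \<xi>.
      2 ^ k * ((1 / 2) ^ card (fst p) * fejer T (real \<xi> / real U + \<alpha>)))"
  proof (intro sum.cong refl)
    fix \<xi> p assume \<xi>: "\<xi> \<in> {..<U}" "p \<in> {p \<in> P. nat (freq p mod int U) = \<xi>}"
    have "freq p = freq p mod int U + int U * (freq p div int U)" by simp
    also have "freq p mod int U = int \<xi>" using \<xi> assms by auto
    finally have "real_of_int (freq p) = real \<xi> + real U * of_int (freq p div int U)"
      by (metis of_int_add of_int_mult of_int_of_nat_eq)
    hence "of_int (freq p) / real U + \<alpha> = real \<xi> / real U + \<alpha> + of_int (freq p div int U)"
      using assms by (simp add: field_simps)
    hence "fejer T (of_int (freq p) / real U + \<alpha>) = fejer T (real \<xi> / real U + \<alpha>)"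
      by (simp only: fejer_add_of_int)
    thus "fejer T (of_int (freq p) / real U + \<alpha>) =
        2 ^ k * ((1 / 2) ^ card (fst p) * fejer T (real \<xi> / real U + \<alpha>))"
      using \<xi> by (simp add: P_def power_one_over)
  qed
  also have "\<dots> = (\<Sum>\<xi><U. 2 ^ k * (fejer T (real \<xi> / real U + \<alpha>) *
      (\<Sum>p | p \<in> P \<and> nat (freq p mod int U) = \<xi>. (1 / 2) ^ card (fst p))))"
    by (simp add: sum_distrib_left mult_ac)
  also have "\<dots> \<le> (\<Sum>\<xi><U. 2 ^ k * (fejer T (real \<xi> / real U + \<alpha>) * 1))"
  proof (intro sum_mono mult_left_mono)
    fix \<xi> assume "\<xi> \<in> {..<U}"
    have "{p \<in> P. nat (freq p mod int U) = \<xi>} \<subseteq> {p \<in> signings X. int U dvd freq p - int \<xi>}"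
      using assms by (auto simp: P_def mod_eq_dvd_iff[symmetric])
    hence "(\<Sum>p | p \<in> P \<and> nat (freq p mod int U) = \<xi>. (1 / 2) ^ card (fst p))
      \<le> (\<Sum>p | p \<in> signings X \<and> int U dvd freq p - int \<xi>. (1 / 2) ^ card (fst p) :: real)"
      using assms by (intro sum_mono2) auto
    also have "\<dots> \<le> 1" by (rule sum_signings_freq_le[OF assms])
    finally show "(\<Sum>p | p \<in> P \<and> nat (freq p mod int U) = \<xi>. (1 / 2) ^ card (fst p)) \<le> (1::real)" .
  qed (simp_all add: fejer_nonneg)
  also have "\<dots> = 2 ^ k * (\<Sum>\<xi><U. fejer T (real \<xi> / real U + \<alpha>))"
    by (simp add: sum_distrib_left)
  also have "\<dots> \<le> 2 ^ k * (real T + real U)"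
    using sum_fejer_translates[OF assms(2)] by (intro mult_left_mono) auto
  finally show ?thesis by (simp add: P_def)
qed

lemma binomial_le_pow_fact: "real (n choose k) \<le> real n ^ k / fact k"
proof -
  have "real ((n choose k) * fact k) \<le> real (n ^ k)"
    using binomial_fact_pow[of n k] of_nat_mono by blast
  thus ?thesis by (simp add: field_simps)
qed

text \<open>
  Splitting at a denominator \<open>Q\<close> would suffice if the weight were \<open>1 / q\<close>; the expansion of
  \<open>q / \<phi>(q)\<close> over divisors \<open>d\<close> reduces to this with a different \<open>Q\<close> for each \<open>d\<close>.
\<close>

lemma sum_totient_weight_le:
  fixes N :: "nat \<times> nat \<Rightarrow> real"
  assumes Q: "finite Q" "0 \<notin> Q"
    and N: "\<And>p. p \<in> farey Q \<Longrightarrow> N p \<ge> 0" "\<And>p. p \<in> farey Q \<Longrightarrow> N p \<le> B" "(\<Sum>p\<in>farey Q. N p) \<le> B'"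
    and B: "B > 0" "B' > 0"
    and g: "finite E" "0 \<notin> E" "\<And>d. d \<in> E \<Longrightarrow> g d \<ge> 0" "(\<Sum>d\<in>E. g d / sqrt (real d)) \<le> S0"
    and tot: "\<And>q. q \<in> Q \<Longrightarrow> 1 / real (totient q) \<le> (\<Sum>d | d \<in> E \<and> d dvd q. g d) / real q"
  shows "(\<Sum>(q, a)\<in>farey Q. N (q, a) / real (totient q)) \<le> 2 * S0 * sqrt (B * B')"
proof -
  define n where "n q = (\<Sum>a\<in>totatives q. N (q, a))" for q
  have farey_sum: "(\<Sum>(q, a)\<in>farey Q. f q a) = (\<Sum>q\<in>Q. \<Sum>a\<in>totatives q. f q a)" for f :: "nat \<Rightarrow> nat \<Rightarrow> real"
    using Q by (simp add: farey_def sum.Sigma)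
  have n_nonneg: "n q \<ge> 0" if "q \<in> Q" for q
    unfolding n_def using N(1) that by (intro sum_nonneg) (auto simp: farey_def)
  have n_le: "n q \<le> real q * B" if "q \<in> Q" for q
  proof -
    have "n q \<le> (\<Sum>a\<in>totatives q. B)"
      unfolding n_def using N(2) that by (intro sum_mono) (auto simp: farey_def)
    also have "\<dots> = real (totient q) * B" by (simp add: totient_def)
    also have "\<dots> \<le> real q * B" using B by (intro mult_right_mono) (auto simp: totient_le)
    finally show ?thesis .
  qed
  have n_sum: "(\<Sum>q\<in>Q. n q) \<le> B'"
    using N(3) farey_sum[of "\<lambda>q a. N (q, a)"] by (simp add: n_def case_prod_unfold)
  have per_d: "(\<Sum>q | q \<in> Q \<and> d dvd q. n q / real q) \<le> 2 * (sqrt (B * B') / sqrt (real d))"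
    if d: "d \<in> E" for d
  proof -
    have d0: "d > 0" using d g(2) by (metis gr0I)
    \<comment> \<open>Denominators up to P contribute at most B each, and at most P / d of them are
      multiples of d; the others contribute at most B' / P altogether. This P makes the two amounts
      equal.\<close>
    define P where "P = sqrt (real d * B' / B)"
    have P: "P > 0" using d0 B by (simp add: P_def)
    define Qd where "Qd = {q \<in> Q. d dvd q}"
    have finQd: "finite Qd" using Q by (simp add: Qd_def)
    have "(\<Sum>q\<in>Qd. n q / real q) =
        (\<Sum>q | q \<in> Qd \<and> real q \<le> P. n q / real q) + (\<Sum>q | q \<in> Qd \<and> \<not> real q \<le> P. n q / real q)"
      using finQd by (subst sum.union_disjoint[symmetric]) (auto intro!: sum.cong)
    also have "(\<Sum>q | q \<in> Qd \<and> real q \<le> P. n q / real q) \<le> (\<Sum>q | q \<in> Qd \<and> real q \<le> P. B)"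
    proof (intro sum_mono)
      fix q assume "q \<in> {q \<in> Qd. real q \<le> P}"
      hence q: "q \<in> Q" by (simp add: Qd_def)
      hence "q > 0" using Q(2) by (metis gr0I)
      thus "n q / real q \<le> B" using n_le[OF q] by (simp add: field_simps)
    qed
    also have "\<dots> = B * real (card {q \<in> Qd. real q \<le> P})" by simp
    also have "\<dots> \<le> B * (P / real d)"
    proof (intro mult_left_mono)
      have "(\<lambda>q. q div d) ` {q \<in> Qd. real q \<le> P} \<subseteq> {1..nat \<lfloor>P / real d\<rfloor>}"
      proof safe
        fix q assume q: "q \<in> Qd" "real q \<le> P"
        then obtain k where k: "q = d * k" by (auto simp: Qd_def)
        have "k > 0" using q k Q(2) by (auto simp: Qd_def intro: gr0I)
        moreover have "real k \<le> P / real d" using q k d0 by (simp add: field_simps)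
        ultimately show "q div d \<in> {1..nat \<lfloor>P / real d\<rfloor>}"
          using k d0 by (simp add: le_nat_floor)
      qed
      moreover have "inj_on (\<lambda>q. q div d) {q \<in> Qd. real q \<le> P}"
        by (intro inj_onI) (metis (mono_tags, lifting) Qd_def dvd_div_mult_self mem_Collect_eq)
      ultimately have "card {q \<in> Qd. real q \<le> P} \<le> card {1..nat \<lfloor>P / real d\<rfloor>}"
        by (intro card_inj_on_le) auto
      hence "real (card {q \<in> Qd. real q \<le> P}) \<le> real (nat \<lfloor>P / real d\<rfloor>)" by simp
      also have "\<dots> \<le> P / real d" using P d0 by simp
      finally show "real (card {q \<in> Qd. real q \<le> P}) \<le> P / real d" .
    qed (use B in auto)
    also have "(\<Sum>q | q \<in> Qd \<and> \<not> real q \<le> P. n q / real q) \<le> (\<Sum>q | q \<in> Qd \<and> \<not> real q \<le> P. n q / P)"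
      using P n_nonneg by (intro sum_mono divide_left_mono) (auto simp: Qd_def)
    also have "\<dots> \<le> (\<Sum>q\<in>Q. n q / P)"
      using Q P n_nonneg by (intro sum_mono2) (auto simp: Qd_def)
    also have "\<dots> \<le> B' / P"
      using n_sum P by (simp add: divide_right_mono flip: sum_divide_distrib)
    also have "B * (P / real d) = sqrt (B * B') / sqrt (real d)"
      using d0 B by (simp add: P_def real_sqrt_mult real_sqrt_divide divide_simps) 
    also have "B' / P = sqrt (B * B') / sqrt (real d)"
      using d0 B by (simp add: P_def real_sqrt_mult real_sqrt_divide divide_simps) 
    finally show ?thesis by (simp add: Qd_def)
  qed
  have "(\<Sum>(q, a)\<in>farey Q. N (q, a) / real (totient q)) = (\<Sum>q\<in>Q. n q * (1 / real (totient q)))"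
    unfolding farey_sum by (simp add: n_def sum_divide_distrib)
  also have "\<dots> \<le> (\<Sum>q\<in>Q. n q * ((\<Sum>d | d \<in> E \<and> d dvd q. g d) / real q))"
    using n_nonneg tot by (intro sum_mono mult_left_mono) auto
  also have "\<dots> = (\<Sum>q\<in>Q. \<Sum>d | d \<in> E \<and> d dvd q. g d * (n q / real q))"
    by (simp add: sum_distrib_left sum_divide_distrib mult_ac)
  also have "\<dots> = (\<Sum>d\<in>E. \<Sum>q | q \<in> Q \<and> d dvd q. g d * (n q / real q))"
    using Q g by (intro sum.swap_restrict) auto
  also have "\<dots> = (\<Sum>d\<in>E. g d * (\<Sum>q | q \<in> Q \<and> d dvd q. n q / real q))"
    by (simp only: sum_distrib_left)
  also have "\<dots> \<le> (\<Sum>d\<in>E. g d * (2 * (sqrt (B * B') / sqrt (real d))))"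
    using per_d g by (intro sum_mono mult_left_mono) auto
  also have "\<dots> = 2 * sqrt (B * B') * (\<Sum>d\<in>E. g d / sqrt (real d))"
    by (simp add: sum_distrib_left mult_ac)
  also have "\<dots> \<le> 2 * sqrt (B * B') * S0"
    using g B by (intro mult_left_mono) auto
  finally show ?thesis by (simp add: mult_ac)
qed

section \<open>Divisor sums and their Fourier coefficients\<close>

definition divisor_sum :: "'i set \<Rightarrow> ('i \<Rightarrow> nat) \<Rightarrow> ('i \<Rightarrow> real) \<Rightarrow> int \<Rightarrow> real" where
  "divisor_sum I d c n = (\<Sum>i | i \<in> I \<and> int (d i) dvd n. c i)"

text \<open>The Fourier coefficient of the divisor sum at every reduced fraction with denominator q:
  each condition d | n is detected by the additive characters modulo d, and their fractions are then
  reduced.\<close>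

definition divisor_weight :: "'i set \<Rightarrow> ('i \<Rightarrow> nat) \<Rightarrow> ('i \<Rightarrow> real) \<Rightarrow> nat \<Rightarrow> real" where
  "divisor_weight I d c q = (\<Sum>i | i \<in> I \<and> q dvd d i. c i / real (d i))"

lemma cesaro_divisor_sum:
  assumes "finite I" "\<And>i. i \<in> I \<Longrightarrow> d i > 0" "Q = {q. \<exists>i\<in>I. q dvd d i}"
  shows "cesaro T (\<lambda>n. of_real (divisor_sum I d c n) * e (of_int n * x)) =
    of_real (\<Sum>(q, a)\<in>farey Q. divisor_weight I d c q * fejer T (x + real a / real q))"
proof -
  have finQ: "finite Q"
  proof -
    have "Q = (\<Union>i\<in>I. {q. q dvd d i})" using assms by auto
    thus ?thesis using assms by (auto intro!: finite_divisors_nat)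
  qed
  have ind: "of_real (divisor_sum I d c n) * e (of_int n * x) =
      (\<Sum>i\<in>I. \<Sum>a=1..d i. of_real (c i / real (d i)) * e (of_int n * (x + real a / real (d i))))" for n
  proof -
    have "complex_of_real (divisor_sum I d c n) = (\<Sum>i\<in>I. if int (d i) dvd n then of_real (c i) else 0)"
      unfolding divisor_sum_def using assms by (simp add: sum.inter_filter if_distrib cong: if_cong)
    also have "\<dots> = (\<Sum>i\<in>I. of_real (c i / real (d i)) * (if int (d i) dvd n then of_nat (d i) else 0))"
      using assms by (intro sum.cong refl) auto
    also have "\<dots> = (\<Sum>i\<in>I. of_real (c i / real (d i)) * (\<Sum>a=1..d i. e (of_int n * real a / real (d i))))"
      using assms by (intro sum.cong refl arg_cong2[where f = "(*)"]) (simp only: sum_e_orthogonal')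
    finally show ?thesis
      by (simp only: sum_distrib_right sum_distrib_left mult.assoc distrib_left e_add times_divide_eq_right)
         (simp only: mult.commute[of "e (of_int n * x)"])
  qed
  have "cesaro T (\<lambda>n. of_real (divisor_sum I d c n) * e (of_int n * x)) =
      (\<Sum>i\<in>I. \<Sum>a=1..d i. of_real (c i / real (d i)) * of_real (fejer T (x + real a / real (d i))))"
    unfolding ind by (simp only: cesaro_sum cesaro_cmult cesaro_e)
  also have "\<dots> = of_real (\<Sum>i\<in>I. c i / real (d i) * (\<Sum>a=1..d i. fejer T (x + real a / real (d i))))"
    by (simp only: of_real_sum of_real_mult sum_distrib_left)
  also have "(\<Sum>i\<in>I. c i / real (d i) * (\<Sum>a=1..d i. fejer T (x + real a / real (d i)))) =
      (\<Sum>i\<in>I. \<Sum>q | q \<in> Q \<and> q dvd d i. c i / real (d i) * (\<Sum>a\<in>totatives q. fejer T (x + real a / real q)))"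
  proof (intro sum.cong refl)
    fix i assume i: "i \<in> I"
    have "{q. q dvd d i} = {q. q \<in> Q \<and> q dvd d i}" using i assms by auto
    thus "c i / real (d i) * (\<Sum>a=1..d i. fejer T (x + real a / real (d i))) =
      (\<Sum>q | q \<in> Q \<and> q dvd d i. c i / real (d i) * (\<Sum>a\<in>totatives q. fejer T (x + real a / real q)))"
      using sum_fractions_reduced[of "d i" "\<lambda>y. fejer T (x + y)"] assms(2)[OF i]
      by (simp add: sum_distrib_left)
  qed
  also have "\<dots> = (\<Sum>q\<in>Q. \<Sum>i | i \<in> I \<and> q dvd d i. c i / real (d i) * (\<Sum>a\<in>totatives q. fejer T (x + real a / real q)))"
    using assms finQ by (intro sum.swap_restrict) auto
  also have "\<dots> = (\<Sum>q\<in>Q. \<Sum>a\<in>totatives q. divisor_weight I d c q * fejer T (x + real a / real q))"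
    by (simp only: divisor_weight_def sum_distrib_right[symmetric] sum_distrib_left[symmetric])
  also have "\<dots> = (\<Sum>(q, a)\<in>farey Q. divisor_weight I d c q * fejer T (x + real a / real q))"
    using finQ by (simp add: farey_def sum.Sigma)
  finally show ?thesis .
qed

text \<open>The mass of the degree k frequencies seen from the fraction p = (q, a), counted without
  phases and without the factor (s / 2)^k.\<close>

definition fejer_mass :: "int set \<Rightarrow> nat \<Rightarrow> nat \<Rightarrow> nat \<Rightarrow> nat \<times> nat \<Rightarrow> real" where
  "fejer_mass X U T k p = (\<Sum>r | r \<in> signings X \<and> card (fst r) = k.
     fejer T (of_int (freq r) / real U + real (snd p) / real (fst p)))"

text \<open>The triangle inequality discards the phases; sorted by degree, only absolute Fourier
  weights and masses remain.\<close>

lemma cesaro_riesz_le: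
  assumes "finite I" "\<And>i. i \<in> I \<Longrightarrow> d i > 0" "Q = {q. \<exists>i\<in>I. q dvd d i}"
    and X: "finite X" "U > 0" and "0 \<le> s"
  shows "cesaro T (\<lambda>n. divisor_sum I d c n * riesz U X s \<phi> n) \<le>
    (\<Sum>k\<le>card X. (s / 2) ^ k * (\<Sum>p\<in>farey Q. \<bar>divisor_weight I d c (fst p)\<bar> * fejer_mass X U T k p))"
proof -
  let ?w = "divisor_weight I d c" and ?\<beta> = "divisor_sum I d c"
  have "complex_of_real (cesaro T (\<lambda>n. ?\<beta> n * riesz U X s \<phi> n)) =
      cesaro T (\<lambda>n. of_real (?\<beta> n) * of_real (riesz U X s \<phi> n))"
    by (simp only: cesaro_of_real[symmetric] of_real_mult)
  also have "(\<lambda>n. of_real (?\<beta> n) * complex_of_real (riesz U X s \<phi> n)) =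
      (\<lambda>n. \<Sum>p\<in>signings X. (of_real ((s / 2) ^ card (fst p)) * e (\<Sum>u\<in>fst p. of_int (snd p u) * \<phi> u)) *
        (of_real (?\<beta> n) * e (of_int n * (of_int (freq p) / real U))))"
    unfolding riesz_expansion[OF X] sum_distrib_left
    by (intro ext sum.cong refl) (simp add: mult_ac)
  also have "cesaro T \<dots> = (\<Sum>p\<in>signings X. (of_real ((s / 2) ^ card (fst p)) * e (\<Sum>u\<in>fst p. of_int (snd p u) * \<phi> u)) *
        of_real (\<Sum>(q, a)\<in>farey Q. ?w q * fejer T (of_int (freq p) / real U + real a / real q)))"
    unfolding cesaro_sum cesaro_cmult
    by (intro sum.cong refl arg_cong2[where f = "(*)"] cesaro_divisor_sum assms)
  finally have "cesaro T (\<lambda>n. ?\<beta> n * riesz U X s \<phi> n) \<le> cmod \<dots>"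
    by (metis abs_ge_self norm_of_real)
  also have "\<dots> \<le> (\<Sum>p\<in>signings X. (s / 2) ^ card (fst p) *
        (\<Sum>(q, a)\<in>farey Q. \<bar>?w q\<bar> * fejer T (of_int (freq p) / real U + real a / real q)))"
  proof (intro sum_norm_le)
    fix p assume "p \<in> signings X"
    have "\<bar>\<Sum>(q, a)\<in>farey Q. ?w q * fejer T (of_int (freq p) / real U + real a / real q)\<bar> \<le>
        (\<Sum>(q, a)\<in>farey Q. \<bar>?w q\<bar> * fejer T (of_int (freq p) / real U + real a / real q))"
      by (intro order_trans[OF sum_abs] sum_mono) (auto simp: abs_mult fejer_nonneg)
    thus "cmod ((of_real ((s / 2) ^ card (fst p)) * e (\<Sum>u\<in>fst p. of_int (snd p u) * \<phi> u)) *
        of_real (\<Sum>(q, a)\<in>farey Q. ?w q * fejer T (of_int (freq p) / real U + real a / real q))) \<le>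
      (s / 2) ^ card (fst p) *
        (\<Sum>(q, a)\<in>farey Q. \<bar>?w q\<bar> * fejer T (of_int (freq p) / real U + real a / real q))"
      using \<open>0 \<le> s\<close> by (simp only: norm_mult norm_of_real norm_e mult_1_right) (auto intro!: mult_left_mono)
  qed
  also have "\<dots> = (\<Sum>k\<le>card X. \<Sum>p | p \<in> signings X \<and> card (fst p) = k. (s / 2) ^ card (fst p) *
        (\<Sum>(q, a)\<in>farey Q. \<bar>?w q\<bar> * fejer T (of_int (freq p) / real U + real a / real q)))"
    using X by (intro sum.group[symmetric] finite_signings) (auto simp: signings_def intro: card_mono)
  also have "\<dots> = (\<Sum>k\<le>card X. (s / 2) ^ k * (\<Sum>p | p \<in> signings X \<and> card (fst p) = k. 
        (\<Sum>r\<in>farey Q. \<bar>?w (fst r)\<bar> * fejer T (of_int (freq p) / real U + real (snd r) / real (fst r)))))"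
    by (simp add: sum_distrib_left case_prod_unfold)
  also have "\<dots> = (\<Sum>k\<le>card X. (s / 2) ^ k * (\<Sum>p\<in>farey Q. \<bar>?w (fst p)\<bar> * fejer_mass X U T k p))"
    unfolding fejer_mass_def sum_distrib_left by (intro sum.cong refl sum.swap)
  finally show ?thesis .
qed

lemma fejer_mass_nonneg: "fejer_mass X U T k p \<ge> 0"
  unfolding fejer_mass_def by (intro sum_nonneg fejer_nonneg)

lemma fejer_mass_le:
  assumes "finite X" "U > 0" "dissociated (int U) X"
  shows "fejer_mass X U T k p \<le> 2 ^ k * (real T + real U)"
  unfolding fejer_mass_def by (rule sum_signings_fejer_le[OF assms])

lemma sum_fejer_mass_le:
  assumes "finite X" "Q \<subseteq> {1..D}"
  shows "(\<Sum>p\<in>farey Q. fejer_mass X U T k p) \<le> 2 ^ k * (real (card X) ^ k / fact k) * (real T + 4 * real D ^ 6 / real T)"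
proof -
  have "(\<Sum>p\<in>farey Q. fejer_mass X U T k p) = (\<Sum>r | r \<in> signings X \<and> card (fst r) = k.
      \<Sum>p\<in>farey Q. fejer T (of_int (freq r) / real U + real (snd p) / real (fst p)))"
    unfolding fejer_mass_def by (rule sum.swap)
  also have "\<dots> \<le> (\<Sum>r | r \<in> signings X \<and> card (fst r) = k. 1 * (real T + 4 * real D ^ 6 / real T))"
    using sum_fejer_farey[OF assms(2)] by (intro sum_mono) (simp add: case_prod_unfold)
  also have "\<dots> = 2 ^ k * real (card X choose k) * (real T + 4 * real D ^ 6 / real T)"
    unfolding sum_distrib_right[symmetric] sum_signings_power[OF assms(1)] ..
  also have "\<dots> \<le> 2 ^ k * (real (card X) ^ k / fact k) * (real T + 4 * real D ^ 6 / real T)"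
    by (intro mult_right_mono mult_left_mono binomial_le_pow_fact) auto
  finally show ?thesis .
qed

text \<open>Up to degree \<open>k0\<close> the pointwise bound on the weights saves the factor W, at
  the price of \<kappa> times the full mass (s L)^k / k! with L = \<open>card X\<close>. Beyond
  \<open>k0\<close> Cauchy--Schwarz with the mean square \<open>B2\<close> of the weights takes
  over; there the factorial has to compensate for the size of \<open>B2\<close>.\<close>

lemma cesaro_riesz_sieve:
  assumes I: "finite I" "\<And>i. i \<in> I \<Longrightarrow> d i > 0" "Q = {q. \<exists>i\<in>I. q dvd d i}" "Q \<subseteq> {1..D}"
    and X: "finite X" "U > 0" "dissociated (int U) X" and s: "0 \<le> s" and T: "T > 0"
    and w: "\<And>q. q \<in> Q \<Longrightarrow> \<bar>divisor_weight I d c q\<bar> \<le> W / real (totient q) + \<kappa>"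
    and W: "W \<ge> 0" "\<kappa> \<ge> 0"
    and w2: "(\<Sum>q\<in>Q. real (totient q) * (divisor_weight I d c q)\<^sup>2) \<le> B2"
    and g: "finite E" "0 \<notin> E" "\<And>d. d \<in> E \<Longrightarrow> g d \<ge> 0" "(\<Sum>d\<in>E. g d / sqrt (real d)) \<le> S0"
    and tot: "\<And>q. q \<in> Q \<Longrightarrow> 1 / real (totient q) \<le> (\<Sum>d | d \<in> E \<and> d dvd q. g d) / real q"
  defines "x \<equiv> s\<^sup>2 * real (card X)" and "T' \<equiv> real T + 4 * real D ^ 6 / real T"
  shows "cesaro T (\<lambda>n. divisor_sum I d c n * riesz U X s \<phi> n) \<le>
    sqrt ((real T + real U) * T') * (2 * S0 * W * (\<Sum>k\<le>card X. sqrt (x ^ k / fact k)) +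
      sqrt B2 * (\<Sum>k\<in>{k0<..card X}. sqrt (x ^ k / fact k))) +
    \<kappa> * T' * (\<Sum>k\<le>k0. (s * real (card X)) ^ k / fact k)"
proof -
  let ?w = "divisor_weight I d c" and ?L = "card X" and ?N = "fejer_mass X U T"
  define A where "A = sqrt ((real T + real U) * T')"
  define r where "r k = sqrt (x ^ k / fact k)" for k
  define F where "F k = (s / 2) ^ k * (\<Sum>p\<in>farey Q. \<bar>?w (fst p)\<bar> * ?N k p)" for k
  have T': "T' > 0" using T by (simp add: T'_def add_pos_nonneg)
  have finQ: "finite Q" using I(4) finite_subset by blast
  have "0 \<notin> Q" using I(4) by auto
  have x: "x \<ge> 0" by (simp add: x_def)
  have S0: "S0 \<ge> 0"
    using g by (intro order_trans[OF sum_nonneg g(4)]) (auto intro!: divide_nonneg_nonneg)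
  have B2: "B2 \<ge> 0"
    by (rule order_trans[OF sum_nonneg w2]) auto
  \<comment> \<open>\<open>B k\<close> bounds the mass at a single fraction, \<open>B' k\<close> the
    mass at all fractions together.\<close>
  define B where "B k = 2 ^ k * (real T + real U)" for k :: nat
  define B' where "B' k = 2 ^ k * (real ?L ^ k / fact k) * T'" for k :: nat
  have Bpos: "B k > 0" for k using T by (simp add: B_def)
  \<comment> \<open>For empty X and k > 0 the total bound is 0, while the balancing of denominators
    divides by such bounds.\<close>
  have B'pos: "B' k > 0" if "k \<le> ?L" for k
    using that T' by (cases "k = 0") (auto simp: B'_def)
  have Nle: "?N k p \<le> B k" for k p
    unfolding B_def by (rule fejer_mass_le[OF X])
  have Nsum: "(\<Sum>p\<in>farey Q. ?N k p) \<le> B' k" for k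
    unfolding B'_def T'_def by (rule sum_fejer_mass_le[OF X(1) I(4)])
  \<comment> \<open>The powers of 2 cancel and s^k L^(k/2) / sqrt(k!) is left: this is where s^2 L
    replaces s L.\<close>
  have root: "(s / 2) ^ k * sqrt (B k * B' k) = A * r k" for k
  proof -
    have "(s / 2) ^ k * sqrt (B k * B' k) = sqrt (((s / 2) ^ k)\<^sup>2) * sqrt (B k * B' k)"
      using s by (subst real_sqrt_abs) simp
    also have "\<dots> = sqrt (((s / 2) ^ k)\<^sup>2 * (B k * B' k))"
      by (simp only: real_sqrt_mult)
    also have "((s / 2) ^ k)\<^sup>2 * (B k * B' k) = ((real T + real U) * T') * (x ^ k / fact k)"
    proof -
      have "((s / 2) ^ k)\<^sup>2 * 2 ^ k * 2 ^ k = (s\<^sup>2) ^ k"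
        by (simp add: power_divide power_mult_distrib power2_eq_square field_simps flip: power_add mult_2)
      thus ?thesis by (simp add: B_def B'_def x_def power_mult_distrib)
    qed
    finally show ?thesis by (simp only: A_def r_def real_sqrt_mult)
  qed
  have small: "F k \<le> 2 * S0 * W * (A * r k) + \<kappa> * T' * ((s * real ?L) ^ k / fact k)" if k: "k \<le> ?L" for k
  proof -
    have "(\<Sum>p\<in>farey Q. \<bar>?w (fst p)\<bar> * ?N k p) \<le>
        (\<Sum>p\<in>farey Q. (W / real (totient (fst p)) + \<kappa>) * ?N k p)"
      using w by (intro sum_mono mult_right_mono fejer_mass_nonneg) (auto simp: farey_def)
    also have "\<dots> = W * (\<Sum>(q, a)\<in>farey Q. ?N k (q, a) / real (totient q)) + \<kappa> * (\<Sum>p\<in>farey Q. ?N k p)"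
      by (simp add: sum_distrib_left distrib_right sum.distrib case_prod_unfold)
    also have "\<dots> \<le> W * (2 * S0 * sqrt (B k * B' k)) + \<kappa> * B' k"
      using Bpos B'pos[OF k] Nle Nsum fejer_mass_nonneg finQ \<open>0 \<notin> Q\<close> g tot W
      by (intro add_mono mult_left_mono sum_totient_weight_le[where E = E and g = g]) auto
    finally have "F k \<le> (s / 2) ^ k * (W * (2 * S0 * sqrt (B k * B' k)) + \<kappa> * B' k)"
      unfolding F_def using s by (intro mult_left_mono) auto
    also have "\<dots> = 2 * S0 * W * ((s / 2) ^ k * sqrt (B k * B' k)) + \<kappa> * ((s / 2) ^ k * B' k)"
      by (simp add: algebra_simps)
    also have "(s / 2) ^ k * B' k = T' * ((s * real ?L) ^ k / fact k)"
      by (simp add: B'_def power_divide power_mult_distrib)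
    finally show ?thesis by (simp only: root mult.assoc)
  qed
  have large: "F k \<le> sqrt B2 * (A * r k)" if k: "k \<le> ?L" for k
  proof -
    have "(\<Sum>p\<in>farey Q. \<bar>?w (fst p)\<bar> * ?N k p)\<^sup>2 \<le>
        (\<Sum>p\<in>farey Q. \<bar>?w (fst p)\<bar>\<^sup>2) * (\<Sum>p\<in>farey Q. (?N k p)\<^sup>2)"
      by (rule Cauchy_Schwarz_ineq_sum)
    also have "\<dots> \<le> B2 * (B k * B' k)"
    proof (intro mult_mono)
      have "(\<Sum>p\<in>farey Q. \<bar>?w (fst p)\<bar>\<^sup>2) = (\<Sum>(q, a)\<in>farey Q. (?w q)\<^sup>2)"
        by (simp add: case_prod_unfold)
      also have "\<dots> = (\<Sum>q\<in>Q. \<Sum>a\<in>totatives q. (?w q)\<^sup>2)"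
        unfolding farey_def using finQ by (intro sum.Sigma[symmetric]) auto
      also have "\<dots> = (\<Sum>q\<in>Q. real (totient q) * (?w q)\<^sup>2)"
        by (simp add: totient_def)
      finally show "(\<Sum>p\<in>farey Q. \<bar>?w (fst p)\<bar>\<^sup>2) \<le> B2" using w2 by simp
      \<comment> \<open>One factor of the square takes the bound for a single fraction, the other is
        summed.\<close>
      have "(\<Sum>p\<in>farey Q. (?N k p)\<^sup>2) \<le> (\<Sum>p\<in>farey Q. B k * ?N k p)"
        unfolding power2_eq_square by (intro sum_mono mult_right_mono Nle fejer_mass_nonneg)
      also have "\<dots> = B k * (\<Sum>p\<in>farey Q. ?N k p)" by (simp add: sum_distrib_left)
      also have "\<dots> \<le> B k * B' k" using Bpos[of k] by (intro mult_left_mono Nsum) auto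
      finally show "(\<Sum>p\<in>farey Q. (?N k p)\<^sup>2) \<le> B k * B' k" .
    qed (use B2 in \<open>auto intro: sum_nonneg\<close>)
    finally have "(\<Sum>p\<in>farey Q. \<bar>?w (fst p)\<bar> * ?N k p) \<le> sqrt (B2 * (B k * B' k))"
      by (rule real_le_rsqrt)
    hence "F k \<le> (s / 2) ^ k * (sqrt B2 * sqrt (B k * B' k))"
      unfolding F_def real_sqrt_mult using s by (intro mult_left_mono) auto
    thus ?thesis using root[of k] by (simp add: mult_ac)
  qed
  have r: "r k \<ge> 0" for k using x by (simp add: r_def)
  have A: "A \<ge> 0" using T' by (simp add: A_def)
  have "cesaro T (\<lambda>n. divisor_sum I d c n * riesz U X s \<phi> n) \<le> (\<Sum>k\<le>?L. F k)"
    unfolding F_def by (rule cesaro_riesz_le) (use assms in auto)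
  also have "\<dots> \<le> (\<Sum>k\<le>?L. 2 * S0 * W * A * r k + sqrt B2 * A * (if k0 < k then r k else 0) +
      \<kappa> * T' * (if k \<le> k0 then (s * real ?L) ^ k / fact k else 0))"
  proof (intro sum_mono)
    fix k assume k: "k \<in> {..?L}"
    have "2 * S0 * W * (A * r k) \<ge> 0" using S0 W A r by simp
    thus "F k \<le> 2 * S0 * W * A * r k + sqrt B2 * A * (if k0 < k then r k else 0) +
      \<kappa> * T' * (if k \<le> k0 then (s * real ?L) ^ k / fact k else 0)"
    proof (cases "k \<le> k0")
      case True
      thus ?thesis using small[of k] k by (simp add: mult.assoc)
    next
      case False
      have "F k \<le> sqrt B2 * (A * r k)" using large[of k] k by simp
      also have "\<dots> \<le> 2 * S0 * W * (A * r k) + sqrt B2 * (A * r k)"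
        using \<open>2 * S0 * W * (A * r k) \<ge> 0\<close> by linarith
      finally show ?thesis using False by (simp add: mult.assoc)
    qed
  qed
  also have "\<dots> = 2 * S0 * W * A * (\<Sum>k\<le>?L. r k) + sqrt B2 * A * (\<Sum>k\<le>?L. if k0 < k then r k else 0) +
      \<kappa> * T' * (\<Sum>k\<le>?L. if k \<le> k0 then (s * real ?L) ^ k / fact k else 0)"
    by (simp only: sum.distrib sum_distrib_left)
  also have "(\<Sum>k\<le>?L. if k0 < k then r k else 0) = (\<Sum>k\<in>{k0<..?L}. r k)"
    by (simp add: sum.inter_filter[symmetric]) (intro sum.cong, auto)
  also have "(\<Sum>k\<le>?L. if k \<le> k0 then (s * real ?L) ^ k / fact k else 0) =
      (\<Sum>k | k \<in> {..?L} \<and> k \<le> k0. (s * real ?L) ^ k / fact k)"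
    by (rule sum.inter_filter[symmetric]) simp
  also have "\<kappa> * T' * \<dots> \<le> \<kappa> * T' * (\<Sum>k\<le>k0. (s * real ?L) ^ k / fact k)"
    using W T' s by (intro mult_left_mono sum_mono2) auto
  finally show ?thesis by (simp add: A_def r_def algebra_simps)
qed

section \<open>Squarefree numbers as sets of primes\<close>

text \<open>A finite set of primes stands for the squarefree number that is its product: inclusion
  is divisibility, union is the least common multiple, and \<open>phi\<close> is Euler's
  totient.\<close>

definition phi :: "nat set \<Rightarrow> real" where
  "phi B = (\<Prod>p\<in>B. real p - 1)"

definition prime_set :: "nat set \<Rightarrow> bool" where
  "prime_set B \<longleftrightarrow> finite B \<and> (\<forall>p\<in>B. prime p)"

lemma prime_set_subset: "prime_set B \<Longrightarrow> A \<subseteq> B \<Longrightarrow> prime_set A"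
  by (auto simp: prime_set_def intro: finite_subset)

lemma prime_set_finite: "prime_set B \<Longrightarrow> finite B"
  by (simp add: prime_set_def)

lemma prime_set_Un: "prime_set A \<Longrightarrow> prime_set B \<Longrightarrow> prime_set (A \<union> B)"
  by (auto simp: prime_set_def)

lemma prod_prime_set_pos: "prime_set B \<Longrightarrow> \<Prod>B > 0"
  by (auto simp: prime_set_def intro!: prod_pos prime_gt_0_nat)

lemma prime_dvd_prod_prime_set_iff:
  assumes "prime_set B" "prime p"
  shows "p dvd \<Prod>B \<longleftrightarrow> p \<in> B"
proof -
  have "p dvd \<Prod>B \<longleftrightarrow> (\<exists>x\<in>B. p dvd x)"
    using assms by (simp add: prime_set_def prime_dvd_prod_iff)
  also have "\<dots> \<longleftrightarrow> p \<in> B"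
    using assms by (metis dvd_refl prime_set_def primes_dvd_imp_eq)
  finally show ?thesis .
qed

lemma prod_prime_set_dvd_iff:
  assumes "prime_set A" "prime_set B"
  shows "\<Prod>A dvd \<Prod>B \<longleftrightarrow> A \<subseteq> B"
proof
  assume "\<Prod>A dvd \<Prod>B"
  thus "A \<subseteq> B"
    using assms by (metis prime_dvd_prod_prime_set_iff dvd_trans subsetI prime_set_def)
next
  assume "A \<subseteq> B"
  thus "\<Prod>A dvd \<Prod>B" using assms by (intro prod_dvd_prod_subset) (auto simp: prime_set_def)
qed

lemma prod_prime_set_inj:
  assumes "prime_set A" "prime_set B" "\<Prod>A = \<Prod>B"
  shows "A = B"
  using assms by (metis dvd_refl prod_prime_set_dvd_iff subset_antisym)

lemma int_prod_prime_set_dvd_iff: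
  assumes "prime_set A"
  shows "int (\<Prod>A) dvd n \<longleftrightarrow> (\<forall>p\<in>A. int p dvd n)"
proof -
  have "finite A" using assms by (simp add: prime_set_def)
  thus ?thesis using assms
  proof (induction A rule: finite_induct)
    case (insert p A)
    have "prime_set A" using insert.prems by (rule prime_set_subset) auto
    have "prime p" using insert.prems by (simp add: prime_set_def)
    hence "coprime p (\<Prod>A)"
      using insert.hyps \<open>prime_set A\<close> by (simp add: prime_dvd_prod_prime_set_iff prime_imp_coprime)
    hence "coprime (int p) (int (\<Prod>A))" by (simp only: coprime_int_iff)
    hence "int p * int (\<Prod>A) dvd n \<longleftrightarrow> int p dvd n \<and> int (\<Prod>A) dvd n"
      by (auto intro: divides_mult dvd_mult_left dvd_mult_right)
    thus ?case using insert by (simp add: \<open>prime_set A\<close>)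
  qed simp
qed

lemma prod_prime_set_dvd_ex:
  assumes "prime_set C" "q dvd \<Prod>C"
  shows "\<exists>B\<subseteq>C. q = \<Prod>B"
proof -
  have "finite C" using assms by (simp add: prime_set_def)
  thus ?thesis using assms
  proof (induction C arbitrary: q rule: finite_induct)
    case (insert p C)
    have C: "prime_set C" using insert.prems(1) by (rule prime_set_subset) auto
    have p: "prime p" using insert.prems by (simp add: prime_set_def)
    have "q dvd p * \<Prod>C" using insert by simp
    then obtain a b where ab: "q = a * b" "a dvd p" "b dvd \<Prod>C"
      using division_decomp by blast
    then obtain B where B: "B \<subseteq> C" "b = \<Prod>B" using insert.IH C by blast
    have "a = 1 \<or> a = p" using p ab by (simp add: prime_nat_iff)
    thus ?case
    proof
      assume "a = 1"
      thus ?thesis using ab B by (intro exI[of _ B]) auto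
    next
      assume "a = p"
      have "p \<notin> B" "finite B" using B insert.hyps finite_subset by auto
      thus ?thesis using \<open>a = p\<close> ab B by (intro exI[of _ "insert p B"]) auto
    qed
  qed auto
qed

lemma totient_prod_prime_set:
  assumes "prime_set A"
  shows "real (totient (\<Prod>A)) = phi A"
proof -
  have "finite A" using assms by (simp add: prime_set_def)
  thus ?thesis using assms
  proof (induction A rule: finite_induct)
    case (insert p A)
    have A: "prime_set A" using insert.prems by (rule prime_set_subset) auto
    have p: "prime p" using insert.prems by (simp add: prime_set_def)
    hence "coprime p (\<Prod>A)"
      using insert.hyps A by (simp add: prime_dvd_prod_prime_set_iff prime_imp_coprime)
    hence "totient (\<Prod>(insert p A)) = (p - 1) * totient (\<Prod>A)"
      using insert.hyps p by (simp add: totient_mult_coprime totient_prime)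
    thus ?case using insert A prime_ge_1_nat[OF p] by (simp add: phi_def of_nat_diff)
  qed (simp add: phi_def)
qed

lemma phi_pos: "prime_set A \<Longrightarrow> phi A > 0"
  unfolding phi_def prime_set_def by (intro prod_pos) (auto dest!: bspec prime_gt_1_nat)

lemma phi_Un_disjoint:
  "prime_set A \<Longrightarrow> prime_set B \<Longrightarrow> A \<inter> B = {} \<Longrightarrow> phi (A \<union> B) = phi A * phi B"
  unfolding phi_def by (intro prod.union_disjoint) (auto simp: prime_set_def)

lemma prod_Un_disjoint:
  "prime_set A \<Longrightarrow> prime_set B \<Longrightarrow> A \<inter> B = {} \<Longrightarrow> \<Prod>(A \<union> B) = \<Prod>A * \<Prod>B"
  by (intro prod.union_disjoint) (auto simp: prime_set_def)

lemma prod_1_plus_subsets: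
  fixes f :: "'a \<Rightarrow> 'b::comm_semiring_1"
  assumes "finite A"
  shows "(\<Prod>x\<in>A. 1 + f x) = (\<Sum>X\<in>Pow A. \<Prod>x\<in>X. f x)"
  using prod_add[OF assms, of f "\<lambda>_. 1"] by (simp add: add.commute)

lemma sum_phi_subsets: "prime_set A \<Longrightarrow> (\<Sum>X\<in>Pow A. phi X) = real (\<Prod>A)"
  unfolding phi_def by (subst prod_1_plus_subsets[symmetric]) (auto simp: prime_set_def)

lemma sum_inverse_phi_subsets:
  assumes "prime_set A"
  shows "(\<Sum>X\<in>Pow A. 1 / phi X) = real (\<Prod>A) / phi A"
proof -
  have "(\<Sum>X\<in>Pow A. 1 / phi X) = (\<Sum>X\<in>Pow A. \<Prod>p\<in>X. 1 / (real p - 1))"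
    by (simp add: phi_def prod_dividef)
  also have "\<dots> = (\<Prod>p\<in>A. 1 + 1 / (real p - 1))"
    using assms by (intro prod_1_plus_subsets[symmetric]) (simp add: prime_set_def)
  also have "\<dots> = (\<Prod>p\<in>A. real p / (real p - 1))"
    using assms by (intro prod.cong refl) (auto simp: prime_set_def field_simps dest!: bspec prime_gt_1_nat)
  finally show ?thesis by (simp add: phi_def prod_dividef)
qed

lemma sum_alternating_subsets:
  assumes "finite A"
  shows "(\<Sum>X\<in>Pow A. (- 1) ^ card X) = (if A = {} then 1 else (0::real))"
proof -
  have "(\<Sum>X\<in>Pow A. (- 1::real) ^ card X) = (\<Prod>x\<in>A. 1 + (- 1))"
    using assms by (subst prod_1_plus_subsets) simp_all
  thus ?thesis using assms by (auto simp: card_gt_0_iff)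
qed

lemma sum_inverse_le_harm:
  assumes "\<And>A. A \<in> \<F> \<Longrightarrow> prime_set A \<and> \<Prod>A \<le> M"
  shows "finite \<F>" "(\<Sum>A\<in>\<F>. 1 / real (\<Prod>A)) \<le> harm M"
proof -
  have inj: "inj_on Prod \<F>" using assms prod_prime_set_inj by (intro inj_onI) blast
  have sub: "Prod ` \<F> \<subseteq> {1..M}" using assms prod_prime_set_pos by (fastforce simp: Suc_le_eq)
  show "finite \<F>" using inj sub by (metis finite_atLeastAtMost finite_imageD finite_subset)
  have "(\<Sum>A\<in>\<F>. 1 / real (\<Prod>A)) = (\<Sum>n\<in>Prod ` \<F>. 1 / real n)"
    using inj by (simp add: sum.reindex)
  also have "\<dots> \<le> (\<Sum>n=1..M. 1 / real n)" using sub by (intro sum_mono2) auto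
  finally show "(\<Sum>A\<in>\<F>. 1 / real (\<Prod>A)) \<le> harm M" by (simp add: harm_def inverse_eq_divide)
qed

text \<open>j^card E counts the ways to write a squarefree number as an ordered product of j
  factors, each of which is again at most M. In the induction, A collects the primes with one of the
  first j labels and E - A those with the new one.\<close>

lemma sum_power_card_le_harm:
  assumes P: "prime_set P"
  shows "(\<Sum>E | E \<subseteq> P \<and> \<Prod>E \<le> M. real j ^ card E / real (\<Prod>E)) \<le> harm M ^ j"
proof (induction j)
  case 0
  have fin: "finite {E. E \<subseteq> P \<and> \<Prod>E \<le> M}" using P by (auto simp: prime_set_def)
  \<comment> \<open>Since 0 ^ 0 = 1, exactly the empty set survives.\<close>
  have "(\<Sum>E | E \<subseteq> P \<and> \<Prod>E \<le> M. real 0 ^ card E / real (\<Prod>E)) =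
      (\<Sum>E\<in>{E. E \<subseteq> P \<and> \<Prod>E \<le> M}. if E = {} then 1 else 0)"
    using P by (intro sum.cong refl) (auto simp: prime_set_def card_gt_0_iff dest: finite_subset)
  also have "\<dots> \<le> 1" using fin by (simp add: sum.delta)
  finally show ?case by simp
next
  case (Suc j)
  define \<E> where "\<E> = {E. E \<subseteq> P \<and> \<Prod>E \<le> M}"
  have fin: "finite \<E>" using P by (auto simp: prime_set_def \<E>_def)
  have ps: "prime_set E" if "E \<in> \<E>" for E using that P prime_set_subset by (auto simp: \<E>_def)
  have "(\<Sum>E\<in>\<E>. real (Suc j) ^ card E / real (\<Prod>E)) =
      (\<Sum>E\<in>\<E>. \<Sum>A\<in>Pow E. real j ^ card A / real (\<Prod>A) * (1 / real (\<Prod>(E - A))))"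
  proof (intro sum.cong refl)
    fix E assume E: "E \<in> \<E>"
    have "real (Suc j) ^ card E = (\<Prod>p\<in>E. 1 + real j)" by simp
    also have "\<dots> = (\<Sum>A\<in>Pow E. \<Prod>p\<in>A. real j)"
      using ps[OF E] by (intro prod_1_plus_subsets) (simp add: prime_set_def)
    finally have "real (Suc j) ^ card E / real (\<Prod>E) = (\<Sum>A\<in>Pow E. real j ^ card A / real (\<Prod>E))"
      by (simp add: sum_divide_distrib)
    also have "\<dots> = (\<Sum>A\<in>Pow E. real j ^ card A / real (\<Prod>A) * (1 / real (\<Prod>(E - A))))"
    proof (intro sum.cong refl)
      fix A assume A: "A \<in> Pow E"
      hence "\<Prod>E = \<Prod>A * \<Prod>(E - A)"
        using ps[OF E] by (subst prod_Un_disjoint[symmetric]) (auto intro: prime_set_subset simp: Un_absorb1)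
      thus "real j ^ card A / real (\<Prod>E) = real j ^ card A / real (\<Prod>A) * (1 / real (\<Prod>(E - A)))"
        by simp
    qed
    finally show "real (Suc j) ^ card E / real (\<Prod>E) =
      (\<Sum>A\<in>Pow E. real j ^ card A / real (\<Prod>A) * (1 / real (\<Prod>(E - A))))" .
  qed
  also have "\<dots> = (\<Sum>(E, A)\<in>(SIGMA E:\<E>. Pow E). real j ^ card A / real (\<Prod>A) * (1 / real (\<Prod>(E - A))))"
    using fin ps by (subst sum.Sigma) (auto simp: prime_set_def)
  also have "\<dots> = (\<Sum>(A, A')\<in>(\<lambda>(E, A). (A, E - A)) ` (SIGMA E:\<E>. Pow E).
      real j ^ card A / real (\<Prod>A) * (1 / real (\<Prod>A')))"
    by (subst sum.reindex) (auto simp: inj_on_def case_prod_unfold)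
  also have "\<dots> \<le> (\<Sum>(A, A')\<in>\<E> \<times> \<E>. real j ^ card A / real (\<Prod>A) * (1 / real (\<Prod>A')))"
  proof (intro sum_mono2)
    have down: "A \<in> \<E>" if "E \<in> \<E>" "A \<subseteq> E" for A E
    proof -
      have "\<Prod>A dvd \<Prod>E" using that ps prime_set_subset prod_prime_set_dvd_iff by blast
      hence "\<Prod>A \<le> \<Prod>E" using ps[OF that(1)] prod_prime_set_pos by (intro dvd_imp_le) auto
      thus ?thesis using that by (auto simp: \<E>_def)
    qed
    show "(\<lambda>(E, A). (A, E - A)) ` (SIGMA E:\<E>. Pow E) \<subseteq> \<E> \<times> \<E>"
      using down by (auto simp: image_def)
  qed (use fin in \<open>auto intro!: divide_nonneg_nonneg mult_nonneg_nonneg prod_nonneg\<close>)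
  also have "\<dots> = (\<Sum>A\<in>\<E>. real j ^ card A / real (\<Prod>A)) * (\<Sum>A'\<in>\<E>. 1 / real (\<Prod>A'))"
    by (simp only: sum_product sum.cartesian_product)
  also have "\<dots> \<le> harm M ^ j * harm M"
  proof (intro mult_mono)
    show "(\<Sum>A'\<in>\<E>. 1 / real (\<Prod>A')) \<le> harm M"
      using ps by (intro sum_inverse_le_harm) (auto simp: \<E>_def)
  qed (use Suc in \<open>auto simp: \<E>_def harm_nonneg intro!: sum_nonneg divide_nonneg_nonneg prod_nonneg\<close>)
  finally show ?case by (simp add: \<E>_def mult.commute)
qed

text \<open>Such an n is a product of positive powers of the primes in E, and 1/p + 1/p^2 + ... = 1
  / (p - 1) for each of them.\<close>

lemma sum_inverse_same_primes_le:
  assumes "prime_set E" "finite M" "\<And>n. n \<in> M \<Longrightarrow> n > 0 \<and> prime_factors n = E"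
  shows "(\<Sum>n\<in>M. 1 / real n) \<le> 1 / phi E"
proof -
  have "finite E" using assms by (simp add: prime_set_def)
  thus ?thesis using assms
  proof (induction E arbitrary: M rule: finite_induct)
    case empty
    have "n = 1" if "n \<in> M" for n
      using empty.prems(3)[OF that] by (auto simp: prime_factorization_empty_iff)
    hence "M \<subseteq> {1}" by auto
    hence "(\<Sum>n\<in>M. 1 / real n) \<le> (\<Sum>n\<in>{1}. 1 / real n)" by (intro sum_mono2) auto
    thus ?case by (simp add: phi_def)
  next
    case (insert p E)
    have p: "prime p" using insert.prems by (simp add: prime_set_def)
    hence p1: "p > 1" by (rule prime_gt_1_nat)
    have E: "prime_set E" using insert.prems(1) by (rule prime_set_subset) auto
    define v where "v n = multiplicity p n" for n
    define M' where "M' = (\<lambda>n. n div p ^ v n) ` M"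
    have decomp: "n = p ^ v n * (n div p ^ v n)" for n
      by (simp add: v_def multiplicity_dvd)
    have v_pos: "v n \<ge> 1" if "n \<in> M" for n
    proof -
      have "p \<in> prime_factors n" using insert.prems(3)[OF that] by simp
      thus ?thesis by (simp add: v_def prime_factors_multiplicity Suc_le_eq)
    qed
    have M': "n > 0 \<and> prime_factors n = E" if "n \<in> M'" for n
    proof -
      obtain k where k: "k \<in> M" "n = k div p ^ v k"
        using \<open>n \<in> M'\<close> unfolding M'_def by blast
      have k0: "k > 0" "prime_factors k = insert p E" using insert.prems(3)[OF k(1)] by auto
      have dec: "k = p ^ v k * n" using decomp[of k] k by simp
      hence n0: "n > 0" using k0 by (metis gr0I mult_0_right)
      have "\<not> p dvd n" unfolding k(2) v_def using k0 p
        by (metis multiplicity_decompose not_prime_unit gr_implies_not0)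
      have "prime_factors k = prime_factors (p ^ v k) \<union> prime_factors n"
        using dec n0 p1 by (metis gr_implies_not0 k0(1) mult_eq_0_iff prime_factors_product)
      also have "prime_factors (p ^ v k) = {p}"
        using p v_pos[OF k(1)] by (simp add: prime_factors_power prime_prime_factors)
      finally have "insert p E = insert p (prime_factors n)" using k0 by simp
      moreover have "p \<notin> prime_factors n" using \<open>\<not> p dvd n\<close> by auto
      ultimately show ?thesis using n0 insert.hyps(2) by (auto simp: insert_ident)
    qed
    define J where "J = Max (insert 1 (v ` M))"
    have vJ: "v n \<le> J" if "n \<in> M" for n
      unfolding J_def using insert.prems that by (intro Max_ge) auto
    have "(\<Sum>n\<in>M. 1 / real n) = (\<Sum>n\<in>M. 1 / real p ^ v n * (1 / real (n div p ^ v n)))"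
    proof (intro sum.cong refl)
      fix n assume "n \<in> M"
      have "real n = real p ^ v n * real (n div p ^ v n)"
        using decomp[of n] by (metis of_nat_mult of_nat_power)
      thus "1 / real n = 1 / real p ^ v n * (1 / real (n div p ^ v n))" by simp
    qed
    also have "\<dots> = (\<Sum>(j, k)\<in>(\<lambda>n. (v n, n div p ^ v n)) ` M. 1 / real p ^ j * (1 / real k))"
    proof (subst sum.reindex)
      show "inj_on (\<lambda>n. (v n, n div p ^ v n)) M"
        by (intro inj_onI) (metis decomp prod.inject)
    qed simp
    also have "\<dots> \<le> (\<Sum>(j, k)\<in>{1..J} \<times> M'. 1 / real p ^ j * (1 / real k))"
      using insert.prems v_pos vJ by (intro sum_mono2) (auto simp: M'_def)
    also have "\<dots> = (\<Sum>j=1..J. 1 / real p ^ j) * (\<Sum>k\<in>M'. 1 / real k)"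
      by (simp only: sum_product sum.cartesian_product)
    also have "\<dots> \<le> 1 / (real p - 1) * (1 / phi E)"
    proof (intro mult_mono)
      have "(real p - 1) * (\<Sum>j=1..J. 1 / real p ^ j) = 1 - 1 / real p ^ J" for J
      proof (induction J)
        case (Suc J)
        have "(real p - 1) * (\<Sum>j=1..Suc J. 1 / real p ^ j) =
            (1 - 1 / real p ^ J) + (real p - 1) * (1 / real p ^ Suc J)"
          by (simp add: distrib_left flip: Suc)
        also have "\<dots> = 1 - 1 / real p ^ Suc J" using p1 by (simp add: field_simps)
        finally show ?case .
      qed simp
      hence "(real p - 1) * (\<Sum>j=1..J. 1 / real p ^ j) \<le> 1" using p1 by simp
      thus "(\<Sum>j=1..J. 1 / real p ^ j) \<le> 1 / (real p - 1)" using p1 by (simp add: field_simps)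
      show "(\<Sum>k\<in>M'. 1 / real k) \<le> 1 / phi E"
        using insert.prems M' E by (intro insert.IH) (auto simp: M'_def)
    qed (use p1 in \<open>auto intro: sum_nonneg\<close>)
    also have "\<dots> = 1 / phi (insert p E)"
      using insert.hyps by (simp add: phi_def)
    finally show ?case .
  qed
qed

text \<open>Every n \<le> z is sorted by its set of prime factors, whose product divides n and is
  therefore at most z.\<close>

lemma harm_le_sum_inverse_phi:
  assumes "P = {p. prime p \<and> p \<le> z}"
  shows "harm z \<le> (\<Sum>E | E \<subseteq> P \<and> \<Prod>E \<le> z. 1 / phi E)"
proof -
  define \<E> where "\<E> = {E. E \<subseteq> P \<and> \<Prod>E \<le> z}"
  have P: "prime_set P" using assms by (auto simp: prime_set_def)
  have fin: "finite \<E>" using P by (auto simp: prime_set_def \<E>_def)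
  have "harm z = (\<Sum>n=1..z. 1 / real n)" by (simp add: harm_def inverse_eq_divide)
  also have "\<dots> = (\<Sum>E\<in>\<E>. \<Sum>n | n \<in> {1..z} \<and> prime_factors n = E. 1 / real n)"
  proof (intro sum.group[symmetric])
    show "prime_factors ` {1..z} \<subseteq> \<E>"
    proof safe
      fix n assume n: "n \<in> {1..z}"
      have "prime_set (prime_factors n)" by (auto simp: prime_set_def)
      have "\<Prod>(prime_factors n) dvd n"
      proof -
        have "\<Prod>(prime_factors n) dvd (\<Prod>p\<in>prime_factors n. p ^ multiplicity p n)"
          by (intro prod_dvd_prod) (auto simp: prime_factors_multiplicity)
        also have "\<dots> = n" using n by (intro prime_factorization_nat[symmetric]) auto
        finally show ?thesis .
      qed
      hence "\<Prod>(prime_factors n) \<le> n" using n by (intro dvd_imp_le) auto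
      moreover have "prime_factors n \<subseteq> P"
        using n assms by (auto simp: in_prime_factors_iff dest!: dvd_imp_le)
      ultimately show "prime_factors n \<in> \<E>" using n by (auto simp: \<E>_def)
    qed
  qed (use fin in auto)
  also have "\<dots> \<le> (\<Sum>E\<in>\<E>. 1 / phi E)"
    using P by (intro sum_mono sum_inverse_same_primes_le) (auto simp: \<E>_def intro: prime_set_subset)
  finally show ?thesis by (simp add: \<E>_def)
qed

text \<open>For squarefree q the sum of 1 / \<phi>(d) over d | q is q / \<phi>(q). This is the
  expansion used to weight the Farey fractions by 1 / \<phi>(q).\<close>

lemma inverse_totient_le_sum_divisors:
  assumes "prime_set P" "B \<subseteq> P"
  shows "1 / real (totient (\<Prod>B)) \<le> (\<Sum>d | d \<in> Prod ` Pow P \<and> d dvd \<Prod>B. 1 / real (totient d)) / real (\<Prod>B)"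
proof -
  have B: "prime_set B" using assms prime_set_subset by blast
  have "{d. d \<in> Prod ` Pow P \<and> d dvd \<Prod>B} = Prod ` Pow B"
    using assms B prod_prime_set_dvd_iff prime_set_subset by (auto 4 4)
  moreover have "inj_on Prod (Pow B)"
    using B prime_set_subset prod_prime_set_inj by (intro inj_onI) blast
  ultimately have "(\<Sum>d | d \<in> Prod ` Pow P \<and> d dvd \<Prod>B. 1 / real (totient d)) = (\<Sum>A\<in>Pow B. 1 / real (totient (\<Prod>A)))"
    by (simp add: sum.reindex)
  also have "\<dots> = (\<Sum>A\<in>Pow B. 1 / phi A)"
    using B prime_set_subset totient_prod_prime_set by (intro sum.cong refl) auto
  also have "\<dots> = real (\<Prod>B) / phi B" by (rule sum_inverse_phi_subsets[OF B])
  finally have "(\<Sum>d | d \<in> Prod ` Pow P \<and> d dvd \<Prod>B. 1 / real (totient d)) / real (\<Prod>B) =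
      real (\<Prod>B) / phi B / real (\<Prod>B)" by (simp only:)
  also have "\<dots> = 1 / phi B"
  proof -
    have "real (\<Prod>B) \<noteq> 0" using prod_prime_set_pos[OF B] by (simp only: of_nat_eq_0_iff)
    thus ?thesis by (simp only: divide_divide_eq_left' nonzero_divide_mult_cancel_left mult_1_right times_divide_eq_right) simp
  qed
  finally show ?thesis by (simp only: totient_prod_prime_set[OF B])
qed

text \<open>The sum is a product of factors 1 + 1 / ((p - 1) sqrt p), bounded uniformly in P because
  the added terms are summable over all integers p \<ge> 2.\<close>

lemma sum_inverse_totient_sqrt_le:
  assumes P: "prime_set P"
  shows "(\<Sum>d\<in>Prod ` Pow P. 1 / real (totient d) / sqrt (real d)) \<le> exp 3"
proof -
  have inj: "inj_on Prod (Pow P)"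
    using P prime_set_subset prod_prime_set_inj by (intro inj_onI) blast
  have "(\<Sum>d\<in>Prod ` Pow P. 1 / real (totient d) / sqrt (real d)) =
      (\<Sum>A\<in>Pow P. \<Prod>p\<in>A. 1 / ((real p - 1) * sqrt (real p)))"
  proof (subst sum.reindex[OF inj], intro sum.cong refl)
    fix A assume "A \<in> Pow P"
    hence A: "prime_set A" using P prime_set_subset by blast
    have "sqrt (real (\<Prod>A)) = (\<Prod>p\<in>A. sqrt (real p))"
      by (induction A rule: infinite_finite_induct) (simp_all add: real_sqrt_mult)
    thus "((\<lambda>d. 1 / real (totient d) / sqrt (real d)) \<circ> Prod) A = (\<Prod>p\<in>A. 1 / ((real p - 1) * sqrt (real p)))"
      using totient_prod_prime_set[OF A] by (simp add: phi_def prod_dividef prod.distrib)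
  qed
  also have "\<dots> = (\<Prod>p\<in>P. 1 + 1 / ((real p - 1) * sqrt (real p)))"
    using P by (intro prod_1_plus_subsets[symmetric]) (simp add: prime_set_def)
  also have "\<dots> \<le> (\<Prod>p\<in>P. exp (1 / ((real p - 1) * sqrt (real p))))"
    using P by (intro prod_mono) (auto simp: prime_set_def intro!: add_nonneg_nonneg divide_nonneg_nonneg mult_nonneg_nonneg dest!: bspec prime_ge_1_nat)
  also have "\<dots> = exp (\<Sum>p\<in>P. 1 / ((real p - 1) * sqrt (real p)))"
    using P by (simp add: exp_sum prime_set_def)
  also have "(\<Sum>p\<in>P. 1 / ((real p - 1) * sqrt (real p))) \<le> 3"
  proof -
    define N where "N = Max (insert 2 P)"
    have N: "N \<ge> 2" unfolding N_def using P by (simp add: prime_set_def)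
    have "P \<subseteq> {2..N}" using P by (auto simp: prime_set_def N_def prime_ge_2_nat)
    hence "(\<Sum>p\<in>P. 1 / ((real p - 1) * sqrt (real p))) \<le> (\<Sum>n=2..N. 1 / ((real n - 1) * sqrt (real n)))"
      by (intro sum_mono2) auto
    \<comment> \<open>A telescoping majorant: with a = sqrt(n - 1) and b = sqrt n one has b - a = 1
      / (a + b), and 2 b \<le> 3 a yields the factor 3.\<close>
    also have "\<dots> \<le> (\<Sum>n=2..N. 3 * (1 / sqrt (real n - 1) - 1 / sqrt (real n)))"
    proof (intro sum_mono)
      fix n assume "n \<in> {2..N}"
      define a where "a = sqrt (real n - 1)"
      define b where "b = sqrt (real n)"
      have a: "a \<ge> 1" and b: "b > 0" and ab: "b\<^sup>2 = a\<^sup>2 + 1" "a\<^sup>2 = real n - 1" "b\<^sup>2 = real n"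
        using \<open>n \<in> {2..N}\<close> by (auto simp: a_def b_def)
      have "2 * b \<le> 3 * a"
      proof -
        have "1 \<le> a\<^sup>2" using a by simp
        hence "(2 * b)\<^sup>2 \<le> (3 * a)\<^sup>2" using ab by (simp add: power_mult_distrib)
        thus ?thesis using a by (intro power2_le_imp_le[of "2 * b" "3 * a"]) auto
      qed
      have "(b - a) * (b + a) = 1" using ab by (simp add: algebra_simps power2_eq_square)
      hence ba: "b - a = 1 / (a + b)" using a b by (simp add: field_simps)
      have "a + b \<le> 3 * a" using \<open>2 * b \<le> 3 * a\<close> a by linarith
      hence "1 / a \<le> 3 * (b - a)" unfolding ba using a b by (simp add: field_simps)
      hence "1 / a * (1 / (a * b)) \<le> 3 * (b - a) * (1 / (a * b))"
        using a b by (intro mult_right_mono) auto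
      also have "\<dots> = 3 * (1 / a - 1 / b)" using a b by (simp add: field_simps)
      finally have "1 / (a\<^sup>2 * b) \<le> 3 * (1 / a - 1 / b)" by (simp add: power2_eq_square)
      thus "1 / ((real n - 1) * sqrt (real n)) \<le> 3 * (1 / sqrt (real n - 1) - 1 / sqrt (real n))"
        using ab by (simp add: a_def b_def)
    qed
    also have "\<dots> = 3 * (1 - 1 / sqrt (real N))"
      using N
    proof (induction N rule: dec_induct)
      case (step n)
      thus ?case by (simp add: algebra_simps)
    qed simp
    also have "\<dots> \<le> 3" by simp
    finally show ?thesis .
  qed
  finally show ?thesis by simp
qed

section \<open>A Brun--Selberg sieve\<close>

text \<open>For r > 0 the partial sum up to n telescopes to (-1)^n (r - 1 choose n), so an even
  cut-off is what matters.\<close>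

lemma sum_choose_alternating_nonneg: "(\<Sum>j\<le>2 * m. (- 1) ^ j * real (r choose j)) \<ge> 0"
proof (cases r)
  case 0
  have "(\<Sum>j\<le>2 * m. (- 1) ^ j * real (0 choose j)) = (\<Sum>j\<le>2 * m. if j = 0 then 1 else 0)"
    by (intro sum.cong refl) auto
  thus ?thesis using 0 by simp
next
  case (Suc r')
  have "(\<Sum>j\<le>n. (- 1) ^ j * real (Suc r' choose j)) = (- 1) ^ n * real (r' choose n)" for n
  proof (induction n)
    case (Suc n)
    have "real (Suc r' choose Suc n) = real (r' choose n) + real (r' choose Suc n)" by simp
    thus ?case using Suc by (simp add: algebra_simps)
  qed simp
  thus ?thesis using Suc by simp
qed

text \<open>A Bonferroni inequality, the positivity behind Brun's sieve.\<close>

lemma sum_card_alternating_nonneg: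
  assumes "finite A"
  shows "(\<Sum>X | X \<subseteq> A \<and> card X \<le> 2 * m. (- 1) ^ card X) \<ge> (0::real)"
proof -
  have fin: "finite {X. X \<subseteq> A \<and> card X \<le> 2 * m}" using assms by auto
  have "(\<Sum>X | X \<subseteq> A \<and> card X \<le> 2 * m. (- 1::real) ^ card X) =
      (\<Sum>j\<le>2 * m. \<Sum>X | X \<in> {X. X \<subseteq> A \<and> card X \<le> 2 * m} \<and> card X = j. (- 1) ^ card X)"
    using fin by (intro sum.group[symmetric]) auto
  also have "\<dots> = (\<Sum>j\<le>2 * m. (- 1) ^ j * real (card A choose j))"
  proof (intro sum.cong refl)
    fix j assume "j \<in> {..2 * m}"
    hence "{X. X \<in> {X. X \<subseteq> A \<and> card X \<le> 2 * m} \<and> card X = j} = {X. X \<subseteq> A \<and> card X = j}" by auto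
    thus "(\<Sum>X | X \<in> {X. X \<subseteq> A \<and> card X \<le> 2 * m} \<and> card X = j. (- 1::real) ^ card X) =
        (- 1) ^ j * real (card A choose j)"
      using n_subsets[OF assms, of j] by simp
  qed
  finally show ?thesis using sum_choose_alternating_nonneg by simp
qed

text \<open>
  The divisor sum indexed by \<open>idx\<close> is a product of two upper bound sieves. The primes up to \<open>y\<close>
  are removed by Brun's truncated inclusion-exclusion, which gives the exact weights
  \<open>\<plusminus>1 / \<phi>(q)\<close> up to a tiny error, and the primes between \<open>y\<close> and \<open>z\<close> by Selberg's sieve, where
  any modulus other than \<open>1\<close> exceeds \<open>y\<close> and a crude bound suffices.
\<close>

locale brun_selberg =
  fixes y z m :: nat
  assumes y: "4 \<le> y" and z: "1 \<le> z"
begin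

section \<open>Index sets, weights and moduli of the majorant\<close>

definition "P1 = {p. prime p \<and> p \<le> y}"
definition "P2 = {p. prime p \<and> y < p \<and> p \<le> z}"
definition "F1 = {A. A \<subseteq> P1 \<and> card A \<le> 2 * m}"
definition "F2 = {B. B \<subseteq> P2 \<and> \<Prod>B \<le> z}"
definition "G = (\<Sum>B\<in>F2. 1 / phi B)"

text \<open>G times Selberg's optimal weight at the divisor \<Prod>B, so that
  \<open>\<rho> {} = G\<close>; the division by G^2 is left to \<open>cf\<close>.\<close>

definition \<rho> :: "nat set \<Rightarrow> real" where
  "\<rho> B = (- 1) ^ card B * real (\<Prod>B) * (\<Sum>C | C \<in> F2 \<and> B \<subseteq> C. 1 / phi C)"

text \<open>A comes from Brun's sum, B and C from the two factors of Selberg's square. The union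
  gives the least common multiple even when B and C overlap.\<close>

definition "idx = F1 \<times> F2 \<times> F2"
definition md :: "nat set \<times> nat set \<times> nat set \<Rightarrow> nat" where
  "md = (\<lambda>(A, B, C). \<Prod>(A \<union> (B \<union> C)))"
definition cf :: "nat set \<times> nat set \<times> nat set \<Rightarrow> real" where
  "cf = (\<lambda>(A, B, C). (- 1) ^ card A * (\<rho> B * \<rho> C / G\<^sup>2))"

lemma prime_set_P1: "prime_set P1" and prime_set_P2: "prime_set P2"
  by (auto simp: prime_set_def P1_def P2_def)

lemma P1_P2_disjoint: "P1 \<inter> P2 = {}"
  by (auto simp: P1_def P2_def)

lemma F1_prime_set: "A \<in> F1 \<Longrightarrow> prime_set A"
  using prime_set_P1 prime_set_subset by (auto simp: F1_def)

lemma F2_prime_set: "B \<in> F2 \<Longrightarrow> prime_set B"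
  using prime_set_P2 prime_set_subset by (auto simp: F2_def)

lemma finite_F1: "finite F1" and finite_F2: "finite F2"
  using prime_set_finite[OF prime_set_P1] prime_set_finite[OF prime_set_P2] by (auto simp: F1_def F2_def)

lemma F2_down: "B \<in> F2 \<Longrightarrow> A \<subseteq> B \<Longrightarrow> A \<in> F2"
proof -
  assume B: "B \<in> F2" and A: "A \<subseteq> B"
  have "\<Prod>A dvd \<Prod>B" using A F2_prime_set[OF B] prime_set_subset prod_prime_set_dvd_iff by blast
  hence "\<Prod>A \<le> \<Prod>B" using prod_prime_set_pos[OF F2_prime_set[OF B]] by (intro dvd_imp_le) auto
  thus "A \<in> F2" using A B by (auto simp: F2_def)
qed

lemma empty_F1: "{} \<in> F1" and empty_F2: "{} \<in> F2"
  using z by (auto simp: F1_def F2_def)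

lemma G_ge_1: "G \<ge> 1"
proof -
  have "(\<Sum>B\<in>{{}}. 1 / phi B) \<le> G"
    unfolding G_def using finite_F2 empty_F2 F2_prime_set phi_pos
    by (intro sum_mono2) (auto intro: less_imp_le)
  thus ?thesis by (simp add: phi_def)
qed

text \<open>Selberg's weights are at most 1 in absolute value: expanding \<Prod>B as the sum of
  \<open>phi E\<close> over E \<subseteq> B gives a sum of \<open>1 / phi (C - E)\<close>, and the
  sets C - E are distinct members of \<open>F2\<close>.\<close>

lemma abs_rho_le:
  assumes B: "B \<in> F2"
  shows "\<bar>\<rho> B\<bar> \<le> G"
proof -
  let ?S = "{C. C \<in> F2 \<and> B \<subseteq> C}"
  have fin: "finite ?S" using finite_F2 by simp
  have psB: "prime_set B" by (rule F2_prime_set[OF B])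
  have nonneg: "(\<Sum>C\<in>?S. 1 / phi C) \<ge> 0"
    using F2_prime_set phi_pos by (intro sum_nonneg) (auto intro: less_imp_le)
  hence "\<bar>\<rho> B\<bar> = real (\<Prod>B) * (\<Sum>C\<in>?S. 1 / phi C)"
    by (simp add: \<rho>_def abs_mult abs_prod)
  also have "\<dots> = (\<Sum>E\<in>Pow B. phi E) * (\<Sum>C\<in>?S. 1 / phi C)"
    by (simp only: sum_phi_subsets[OF psB])
  also have "\<dots> = (\<Sum>(E, C)\<in>Pow B \<times> ?S. phi E * (1 / phi C))"
    by (simp only: sum_product sum.cartesian_product)
  also have "\<dots> = (\<Sum>(E, C)\<in>Pow B \<times> ?S. 1 / phi (C - E))"
  proof (intro sum.cong refl, clarify)
    fix E C assume *: "E \<subseteq> B" "C \<in> F2" "B \<subseteq> C"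
    have "phi (E \<union> (C - E)) = phi E * phi (C - E)"
      using * F2_prime_set[OF *(2)] by (intro phi_Un_disjoint) (auto intro: prime_set_subset)
    moreover have "E \<union> (C - E) = C" using * by auto
    moreover have "phi E > 0" using * psB by (intro phi_pos) (rule prime_set_subset)
    ultimately show "phi E * (1 / phi C) = 1 / phi (C - E)" by simp
  qed
  also have "\<dots> = (\<Sum>D\<in>(\<lambda>(E, C). C - E) ` (Pow B \<times> ?S). 1 / phi D)"
  proof (subst sum.reindex)
    show "inj_on (\<lambda>(E, C). C - E) (Pow B \<times> ?S)"
    proof (intro inj_onI, clarify)
      fix E C E' C' assume *: "E \<subseteq> B" "E' \<subseteq> B" "B \<subseteq> C" "B \<subseteq> C'" and eq: "C - E = C' - E'"
      have "E = B - (C - E)" "E' = B - (C' - E')" using * by auto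
      hence "E = E'" using eq by simp
      moreover have "C = (C - E) \<union> B" "C' = (C' - E') \<union> B" using * by auto
      ultimately show "E = E' \<and> C = C'" using eq by metis
    qed
  qed (simp add: case_prod_unfold)
  also have "\<dots> \<le> G"
    unfolding G_def using finite_F2 F2_prime_set phi_pos F2_down
    by (intro sum_mono2) (auto intro: less_imp_le)
  finally show ?thesis .
qed

text \<open>Moebius inversion: for fixed C the signs over E \<subseteq> B \<subseteq> C cancel
  unless C = E.\<close>

lemma sum_rho_supersets:
  assumes E: "E \<in> F2"
  shows "(\<Sum>B\<in>F2. of_bool (E \<subseteq> B) * (\<rho> B / real (\<Prod>B))) = (- 1) ^ card E / phi E"
proof -
  have "(\<Sum>B\<in>F2. of_bool (E \<subseteq> B) * (\<rho> B / real (\<Prod>B))) =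
      (\<Sum>B\<in>F2. \<Sum>C\<in>F2. of_bool (E \<subseteq> B) * of_bool (B \<subseteq> C) * (- 1) ^ card B * (1 / phi C))"
  proof (intro sum.cong refl)
    fix B assume B: "B \<in> F2"
    have "real (\<Prod>B) \<noteq> 0" using prod_prime_set_pos[OF F2_prime_set[OF B]] by (simp only: of_nat_eq_0_iff)
    moreover have "a * P * x / P = a * x" if "P \<noteq> 0" for a P x :: real
      using that by simp
    ultimately have "\<rho> B / real (\<Prod>B) = (- 1) ^ card B * (\<Sum>C | C \<in> F2 \<and> B \<subseteq> C. 1 / phi C)"
      unfolding \<rho>_def by blast
    also have "(\<Sum>C | C \<in> F2 \<and> B \<subseteq> C. 1 / phi C) = (\<Sum>C\<in>F2. of_bool (B \<subseteq> C) * (1 / phi C))"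
      using finite_F2 by (subst sum.inter_filter) (auto intro!: sum.cong)
    finally show "of_bool (E \<subseteq> B) * (\<rho> B / real (\<Prod>B)) =
        (\<Sum>C\<in>F2. of_bool (E \<subseteq> B) * of_bool (B \<subseteq> C) * (- 1) ^ card B * (1 / phi C))"
      by (simp only: sum_distrib_left mult_ac)
  qed
  also have "\<dots> = (\<Sum>C\<in>F2. \<Sum>B\<in>F2. of_bool (E \<subseteq> B) * of_bool (B \<subseteq> C) * (- 1) ^ card B * (1 / phi C))"
    by (rule sum.swap)
  also have "\<dots> = (\<Sum>C\<in>F2. if C = E then (- 1) ^ card E / phi E else 0)"
  proof (intro sum.cong refl)
    fix C assume C: "C \<in> F2"
    have "(\<Sum>B\<in>F2. of_bool (E \<subseteq> B) * of_bool (B \<subseteq> C) * (- 1) ^ card B * (1 / phi C)) =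
        (\<Sum>B\<in>F2. of_bool (E \<subseteq> B) * of_bool (B \<subseteq> C) * (- 1) ^ card B) * (1 / phi C)"
      by (simp only: sum_distrib_right)
    also have "(\<Sum>B\<in>F2. of_bool (E \<subseteq> B) * of_bool (B \<subseteq> C) * (- 1) ^ card B) =
        (\<Sum>B | B \<in> F2 \<and> E \<subseteq> B \<and> B \<subseteq> C. (- 1::real) ^ card B)"
      using finite_F2 by (subst sum.inter_filter) (auto intro!: sum.cong)
    also have "{B. B \<in> F2 \<and> E \<subseteq> B \<and> B \<subseteq> C} = {B. E \<subseteq> B \<and> B \<subseteq> C}"
      using F2_down[OF C] by auto
    also have "(\<Sum>B | E \<subseteq> B \<and> B \<subseteq> C. (- 1::real) ^ card B) = (if C = E then (- 1) ^ card E else 0)"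
    proof (cases "E \<subseteq> C")
      case True
      have finC: "finite C" using F2_prime_set[OF C] by (simp add: prime_set_def)
      have "(\<Sum>B | E \<subseteq> B \<and> B \<subseteq> C. (- 1::real) ^ card B) = (\<Sum>X\<in>Pow (C - E). (- 1) ^ card (E \<union> X))"
        using True by (intro sum.reindex_bij_witness[where i = "\<lambda>X. E \<union> X" and j = "\<lambda>B. B - E"])
          (auto simp: Un_absorb1)
      also have "\<dots> = (\<Sum>X\<in>Pow (C - E). (- 1) ^ card E * (- 1) ^ card X)"
      proof (intro sum.cong refl)
        fix X assume X: "X \<in> Pow (C - E)"
        hence "finite X" "finite E" "E \<inter> X = {}" using finC True by (auto intro: finite_subset)
        thus "(- 1::real) ^ card (E \<union> X) = (- 1) ^ card E * (- 1) ^ card X"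
          by (simp add: card_Un_disjoint power_add)
      qed
      also have "\<dots> = (- 1) ^ card E * (\<Sum>X\<in>Pow (C - E). (- 1) ^ card X)"
        by (simp only: sum_distrib_left)
      also have "\<dots> = (if C = E then (- 1) ^ card E else 0)"
        using finC True by (subst sum_alternating_subsets) auto
      finally show ?thesis .
    next
      case False
      hence "{B. E \<subseteq> B \<and> B \<subseteq> C} = {}" "C \<noteq> E" by auto
      thus ?thesis by (simp only: sum.empty if_False)
    qed
    finally show "(\<Sum>B\<in>F2. of_bool (E \<subseteq> B) * of_bool (B \<subseteq> C) * (- 1) ^ card B * (1 / phi C)) =
        (if C = E then (- 1) ^ card E / phi E else 0)"
      by simp
  qed
  also have "\<dots> = (- 1) ^ card E / phi E" using finite_F2 E by simp
  finally show ?thesis .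
qed

text \<open>Selberg's diagonalisation of the quadratic form with matrix \<open>1 / lcm(b, c)\<close>.\<close>

lemma sum_rho_lcm: "(\<Sum>(B, C)\<in>F2 \<times> F2. \<rho> B * \<rho> C / real (\<Prod>(B \<union> C))) = G"
proof -
  define \<tau> where "\<tau> B = \<rho> B / real (\<Prod>B)" for B
  have "(\<Sum>(B, C)\<in>F2 \<times> F2. \<rho> B * \<rho> C / real (\<Prod>(B \<union> C))) =
      (\<Sum>B\<in>F2. \<Sum>C\<in>F2. \<Sum>E\<in>F2. phi E * (of_bool (E \<subseteq> B) * \<tau> B) * (of_bool (E \<subseteq> C) * \<tau> C))"
    unfolding sum.cartesian_product[symmetric]
  proof (intro sum.cong refl)
    fix B C assume B: "B \<in> F2" and C: "C \<in> F2"
    have ps: "prime_set B" "prime_set C" using B C F2_prime_set by auto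
    have pos: "real (\<Prod>B) \<noteq> 0" "real (\<Prod>C) \<noteq> 0" "real (\<Prod>(B \<union> C)) \<noteq> 0"
      using ps[THEN prod_prime_set_pos] prod_prime_set_pos[OF prime_set_Un[OF ps]]
      by (simp_all only: of_nat_eq_0_iff)
    have "\<Prod>(B \<union> C) * \<Prod>(B \<inter> C) = \<Prod>B * \<Prod>C"
      using ps by (intro prod.union_inter) (auto simp: prime_set_def)
    hence "real (\<Prod>(B \<union> C)) * real (\<Prod>(B \<inter> C)) = real (\<Prod>B) * real (\<Prod>C)"
      by (simp only: of_nat_mult[symmetric])
    moreover have "b * c / u = i * (b / b') * (c / c')"
      if "u * i = b' * c'" "u \<noteq> 0" "b' \<noteq> 0" "c' \<noteq> 0" for b c u i b' c' :: real
    proof -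
      have "b * c / u = b * c * (u * i) / (u * (b' * c'))" using that by simp
      thus ?thesis using that(2) by simp
    qed
    ultimately have "\<rho> B * \<rho> C / real (\<Prod>(B \<union> C)) = real (\<Prod>(B \<inter> C)) * \<tau> B * \<tau> C"
      unfolding \<tau>_def using pos by blast
    \<comment> \<open>The greatest common divisor is the sum of the totients of its divisors, which
      separates the variables B and C.\<close>
    also have "real (\<Prod>(B \<inter> C)) = (\<Sum>E\<in>Pow (B \<inter> C). phi E)"
      using ps by (intro sum_phi_subsets[symmetric]) (auto intro: prime_set_subset)
    also have "Pow (B \<inter> C) = {E \<in> F2. E \<subseteq> B \<and> E \<subseteq> C}"
      using F2_down[OF B] by auto
    also have "(\<Sum>E\<in>{E \<in> F2. E \<subseteq> B \<and> E \<subseteq> C}. phi E) = (\<Sum>E\<in>F2. of_bool (E \<subseteq> B) * of_bool (E \<subseteq> C) * phi E)"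
      using finite_F2 by (subst sum.inter_filter) (auto intro!: sum.cong)
    finally show "\<rho> B * \<rho> C / real (\<Prod>(B \<union> C)) =
        (\<Sum>E\<in>F2. phi E * (of_bool (E \<subseteq> B) * \<tau> B) * (of_bool (E \<subseteq> C) * \<tau> C))"
      by (simp only: sum_distrib_right sum_distrib_left mult_ac)
  qed
  also have "\<dots> = (\<Sum>B\<in>F2. \<Sum>E\<in>F2. \<Sum>C\<in>F2. phi E * (of_bool (E \<subseteq> B) * \<tau> B) * (of_bool (E \<subseteq> C) * \<tau> C))"
    by (intro sum.cong refl sum.swap)
  also have "\<dots> = (\<Sum>E\<in>F2. \<Sum>B\<in>F2. \<Sum>C\<in>F2. phi E * (of_bool (E \<subseteq> B) * \<tau> B) * (of_bool (E \<subseteq> C) * \<tau> C))"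
    by (rule sum.swap)
  also have "\<dots> = (\<Sum>E\<in>F2. phi E * ((\<Sum>B\<in>F2. of_bool (E \<subseteq> B) * \<tau> B) * (\<Sum>C\<in>F2. of_bool (E \<subseteq> C) * \<tau> C)))"
    by (intro sum.cong refl, subst sum_product) (simp only: sum_distrib_left mult.assoc)
  also have "\<dots> = (\<Sum>E\<in>F2. 1 / phi E)"
  proof (intro sum.cong refl)
    fix E assume E: "E \<in> F2"
    have "phi E > 0" using F2_prime_set[OF E] by (rule phi_pos)
    thus "phi E * ((\<Sum>B\<in>F2. of_bool (E \<subseteq> B) * \<tau> B) * (\<Sum>C\<in>F2. of_bool (E \<subseteq> C) * \<tau> C)) = 1 / phi E"
      unfolding \<tau>_def sum_rho_supersets[OF E] by (simp add: field_simps flip: power_add mult_2)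
  qed
  finally show ?thesis by (simp add: G_def)
qed

text \<open>A squarefree number up to z splits into a subset of \<open>P1\<close> and a member of
  \<open>F2\<close>. Consequently the density of the combined sieve,
  \<open>phi P1 / \<Prod>P1\<close> times 1 / G, is at most \<open>1 / harm z\<close>.\<close>

lemma harm_le_G: "harm z \<le> real (\<Prod>P1) / phi P1 * G"
proof -
  define P where "P = {p. prime p \<and> p \<le> z}"
  define \<E> where "\<E> = {E. E \<subseteq> P \<and> \<Prod>E \<le> z}"
  have psP: "prime_set P" by (auto simp: P_def prime_set_def)
  have PP: "P \<subseteq> P1 \<union> P2" by (auto simp: P_def P1_def P2_def)
  have "harm z \<le> (\<Sum>E\<in>\<E>. 1 / phi E)"
    unfolding \<E>_def by (rule harm_le_sum_inverse_phi) (simp add: P_def)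
  also have "\<dots> = (\<Sum>E\<in>\<E>. 1 / phi (E \<inter> P1) * (1 / phi (E \<inter> P2)))"
  proof (intro sum.cong refl)
    fix E assume "E \<in> \<E>"
    hence "E = (E \<inter> P1) \<union> (E \<inter> P2)" using PP by (auto simp: \<E>_def)
    moreover have "phi ((E \<inter> P1) \<union> (E \<inter> P2)) = phi (E \<inter> P1) * phi (E \<inter> P2)"
      using P1_P2_disjoint by (intro phi_Un_disjoint prime_set_subset[OF prime_set_P1] prime_set_subset[OF prime_set_P2]) auto
    ultimately show "1 / phi E = 1 / phi (E \<inter> P1) * (1 / phi (E \<inter> P2))" by simp
  qed
  also have "\<dots> = (\<Sum>(A, B)\<in>(\<lambda>E. (E \<inter> P1, E \<inter> P2)) ` \<E>. 1 / phi A * (1 / phi B))"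
  proof (subst sum.reindex)
    show "inj_on (\<lambda>E. (E \<inter> P1, E \<inter> P2)) \<E>"
      using PP by (intro inj_onI) (auto simp: \<E>_def)
  qed simp
  also have "\<dots> \<le> (\<Sum>(A, B)\<in>Pow P1 \<times> F2. 1 / phi A * (1 / phi B))"
  proof (intro sum_mono2)
    show "(\<lambda>E. (E \<inter> P1, E \<inter> P2)) ` \<E> \<subseteq> Pow P1 \<times> F2"
    proof clarsimp
      fix E assume E: "E \<in> \<E>"
      have "prime_set E" using E psP prime_set_subset by (auto simp: \<E>_def)
      hence "\<Prod>(E \<inter> P2) dvd \<Prod>E" using prime_set_subset by (subst prod_prime_set_dvd_iff) auto
      hence "\<Prod>(E \<inter> P2) \<le> \<Prod>E" using prod_prime_set_pos[OF \<open>prime_set E\<close>] by (intro dvd_imp_le) auto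
      thus "E \<inter> P2 \<in> F2" using E by (auto simp: F2_def \<E>_def)
    qed
    show "0 \<le> (case b of (A, B) \<Rightarrow> 1 / phi A * (1 / phi B))"
      if "b \<in> Pow P1 \<times> F2 - (\<lambda>E. (E \<inter> P1, E \<inter> P2)) ` \<E>" for b
    proof -
      obtain A B where b: "b = (A, B)" by force
      have "phi A > 0" using that b prime_set_P1 prime_set_subset by (intro phi_pos) auto
      moreover have "phi B > 0" using that b F2_prime_set by (intro phi_pos) auto
      ultimately show ?thesis using b by simp
    qed
  qed (use finite_F2 prime_set_P1 in \<open>auto simp: prime_set_def\<close>)
  also have "\<dots> = (\<Sum>A\<in>Pow P1. 1 / phi A) * G"
    by (simp only: G_def sum_product sum.cartesian_product)
  also have "(\<Sum>A\<in>Pow P1. 1 / phi A) = real (\<Prod>P1) / phi P1"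
    by (rule sum_inverse_phi_subsets[OF prime_set_P1])
  finally show ?thesis .
qed

text \<open>The divisibility conditions on A, B and C are independent, so the sum is Brun's
  truncated sum times a square. Nonnegativity and the value 1 at large primes are read off from this
  form.\<close>

lemma divisor_sum_eq:
  "divisor_sum idx md cf n = (\<Sum>A | A \<in> F1 \<and> (\<forall>p\<in>A. int p dvd n). (- 1) ^ card A) *
     ((\<Sum>B | B \<in> F2 \<and> (\<forall>p\<in>B. int p dvd n). \<rho> B) / G)\<^sup>2"
proof -
  let ?S1 = "{A. A \<in> F1 \<and> (\<forall>p\<in>A. int p dvd n)}" and ?S2 = "{B. B \<in> F2 \<and> (\<forall>p\<in>B. int p dvd n)}"
  have "{i. i \<in> idx \<and> int (md i) dvd n} = ?S1 \<times> ?S2 \<times> ?S2"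
  proof -
    have "int (md (A, B, C)) dvd n \<longleftrightarrow> (\<forall>p\<in>A. int p dvd n) \<and> (\<forall>p\<in>B. int p dvd n) \<and> (\<forall>p\<in>C. int p dvd n)"
      if "A \<in> F1" "B \<in> F2" "C \<in> F2" for A B C
      using that F1_prime_set F2_prime_set
      by (simp only: md_def prod.case, subst int_prod_prime_set_dvd_iff) (auto intro!: prime_set_Un)
    thus ?thesis by (auto simp: idx_def)
  qed
  hence "divisor_sum idx md cf n = (\<Sum>(A, B, C)\<in>?S1 \<times> ?S2 \<times> ?S2. (- 1) ^ card A * (\<rho> B * \<rho> C / G\<^sup>2))"
    by (simp add: divisor_sum_def cf_def)
  also have "\<dots> = (\<Sum>A\<in>?S1. (- 1) ^ card A) * (\<Sum>(B, C)\<in>?S2 \<times> ?S2. \<rho> B * \<rho> C / G\<^sup>2)"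
    by (simp only: sum_product sum.cartesian_product case_prod_unfold)
  also have "(\<Sum>(B, C)\<in>?S2 \<times> ?S2. \<rho> B * \<rho> C / G\<^sup>2) = (\<Sum>B\<in>?S2. \<Sum>C\<in>?S2. \<rho> B / G * (\<rho> C / G))"
    by (simp add: sum.cartesian_product power2_eq_square)
  also have "\<dots> = ((\<Sum>B\<in>?S2. \<rho> B) / G)\<^sup>2"
    by (simp only: sum_product[symmetric] power2_eq_square sum_divide_distrib)
  finally show ?thesis .
qed

lemma divisor_sum_nonneg: "divisor_sum idx md cf n \<ge> 0"
proof -
  have "{A. A \<in> F1 \<and> (\<forall>p\<in>A. int p dvd n)} = {A. A \<subseteq> {p\<in>P1. int p dvd n} \<and> card A \<le> 2 * m}"
    by (auto simp: F1_def)
  moreover have "finite {p\<in>P1. int p dvd n}" using prime_set_P1 by (simp add: prime_set_def)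
  ultimately have "(\<Sum>A | A \<in> F1 \<and> (\<forall>p\<in>A. int p dvd n). (- 1) ^ card A) \<ge> (0::real)"
    using sum_card_alternating_nonneg by simp
  thus ?thesis unfolding divisor_sum_eq by simp
qed

lemma divisor_sum_prime:
  assumes "prime p" "p > y" "p > z"
  shows "divisor_sum idx md cf (int p) = 1"
proof -
  have no: "\<not> int r dvd int p" if "r \<in> P1 \<union> P2" for r
  proof
    assume "int r dvd int p"
    hence "r dvd p" by simp
    moreover have "prime r" "r \<noteq> p" using that assms by (auto simp: P1_def P2_def)
    ultimately show False using assms primes_dvd_imp_eq by blast
  qed
  have "{A. A \<in> F1 \<and> (\<forall>r\<in>A. int r dvd int p)} = {{}}"
    using no empty_F1 by (auto simp: F1_def)
  moreover have "{A. A \<in> F2 \<and> (\<forall>r\<in>A. int r dvd int p)} = {{}}"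
    using no empty_F2 by (auto simp: F2_def)
  moreover have "\<rho> {} = G" by (simp add: \<rho>_def G_def)
  ultimately show ?thesis unfolding divisor_sum_eq using G_ge_1 by simp
qed

lemma prod_F1_le: "A \<in> F1 \<Longrightarrow> \<Prod>A \<le> y ^ (2 * m)"
  using y by (intro prod_le_power) (auto simp: F1_def P1_def)

lemma prod_Un_le:
  assumes "prime_set A" "prime_set B"
  shows "\<Prod>(A \<union> B) \<le> \<Prod>A * \<Prod>B"
proof -
  have "\<Prod>(A \<union> B) * \<Prod>(A \<inter> B) = \<Prod>A * \<Prod>B"
    using assms by (intro prod.union_inter) (auto simp: prime_set_def)
  moreover have "\<Prod>(A \<inter> B) \<ge> 1"
    using prod_prime_set_pos[OF prime_set_subset[OF assms(1), of "A \<inter> B"]] by auto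
  ultimately show ?thesis by (metis mult_le_mono2 mult.right_neutral)
qed

section \<open>Fourier coefficients of the majorant\<close>

definition "w1 B = (\<Sum>A | A \<in> F1 \<and> B \<subseteq> A. (- 1) ^ card A / real (\<Prod>A))"
definition "w2 B = (\<Sum>(C, D) | (C, D) \<in> F2 \<times> F2 \<and> B \<subseteq> C \<union> D. \<rho> C * \<rho> D / G\<^sup>2 / real (\<Prod>(C \<union> D)))"

text \<open>Brun's moduli are coprime to Selberg's, so each coefficient is a Brun factor times a
  Selberg factor.\<close>

lemma divisor_weight_eq:
  assumes B: "B \<subseteq> P1 \<union> P2"
  shows "divisor_weight idx md cf (\<Prod>B) = w1 (B \<inter> P1) * w2 (B \<inter> P2)"
proof -
  let ?S1 = "{A. A \<in> F1 \<and> B \<inter> P1 \<subseteq> A}" and ?S2 = "{(C, D). (C, D) \<in> F2 \<times> F2 \<and> B \<inter> P2 \<subseteq> C \<union> D}"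
  have psB: "prime_set B"
    using B prime_set_P1 prime_set_P2 prime_set_Un prime_set_subset by blast
  have "{i. i \<in> idx \<and> \<Prod>B dvd md i} = ?S1 \<times> ?S2"
  proof -
    have "\<Prod>B dvd md (A, C, D) \<longleftrightarrow> B \<inter> P1 \<subseteq> A \<and> B \<inter> P2 \<subseteq> C \<union> D"
      if "A \<in> F1" "C \<in> F2" "D \<in> F2" for A C D
    proof -
      have "prime_set (A \<union> (C \<union> D))" using that F1_prime_set F2_prime_set prime_set_Un by blast
      hence "\<Prod>B dvd md (A, C, D) \<longleftrightarrow> B \<subseteq> A \<union> (C \<union> D)"
        using psB by (simp add: md_def prod_prime_set_dvd_iff)
      also have "\<dots> \<longleftrightarrow> B \<inter> P1 \<subseteq> A \<and> B \<inter> P2 \<subseteq> C \<union> D"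
        using that B P1_P2_disjoint unfolding F1_def F2_def by blast
      finally show ?thesis .
    qed
    thus ?thesis by (auto simp: idx_def)
  qed
  hence "divisor_weight idx md cf (\<Prod>B) = (\<Sum>i\<in>?S1 \<times> ?S2. cf i / real (md i))"
    by (simp only: divisor_weight_def)
  also have "\<dots> = (\<Sum>(A, (C, D))\<in>?S1 \<times> ?S2. (- 1) ^ card A / real (\<Prod>A) * (\<rho> C * \<rho> D / G\<^sup>2 / real (\<Prod>(C \<union> D))))"
  proof (intro sum.cong refl, clarify)
    fix A C D assume *: "A \<in> F1" "C \<in> F2" "D \<in> F2"
    have "prime_set (C \<union> D)" using * F2_prime_set prime_set_Un by blast
    moreover have "A \<inter> (C \<union> D) = {}" using * P1_P2_disjoint by (auto simp: F1_def F2_def)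
    ultimately have "\<Prod>(A \<union> (C \<union> D)) = \<Prod>A * \<Prod>(C \<union> D)"
      using F1_prime_set[OF *(1)] by (intro prod_Un_disjoint)
    thus "cf (A, C, D) / real (md (A, C, D)) =
        (- 1) ^ card A / real (\<Prod>A) * (\<rho> C * \<rho> D / G\<^sup>2 / real (\<Prod>(C \<union> D)))"
      by (simp add: cf_def md_def)
  qed
  also have "\<dots> = w1 (B \<inter> P1) * w2 (B \<inter> P2)"
    by (simp only: w1_def w2_def sum_product sum.cartesian_product case_prod_unfold)
  finally show ?thesis .
qed

lemma prod_diff_subset:
  assumes "prime_set A" "B \<subseteq> A"
  shows "\<Prod>A = \<Prod>B * \<Prod>(A - B)"
  using assms by (subst prod_Un_disjoint[symmetric]) (auto intro: prime_set_subset simp: Un_absorb1)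

text \<open>Splitting off B leaves reciprocals of distinct squarefree numbers up to D. Lossy by a
  logarithm, but valid for every B.\<close>

lemma abs_w1_le_harm:
  assumes D: "y ^ (2 * m) \<le> D"
  shows "\<bar>w1 B\<bar> \<le> harm D / real (\<Prod>B)"
proof -
  let ?S = "{A. A \<in> F1 \<and> B \<subseteq> A}"
  have "\<bar>w1 B\<bar> \<le> (\<Sum>A\<in>?S. 1 / real (\<Prod>A))"
    unfolding w1_def by (intro order_trans[OF sum_abs] sum_mono) (auto simp: abs_prod)
  also have "\<dots> = (\<Sum>A\<in>?S. 1 / real (\<Prod>B) * (1 / real (\<Prod>(A - B))))"
  proof (intro sum.cong refl)
    fix A assume "A \<in> ?S"
    hence "\<Prod>A = \<Prod>B * \<Prod>(A - B)" using F1_prime_set by (intro prod_diff_subset) auto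
    thus "1 / real (\<Prod>A) = 1 / real (\<Prod>B) * (1 / real (\<Prod>(A - B)))"
      by (simp only: of_nat_mult) simp
  qed
  also have "\<dots> = 1 / real (\<Prod>B) * (\<Sum>E\<in>(\<lambda>A. A - B) ` ?S. 1 / real (\<Prod>E))"
  proof (subst sum.reindex)
    show "inj_on (\<lambda>A. A - B) ?S" by (intro inj_onI) auto
  qed (simp add: sum_distrib_left)
  also have "(\<Sum>E\<in>(\<lambda>A. A - B) ` ?S. 1 / real (\<Prod>E)) \<le> harm D"
  proof (intro sum_inverse_le_harm)
    fix E assume "E \<in> (\<lambda>A. A - B) ` ?S"
    then obtain A where A: "A \<in> F1" "E = A - B" by auto
    have ps: "prime_set A" by (rule F1_prime_set[OF A(1)])
    hence psE: "prime_set E" using A prime_set_subset by blast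
    have "\<Prod>E dvd \<Prod>A" using A ps psE by (subst prod_prime_set_dvd_iff) auto
    hence "\<Prod>E \<le> \<Prod>A" using prod_prime_set_pos[OF ps] by (intro dvd_imp_le)
    thus "prime_set E \<and> \<Prod>E \<le> D" using psE prod_F1_le[OF A(1)] D by linarith
  qed
  finally show ?thesis by (simp add: mult_left_mono prod_nonneg divide_right_mono)
qed

text \<open>Rankin's trick: sets with more than 2 m primes are weighted by 3^(card A - 2 m) \<ge> 1,
  and the product of 1 + 3/p is compared with the telescoping product of (1 + 1/n)^3.\<close>

lemma sum_many_primes_le:
  "(\<Sum>A | A \<subseteq> P1 \<and> 2 * m < card A. 1 / real (\<Prod>A)) \<le> real (y + 1) ^ 3 / 3 ^ (2 * m)"
proof -
  have fin: "finite P1" using prime_set_P1 by (simp add: prime_set_def)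
  have pos: "p > 0" if "p \<in> P1" for p using that by (auto simp: P1_def prime_gt_0_nat)
  have "(\<Prod>p\<in>P1. 1 + 3 / real p) \<le> (\<Prod>n\<in>{1..y}. 1 + 3 / real n)"
  proof (intro prod_mono2)
    show "P1 \<subseteq> {1..y}" using pos by (auto simp: P1_def dest: prime_ge_1_nat)
  qed simp_all
  also have "\<dots> \<le> (\<Prod>n\<in>{1..y}. (1 + 1 / real n) ^ 3)"
  proof (intro prod_mono conjI)
    fix n :: nat
    have "- 1 \<le> 1 / real n" by (rule order_trans[of _ 0]) auto
    hence "1 + real 3 * (1 / real n) \<le> (1 + 1 / real n) ^ 3"
      by (rule Bernoulli_inequality)
    thus "1 + 3 / real n \<le> (1 + 1 / real n) ^ 3" by simp
  qed auto
  also have "\<dots> = (\<Prod>n\<in>{1..y}. 1 + 1 / real n) ^ 3" by (rule prod_power_distrib[symmetric])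
  also have "(\<Prod>n\<in>{1..y}. 1 + 1 / real n) = real (y + 1)"
  proof (induction y)
    case (Suc k)
    have "real (k + 1) * (1 + 1 / real (Suc k)) = real (Suc k + 1)" by (simp add: field_simps)
    thus ?case using Suc by simp
  qed simp
  finally have prod_le: "(\<Prod>p\<in>P1. 1 + 3 / real p) \<le> real (y + 1) ^ 3" .
  have "(\<Sum>A | A \<subseteq> P1 \<and> 2 * m < card A. 1 / real (\<Prod>A)) \<le>
      (\<Sum>A | A \<subseteq> P1 \<and> 2 * m < card A. 1 / 3 ^ (2 * m) * (\<Prod>p\<in>A. 3 / real p))"
  proof (intro sum_mono)
    fix A assume A: "A \<in> {A. A \<subseteq> P1 \<and> 2 * m < card A}"
    have "(3::real) ^ (2 * m) \<le> 3 ^ card A" using A by (intro power_increasing) auto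
    hence le: "3 ^ (2 * m) * (1 / real (\<Prod>A)) \<le> 3 ^ card A * (1 / real (\<Prod>A))"
      by (intro mult_right_mono) (auto intro!: prod_nonneg)
    have scale: "r \<le> 1 / a * b" if "a * r \<le> b" "a > 0" for a b r :: real
      using that by (simp add: field_simps)
    have "1 / real (\<Prod>A) \<le> 1 / 3 ^ (2 * m) * (3 ^ card A * (1 / real (\<Prod>A)))"
      by (rule scale[OF le]) simp
    thus "1 / real (\<Prod>A) \<le> 1 / 3 ^ (2 * m) * (\<Prod>p\<in>A. 3 / real p)"
      by (simp add: prod_dividef)
  qed
  also have "\<dots> \<le> (\<Sum>A\<in>Pow P1. 1 / 3 ^ (2 * m) * (\<Prod>p\<in>A. 3 / real p))"
    using fin by (intro sum_mono2) (auto intro!: divide_nonneg_nonneg prod_nonneg)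
  also have "\<dots> = (\<Prod>p\<in>P1. 1 + 3 / real p) / 3 ^ (2 * m)"
    using fin by (simp add: prod_1_plus_subsets sum_divide_distrib)
  also have "\<dots> \<le> real (y + 1) ^ 3 / 3 ^ (2 * m)"
    by (intro divide_right_mono prod_le) simp
  finally show ?thesis .
qed

text \<open>Without truncation the alternating sum over the supersets of B is an exact product,
  equal up to sign to \<open>phi P1 / \<Prod>P1 / phi B\<close>. The sets cut off are bounded by
  Rankin's trick.\<close>

lemma abs_w1_le:
  assumes B: "B \<subseteq> P1"
  shows "\<bar>w1 B\<bar> \<le> phi P1 / real (\<Prod>P1) / phi B + real (y + 1) ^ 3 / 3 ^ (2 * m)"
proof -
  have fin: "finite P1" using prime_set_P1 by (simp add: prime_set_def)
  have psB: "prime_set B" and psC: "prime_set (P1 - B)"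
    using B prime_set_P1 prime_set_subset by blast+
  let ?f = "\<lambda>A. (- 1) ^ card A / real (\<Prod>A)"
  let ?S = "{A. A \<subseteq> P1 \<and> B \<subseteq> A}"
  have split: "?S = {A. A \<in> F1 \<and> B \<subseteq> A} \<union> {A. A \<subseteq> P1 \<and> B \<subseteq> A \<and> 2 * m < card A}"
    by (auto simp: F1_def)
  have "(\<Sum>A\<in>?S. ?f A) = w1 B + (\<Sum>A | A \<subseteq> P1 \<and> B \<subseteq> A \<and> 2 * m < card A. ?f A)"
    unfolding w1_def split using finite_F1 fin by (intro sum.union_disjoint) (auto simp: F1_def)
  hence "\<bar>w1 B\<bar> \<le> \<bar>\<Sum>A\<in>?S. ?f A\<bar> + \<bar>\<Sum>A | A \<subseteq> P1 \<and> B \<subseteq> A \<and> 2 * m < card A. ?f A\<bar>"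
    by linarith
  also have "\<bar>\<Sum>A | A \<subseteq> P1 \<and> B \<subseteq> A \<and> 2 * m < card A. ?f A\<bar> \<le>
      (\<Sum>A | A \<subseteq> P1 \<and> B \<subseteq> A \<and> 2 * m < card A. 1 / real (\<Prod>A))"
    by (intro order_trans[OF sum_abs] sum_mono) (auto simp: abs_prod)
  also have "\<dots> \<le> (\<Sum>A | A \<subseteq> P1 \<and> 2 * m < card A. 1 / real (\<Prod>A))"
    using fin by (intro sum_mono2) (auto intro!: prod_nonneg)
  also have "\<dots> \<le> real (y + 1) ^ 3 / 3 ^ (2 * m)" by (rule sum_many_primes_le)
  also have "(\<Sum>A\<in>?S. ?f A) = (\<Sum>X\<in>Pow (P1 - B). ?f B * (\<Prod>p\<in>X. - 1 / real p))"
  proof (rule sum.reindex_bij_witness[where i = "\<lambda>X. B \<union> X" and j = "\<lambda>A. A - B"])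
    fix A assume A: "A \<in> ?S"
    hence psA: "prime_set A" using prime_set_P1 prime_set_subset by blast
    have "card A = card B + card (A - B)"
      using A prime_set_finite[OF psA] by (metis (mono_tags, lifting) card_Diff_subset card_mono finite_subset le_add_diff_inverse mem_Collect_eq)
    moreover have "\<Prod>A = \<Prod>B * \<Prod>(A - B)" using A psA by (intro prod_diff_subset) auto
    moreover have "(\<Prod>p\<in>A - B. - 1 / real p) = (- 1) ^ card (A - B) / real (\<Prod>(A - B))"
      by (simp only: prod_dividef prod_constant of_nat_prod)
    ultimately show "?f B * (\<Prod>p\<in>A - B. - 1 / real p) = ?f A"
      by (simp add: power_add)
  qed (use B in auto)
  also have "\<dots> = ?f B * (\<Prod>p\<in>P1 - B. 1 + - 1 / real p)"
    using fin by (simp only: sum_distrib_left[symmetric] prod_1_plus_subsets finite_Diff)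
  also have "(\<Prod>p\<in>P1 - B. 1 + - 1 / real p) = (\<Prod>p\<in>P1 - B. (real p - 1) / real p)"
  proof (intro prod.cong refl)
    fix p assume "p \<in> P1 - B"
    hence "p > 0" by (auto simp: P1_def prime_gt_0_nat)
    thus "1 + - 1 / real p = (real p - 1) / real p" by (simp add: field_simps)
  qed
  also have "\<dots> = phi (P1 - B) / real (\<Prod>(P1 - B))" by (simp add: prod_dividef phi_def)
  also have "\<bar>?f B * (phi (P1 - B) / real (\<Prod>(P1 - B)))\<bar> = phi (P1 - B) / (real (\<Prod>B) * real (\<Prod>(P1 - B)))"
    using phi_pos[OF psC] by (simp add: abs_mult abs_prod)
  also have "real (\<Prod>B) * real (\<Prod>(P1 - B)) = real (\<Prod>P1)"
    using prod_diff_subset[OF prime_set_P1 B] by (simp only: of_nat_mult)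
  also have "phi (P1 - B) = phi P1 / phi B"
  proof -
    have "phi (B \<union> (P1 - B)) = phi B * phi (P1 - B)"
      using psB psC by (intro phi_Un_disjoint) auto
    moreover have "B \<union> (P1 - B) = P1" using B by auto
    ultimately show ?thesis using phi_pos[OF psB] by simp
  qed
  finally show ?thesis by (simp add: mult.commute)
qed

lemma w2_empty: "w2 {} = 1 / G"
proof -
  have "w2 {} = (\<Sum>(C, D)\<in>F2 \<times> F2. \<rho> C * \<rho> D / G\<^sup>2 / real (\<Prod>(C \<union> D)))"
    unfolding w2_def by (intro sum.cong) auto
  also have "\<dots> = (\<Sum>(C, D)\<in>F2 \<times> F2. \<rho> C * \<rho> D / real (\<Prod>(C \<union> D))) / G\<^sup>2"
    by (simp only: sum_divide_distrib case_prod_unfold divide_divide_eq_left mult.commute)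
  also have "\<dots> = 1 / G" unfolding sum_rho_lcm using G_ge_1 by (simp add: power2_eq_square)
  finally show ?thesis .
qed

text \<open>Since |\<rho>| \<le> G, each pair counts at most the reciprocal of its modulus, and at
  most 4^card E pairs have union E. Splitting off B leaves a sum of 4^card X / \<Prod>X, worth
  \<open>harm D ^ 4\<close>.\<close>

lemma abs_w2_le:
  assumes B: "B \<subseteq> P2" and D: "z\<^sup>2 \<le> D"
  shows "\<bar>w2 B\<bar> \<le> 4 ^ card B * harm D ^ 4 / real (\<Prod>B)"
proof -
  define \<E> where "\<E> = {E. E \<subseteq> P2 \<and> \<Prod>E \<le> D}"
  let ?S = "{(C, C'). (C, C') \<in> F2 \<times> F2 \<and> B \<subseteq> C \<union> C'}"
  have finP2: "finite P2" using prime_set_P2 by (simp add: prime_set_def)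
  have fin: "finite \<E>" "finite ?S"
    using finP2 finite_F2 by (auto simp: \<E>_def intro: finite_subset[of _ "F2 \<times> F2"])
  have ps: "prime_set E" if "E \<in> \<E>" for E using that prime_set_P2 prime_set_subset by (auto simp: \<E>_def)
  have "\<bar>w2 B\<bar> \<le> (\<Sum>(C, C')\<in>?S. 1 / real (\<Prod>(C \<union> C')))"
    unfolding w2_def
  proof (intro order_trans[OF sum_abs] sum_mono, clarify)
    fix C C' assume "C \<in> F2" "C' \<in> F2"
    hence "\<bar>\<rho> C * \<rho> C'\<bar> \<le> G * G" unfolding abs_mult using abs_rho_le G_ge_1 by (intro mult_mono) auto
    hence "\<bar>\<rho> C * \<rho> C' / G\<^sup>2\<bar> \<le> 1" using G_ge_1 by (simp add: power2_eq_square abs_mult divide_le_eq)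
    hence "\<bar>\<rho> C * \<rho> C' / G\<^sup>2\<bar> / real (\<Prod>(C \<union> C')) \<le> 1 / real (\<Prod>(C \<union> C'))"
      by (intro divide_right_mono) (auto intro!: prod_nonneg)
    thus "\<bar>\<rho> C * \<rho> C' / G\<^sup>2 / real (\<Prod>(C \<union> C'))\<bar> \<le> 1 / real (\<Prod>(C \<union> C'))"
      by (simp only: abs_divide abs_of_nat)
  qed
  also have "\<dots> = (\<Sum>E | E \<in> \<E> \<and> B \<subseteq> E. \<Sum>p | p \<in> ?S \<and> fst p \<union> snd p = E. 1 / real (\<Prod>(fst p \<union> snd p)))"
    unfolding case_prod_unfold
  proof (intro sum.group[symmetric])
    show "(\<lambda>p. fst p \<union> snd p) ` {x. (fst x, snd x) \<in> F2 \<times> F2 \<and> B \<subseteq> fst x \<union> snd x} \<subseteq> {E. E \<in> \<E> \<and> B \<subseteq> E}"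
    proof clarsimp
      fix C C' assume *: "C \<in> F2" "C' \<in> F2" "B \<subseteq> C \<union> C'"
      have "\<Prod>(C \<union> C') \<le> \<Prod>C * \<Prod>C'" using * F2_prime_set by (intro prod_Un_le) auto
      also have "\<dots> \<le> z * z" using * by (intro mult_mono) (auto simp: F2_def)
      finally show "C \<union> C' \<in> \<E>" using * D by (auto simp: \<E>_def F2_def power2_eq_square)
    qed
  qed (use fin in \<open>auto simp: case_prod_unfold mem_Times_iff\<close>)
  also have "\<dots> \<le> (\<Sum>E | E \<in> \<E> \<and> B \<subseteq> E. 4 ^ card E / real (\<Prod>E))"
  proof (intro sum_mono)
    fix E assume E: "E \<in> {E. E \<in> \<E> \<and> B \<subseteq> E}"
    hence finE: "finite E" using ps by (simp add: prime_set_def)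
    have "(\<Sum>p | p \<in> ?S \<and> fst p \<union> snd p = E. 1 / real (\<Prod>(fst p \<union> snd p))) =
        (\<Sum>p | p \<in> ?S \<and> fst p \<union> snd p = E. 1 / real (\<Prod>E))"
      by (intro sum.cong) auto
    also have "\<dots> \<le> (\<Sum>p\<in>Pow E \<times> Pow E. 1 / real (\<Prod>E))"
      using finE by (intro sum_mono2) (auto intro!: prod_nonneg)
    also have "\<dots> = real (card (Pow E \<times> Pow E)) * (1 / real (\<Prod>E))" by simp
    also have "card (Pow E \<times> Pow E) = 4 ^ card E"
      using finE by (simp add: card_cartesian_product card_Pow flip: power_mult_distrib)
    finally show "(\<Sum>p | p \<in> ?S \<and> fst p \<union> snd p = E. 1 / real (\<Prod>(fst p \<union> snd p))) \<le> 4 ^ card E / real (\<Prod>E)"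
      by simp
  qed
  also have "\<dots> = (\<Sum>X\<in>(\<lambda>E. E - B) ` {E. E \<in> \<E> \<and> B \<subseteq> E}. 4 ^ card B / real (\<Prod>B) * (4 ^ card X / real (\<Prod>X)))"
  proof (subst sum.reindex)
    show "inj_on (\<lambda>E. E - B) {E. E \<in> \<E> \<and> B \<subseteq> E}" by (intro inj_onI) auto
    show "(\<Sum>E | E \<in> \<E> \<and> B \<subseteq> E. 4 ^ card E / real (\<Prod>E)) =
      sum ((\<lambda>X. 4 ^ card B / real (\<Prod>B) * (4 ^ card X / real (\<Prod>X))) \<circ> (\<lambda>E. E - B)) {E. E \<in> \<E> \<and> B \<subseteq> E}"
    proof (intro sum.cong refl)
      fix E assume E: "E \<in> {E. E \<in> \<E> \<and> B \<subseteq> E}"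
      hence psE: "prime_set E" using ps by auto
      have "card E = card B + card (E - B)"
        using E prime_set_finite[OF psE] by (metis (mono_tags, lifting) card_Diff_subset card_mono finite_subset le_add_diff_inverse mem_Collect_eq)
      moreover have "\<Prod>E = \<Prod>B * \<Prod>(E - B)" using E psE by (intro prod_diff_subset) auto
      ultimately show "4 ^ card E / real (\<Prod>E) =
          ((\<lambda>X. 4 ^ card B / real (\<Prod>B) * (4 ^ card X / real (\<Prod>X))) \<circ> (\<lambda>E. E - B)) E"
        by (simp add: power_add)
    qed
  qed
  also have "\<dots> \<le> (\<Sum>X\<in>\<E>. 4 ^ card B / real (\<Prod>B) * (4 ^ card X / real (\<Prod>X)))"
  proof (intro sum_mono2)
    show "(\<lambda>E. E - B) ` {E. E \<in> \<E> \<and> B \<subseteq> E} \<subseteq> \<E>"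
    proof clarify
      fix E assume E: "E \<in> \<E>" "B \<subseteq> E"
      have "\<Prod>(E - B) dvd \<Prod>E" using ps[OF E(1)] prime_set_subset by (subst prod_prime_set_dvd_iff) auto
      hence "\<Prod>(E - B) \<le> \<Prod>E" using prod_prime_set_pos[OF ps[OF E(1)]] by (intro dvd_imp_le) auto
      thus "E - B \<in> \<E>" using E by (auto simp: \<E>_def)
    qed
  qed (use fin in \<open>auto intro!: mult_nonneg_nonneg divide_nonneg_nonneg prod_nonneg\<close>)
  also have "\<dots> = 4 ^ card B / real (\<Prod>B) * (\<Sum>X\<in>\<E>. real 4 ^ card X / real (\<Prod>X))"
    by (simp add: sum_distrib_left)
  also have "\<dots> \<le> 4 ^ card B / real (\<Prod>B) * harm D ^ 4"
    unfolding \<E>_def by (intro mult_left_mono sum_power_card_le_harm prime_set_P2) (auto intro!: divide_nonneg_nonneg prod_nonneg)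
  finally show ?thesis by simp
qed

definition "Q = {q. \<exists>i\<in>idx. q dvd md i}"

lemma finite_idx: "finite idx"
  using finite_F1 finite_F2 by (simp add: idx_def)

lemma prime_set_idx: "(A, C, C') \<in> idx \<Longrightarrow> prime_set (A \<union> (C \<union> C'))"
  using F1_prime_set F2_prime_set prime_set_Un by (auto simp: idx_def)

lemma md_pos: "i \<in> idx \<Longrightarrow> md i > 0"
  using prod_prime_set_pos[OF prime_set_idx] by (cases i) (auto simp: md_def)

lemma Q_cases:
  assumes "q \<in> Q" and D: "y ^ (2 * m) * z\<^sup>2 \<le> D"
  obtains B where "B \<subseteq> P1 \<union> P2" "q = \<Prod>B" "\<Prod>B \<le> D"
proof -
  obtain A C C' where *: "(A, C, C') \<in> idx" "q dvd \<Prod>(A \<union> (C \<union> C'))"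
    using assms by (auto simp: Q_def md_def)
  have in_F: "A \<in> F1" "C \<in> F2" "C' \<in> F2" using * by (auto simp: idx_def)
  obtain B where B: "B \<subseteq> A \<union> (C \<union> C')" "q = \<Prod>B"
    using prod_prime_set_dvd_ex[OF prime_set_idx[OF *(1)] *(2)] by auto
  have "q \<le> \<Prod>(A \<union> (C \<union> C'))"
    using * md_pos[OF *(1)] by (intro dvd_imp_le) (auto simp: md_def)
  also have "\<dots> \<le> \<Prod>A * \<Prod>(C \<union> C')"
    using in_F F1_prime_set F2_prime_set prime_set_Un by (intro prod_Un_le) auto
  also have "\<dots> \<le> y ^ (2 * m) * (z * z)"
  proof (intro mult_mono prod_F1_le in_F)
    have "\<Prod>(C \<union> C') \<le> \<Prod>C * \<Prod>C'" using in_F F2_prime_set by (intro prod_Un_le) auto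
    also have "\<dots> \<le> z * z" using in_F by (intro mult_mono) (auto simp: F2_def)
    finally show "\<Prod>(C \<union> C') \<le> z * z" .
  qed auto
  finally have "\<Prod>B \<le> D" using D B by (simp add: power2_eq_square)
  moreover have "B \<subseteq> P1 \<union> P2" using B in_F by (auto simp: F1_def F2_def)
  ultimately show thesis using that B by blast
qed

lemma prime_set_P12: "prime_set (P1 \<union> P2)"
  by (rule prime_set_Un[OF prime_set_P1 prime_set_P2])

lemma Q_subset:
  assumes "y ^ (2 * m) * z\<^sup>2 \<le> D"
  shows "Q \<subseteq> {1..D}"
proof
  fix q assume "q \<in> Q"
  then obtain B where "B \<subseteq> P1 \<union> P2" "q = \<Prod>B" "\<Prod>B \<le> D" using Q_cases assms by blast
  thus "q \<in> {1..D}"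
    using prod_prime_set_pos[OF prime_set_subset[OF prime_set_P12, of B]] by auto
qed

lemma D_bounds:
  assumes "y ^ (2 * m) * z\<^sup>2 \<le> D"
  shows "y ^ (2 * m) \<le> D" "z\<^sup>2 \<le> D"
proof -
  have "y ^ (2 * m) * 1 \<le> y ^ (2 * m) * z\<^sup>2"
    using z by (intro mult_le_mono2) simp
  from order_trans[OF this assms] show "y ^ (2 * m) \<le> D" by simp
  have "1 * z\<^sup>2 \<le> y ^ (2 * m) * z\<^sup>2"
    using y by (intro mult_le_mono1) simp
  from order_trans[OF this assms] show "z\<^sup>2 \<le> D" by simp
qed

text \<open>Every factor 4 / r is at most 1 because r > y \<ge> 4; keeping a single one
  suffices.\<close>

lemma four_power_card_le:
  assumes "B \<subseteq> P2" "B \<noteq> {}"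
  shows "4 ^ card B / real (\<Prod>B) \<le> 4 / real y"
proof -
  obtain p where p: "p \<in> B" using assms by auto
  have fin: "finite B" using assms prime_set_P2 finite_subset by (auto simp: prime_set_def)
  have big: "real r > real y" if "r \<in> B" for r using that assms by (auto simp: P2_def)
  have "4 ^ card B / real (\<Prod>B) = (\<Prod>r\<in>B. 4 / real r)"
    by (simp add: prod_dividef)
  also have "\<dots> = 4 / real p * (\<Prod>r\<in>B - {p}. 4 / real r)"
    using fin p by (simp add: prod.remove)
  also have "\<dots> \<le> 4 / real y * 1"
  proof (intro mult_mono)
    show "4 / real p \<le> 4 / real y" using big[OF p] y by (intro divide_left_mono) auto
    show "(\<Prod>r\<in>B - {p}. 4 / real r) \<le> 1"
      using big y by (intro prod_le_1) (force simp: divide_le_eq)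
  qed (auto intro!: prod_nonneg)
  finally show ?thesis by simp
qed

text \<open>Denominators built from primes up to y inherit Brun's main term, with the density of the
  combined sieve in front. Any other denominator has a prime factor beyond y, and its crude bound is
  absorbed in the error.\<close>

lemma abs_divisor_weight_le:
  assumes q: "q \<in> Q" and D: "y ^ (2 * m) * z\<^sup>2 \<le> D"
  shows "\<bar>divisor_weight idx md cf q\<bar> \<le>
    (1 / harm z) / real (totient q) + (real (y + 1) ^ 3 / 3 ^ (2 * m) + 4 * harm D ^ 5 / real y)"
proof -
  obtain B where B: "B \<subseteq> P1 \<union> P2" "q = \<Prod>B" "\<Prod>B \<le> D" using Q_cases q D by blast
  have psB: "prime_set B" using B prime_set_P12 prime_set_subset by blast
  have hz: "harm z > (0::real)" using z by (simp add: harm_pos)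
  have eq: "\<bar>divisor_weight idx md cf q\<bar> = \<bar>w1 (B \<inter> P1)\<bar> * \<bar>w2 (B \<inter> P2)\<bar>"
    using divisor_weight_eq[OF B(1)] B(2) by (simp add: abs_mult)
  show ?thesis
  proof (cases "B \<inter> P2 = {}")
    case True
    hence BP1: "B \<inter> P1 = B" using B by auto
    have phiB: "phi B > 0" by (rule phi_pos[OF psB])
    have "\<bar>divisor_weight idx md cf q\<bar> = \<bar>w1 B\<bar> * (1 / G)"
      using eq True BP1 G_ge_1 by (simp add: w2_empty)
    also have "\<dots> \<le> (phi P1 / real (\<Prod>P1) / phi B + real (y + 1) ^ 3 / 3 ^ (2 * m)) * (1 / G)"
      using B True G_ge_1 by (intro mult_right_mono abs_w1_le) auto
    also have "\<dots> = phi P1 / real (\<Prod>P1) / G / phi B + real (y + 1) ^ 3 / 3 ^ (2 * m) * (1 / G)"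
      by (simp add: algebra_simps)
    \<comment> \<open>The densities of the two sieves are bounded jointly, through the harmonic
      sum.\<close>
    also have "phi P1 / real (\<Prod>P1) / G \<le> 1 / harm z"
    proof -
      have a: "phi P1 > 0" by (rule phi_pos[OF prime_set_P1])
      have b: "real (\<Prod>P1) > 0" using prod_prime_set_pos[OF prime_set_P1] by (simp only: of_nat_0_less_iff)
      have "x / w / G \<le> 1 / h" if "x > 0" "w > 0" "h > 0" "h \<le> w / x * G" for x w h
        using that G_ge_1 by (simp add: field_simps)
      thus ?thesis using a b hz harm_le_G by blast
    qed
    also have "real (y + 1) ^ 3 / 3 ^ (2 * m) * (1 / G) \<le> real (y + 1) ^ 3 / 3 ^ (2 * m) * 1"
      using G_ge_1 by (intro mult_left_mono) auto
    finally have "\<bar>divisor_weight idx md cf q\<bar> \<le> 1 / harm z / phi B + real (y + 1) ^ 3 / 3 ^ (2 * m)"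
      using phiB by (simp add: divide_right_mono)
    moreover have t: "real (totient q) = phi B" using B psB totient_prod_prime_set by simp
    moreover have "4 * harm D ^ 5 / real y \<ge> 0" by (simp add: harm_nonneg)
    ultimately show ?thesis unfolding t by linarith
  next
    case False
    have hD: "harm D \<ge> (0::real)" by (rule harm_nonneg)
    have "real (\<Prod>(B \<inter> P1)) \<ge> 1"
      unfolding real_of_nat_ge_one_iff
      using prod_prime_set_pos[OF prime_set_subset[OF psB, of "B \<inter> P1"]] by auto
    have "\<bar>w1 (B \<inter> P1)\<bar> \<le> harm D / real (\<Prod>(B \<inter> P1))"
      by (rule abs_w1_le_harm[OF D_bounds(1)[OF D]])
    also have "\<dots> \<le> harm D / 1"
      using hD \<open>real (\<Prod>(B \<inter> P1)) \<ge> 1\<close> by (intro divide_left_mono) auto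
    finally have 1: "\<bar>w1 (B \<inter> P1)\<bar> \<le> harm D" by simp
    have "\<bar>w2 (B \<inter> P2)\<bar> \<le> 4 ^ card (B \<inter> P2) * harm D ^ 4 / real (\<Prod>(B \<inter> P2))"
      by (rule abs_w2_le[OF _ D_bounds(2)[OF D]]) auto
    also have "\<dots> = harm D ^ 4 * (4 ^ card (B \<inter> P2) / real (\<Prod>(B \<inter> P2)))" by simp
    also have "\<dots> \<le> harm D ^ 4 * (4 / real y)"
      using hD False by (intro mult_left_mono four_power_card_le) auto
    finally have "\<bar>divisor_weight idx md cf q\<bar> \<le> harm D * (harm D ^ 4 * (4 / real y))"
      unfolding eq using 1 hD by (intro mult_mono) auto
    also have "\<dots> = 4 * harm D ^ 5 / real y" by (simp add: power_numeral_reduce)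
    finally have "\<bar>divisor_weight idx md cf q\<bar> \<le> 4 * harm D ^ 5 / real y" .
    moreover have "1 / harm z / real (totient q) \<ge> 0" by (simp add: harm_nonneg)
    moreover have "real (y + 1) ^ 3 / 3 ^ (2 * m) \<ge> 0" by simp
    ultimately show ?thesis by linarith
  qed
qed

text \<open>With h = \<open>harm D\<close> the crude bounds give |w(q)| \<le> h^5 4^j / q, where j
  counts the primes of q beyond y. So \<phi>(q) w(q)^2 is at most h^10 16^j / q, and the sum of 16^j
  / q is at most h^16: together h^26.\<close>

lemma sum_totient_divisor_weight_le:
  assumes D: "y ^ (2 * m) * z\<^sup>2 \<le> D"
  shows "(\<Sum>q\<in>Q. real (totient q) * (divisor_weight idx md cf q)\<^sup>2) \<le> harm D ^ 26"
proof -
  define \<E> where "\<E> = {E. E \<subseteq> P1 \<union> P2 \<and> \<Prod>E \<le> D}"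
  let ?h = "harm D :: real"
  have ps: "prime_set E" if "E \<in> \<E>" for E using that prime_set_P12 prime_set_subset by (auto simp: \<E>_def)
  have fin: "finite \<E>" using prime_set_finite[OF prime_set_P12] by (simp add: \<E>_def)
  have inj: "inj_on Prod \<E>" using ps prod_prime_set_inj by (intro inj_onI) blast
  have "Q \<subseteq> Prod ` \<E>" using Q_cases[OF _ D] by (auto simp: \<E>_def)
  hence "(\<Sum>q\<in>Q. real (totient q) * (divisor_weight idx md cf q)\<^sup>2) \<le>
      (\<Sum>q\<in>Prod ` \<E>. real (totient q) * (divisor_weight idx md cf q)\<^sup>2)"
    using fin by (intro sum_mono2) auto
  also have "\<dots> = (\<Sum>B\<in>\<E>. real (totient (\<Prod>B)) * (divisor_weight idx md cf (\<Prod>B))\<^sup>2)"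
    using inj by (simp add: sum.reindex)
  also have "\<dots> \<le> (\<Sum>B\<in>\<E>. ?h ^ 10 * (real 16 ^ card B / real (\<Prod>B)))"
  proof (intro sum_mono)
    fix B assume B: "B \<in> \<E>"
    define P where "P = real (\<Prod>(B \<inter> P1))"
    define P' where "P' = real (\<Prod>(B \<inter> P2))"
    define j where "j = card (B \<inter> P2)"
    have psB: "prime_set B" by (rule ps[OF B])
    have fB: "finite B" by (rule prime_set_finite[OF psB])
    have pos: "P > 0" "P' > 0"
      unfolding P_def P'_def of_nat_0_less_iff by (intro prod_prime_set_pos prime_set_subset[OF psB]; simp)+
    have "B = (B \<inter> P1) \<union> (B \<inter> P2)" using B by (auto simp: \<E>_def)
    moreover have "\<Prod>((B \<inter> P1) \<union> (B \<inter> P2)) = \<Prod>(B \<inter> P1) * \<Prod>(B \<inter> P2)"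
      using P1_P2_disjoint by (intro prod_Un_disjoint prime_set_subset[OF psB]) auto
    ultimately have PB: "real (\<Prod>B) = P * P'" unfolding P_def P'_def by (metis of_nat_mult)
    have "\<bar>divisor_weight idx md cf (\<Prod>B)\<bar> = \<bar>w1 (B \<inter> P1)\<bar> * \<bar>w2 (B \<inter> P2)\<bar>"
      using B by (simp add: divisor_weight_eq \<E>_def abs_mult)
    also have "\<dots> \<le> (?h / P) * (4 ^ j * ?h ^ 4 / P')"
      unfolding P_def P'_def j_def using D_bounds[OF D]
      by (intro mult_mono abs_w1_le_harm abs_w2_le) (auto intro!: prod_nonneg divide_nonneg_nonneg simp: harm_nonneg)
    also have "\<dots> = ?h ^ 5 * 4 ^ j / (P * P')" by (simp add: power_numeral_reduce)
    finally have w: "\<bar>divisor_weight idx md cf (\<Prod>B)\<bar> \<le> ?h ^ 5 * 4 ^ j / (P * P')" .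
    have "(divisor_weight idx md cf (\<Prod>B))\<^sup>2 \<le> (?h ^ 5 * 4 ^ j / (P * P'))\<^sup>2"
      using power_mono[OF w, of 2] by simp
    also have "\<dots> = ?h ^ 10 * 16 ^ j / (P * P')\<^sup>2"
    proof -
      have "((4::real) ^ j)\<^sup>2 = 16 ^ j" by (simp add: power2_eq_square flip: power_mult_distrib)
      moreover have "(?h ^ 5)\<^sup>2 = ?h ^ 10" by (simp flip: power_mult)
      ultimately show ?thesis by (simp add: power_mult_distrib power_divide)
    qed
    moreover have "real (totient (\<Prod>B)) \<le> P * P'"
      unfolding PB[symmetric] by (intro of_nat_mono totient_le)
    ultimately have "real (totient (\<Prod>B)) * (divisor_weight idx md cf (\<Prod>B))\<^sup>2 \<le>
        (P * P') * (?h ^ 10 * 16 ^ j / (P * P')\<^sup>2)"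
      using pos by (intro mult_mono) auto
    also have "\<dots> = ?h ^ 10 * (16 ^ j / (P * P'))"
      using pos by (simp add: power2_eq_square)
    also have "\<dots> \<le> ?h ^ 10 * (16 ^ card B / (P * P'))"
    proof (intro mult_left_mono divide_right_mono power_increasing)
      show "j \<le> card B" unfolding j_def using fB by (intro card_mono) auto
    qed (use pos in \<open>auto simp: harm_nonneg\<close>)
    finally show "real (totient (\<Prod>B)) * (divisor_weight idx md cf (\<Prod>B))\<^sup>2 \<le>
        ?h ^ 10 * (real 16 ^ card B / real (\<Prod>B))" unfolding PB by simp
  qed
  also have "\<dots> = ?h ^ 10 * (\<Sum>B\<in>\<E>. real 16 ^ card B / real (\<Prod>B))"
    by (simp only: sum_distrib_left)
  also have "\<dots> \<le> ?h ^ 10 * ?h ^ 16"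
    unfolding \<E>_def by (intro mult_left_mono sum_power_card_le_harm prime_set_P12) (simp add: harm_nonneg)
  finally show ?thesis by (simp flip: power_add)
qed

lemma Q_totient:
  assumes "q \<in> Q"
  shows "1 / real (totient q) \<le>
    (\<Sum>d | d \<in> Prod ` Pow (P1 \<union> P2) \<and> d dvd q. 1 / real (totient d)) / real q"
proof -
  obtain B where "B \<subseteq> P1 \<union> P2" "q = \<Prod>B" using Q_cases[OF assms order_refl] by blast
  thus ?thesis using inverse_totient_le_sum_divisors[OF prime_set_P12] by blast
qed

end

section \<open>Large values on a set of integers\<close>

lemma tanh_le_self:
  fixes x :: real
  assumes "x \<ge> 0"
  shows "tanh x \<le> x"
proof -
  have "0 - tanh 0 \<le> x - tanh x"
  proof (rule DERIV_nonneg_imp_nondecreasing[OF assms])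
    fix y :: real
    have "((\<lambda>x. x - tanh x) has_real_derivative (1 - (1 - tanh y ^ 2))) (at y)"
      by (auto intro!: derivative_eq_intros)
    thus "\<exists>d. ((\<lambda>x. x - tanh x) has_real_derivative d) (at y) \<and> 0 \<le> d" by fastforce
  qed
  thus ?thesis by simp
qed

text \<open>The derivative of t^2 / 2 - ln(cosh t) is t - tanh t, nonnegative for t \<ge> 0; both
  sides are even.\<close>

lemma cosh_le_exp: "cosh t \<le> exp (t\<^sup>2 / 2)" for t :: real
proof -
  have *: "cosh t \<le> exp (t\<^sup>2 / 2)" if t: "t \<ge> 0" for t :: real
  proof -
    have "0\<^sup>2 / 2 - ln (cosh 0) \<le> t\<^sup>2 / 2 - ln (cosh t)"
    proof (rule DERIV_nonneg_imp_nondecreasing[OF t])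
      fix y :: real assume "0 \<le> y"
      have "((\<lambda>x. x\<^sup>2 / 2 - ln (cosh x)) has_real_derivative (y - tanh y)) (at y)"
        by (auto intro!: derivative_eq_intros simp: tanh_def)
      thus "\<exists>d. ((\<lambda>x. x\<^sup>2 / 2 - ln (cosh x)) has_real_derivative d) (at y) \<and> 0 \<le> d"
        using tanh_le_self[OF \<open>0 \<le> y\<close>] by fastforce
    qed
    hence "ln (cosh t) \<le> t\<^sup>2 / 2" by simp
    hence "exp (ln (cosh t)) \<le> exp (t\<^sup>2 / 2)" by (simp only: exp_le_cancel_iff)
    thus ?thesis by (simp only: exp_ln[OF cosh_real_pos])
  qed
  show ?thesis using *[of "\<bar>t\<bar>"] by simp
qed

text \<open>Convexity puts exp below its chord over [-t, t]. In factored form the chord is a factor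
  of a Riesz product with s = tanh t, which stays below 1.\<close>

lemma exp_le_cosh_sinh:
  fixes t v :: real
  assumes "\<bar>v\<bar> \<le> 1"
  shows "exp (t * v) \<le> cosh t * (1 + tanh t * v)"
proof -
  have "convex_on UNIV (exp :: real \<Rightarrow> real)" by (rule exp_convex)
  hence "exp ((1 - (1 - v) / 2) *\<^sub>R t + ((1 - v) / 2) *\<^sub>R (- t)) \<le> (1 - (1 - v) / 2) * exp t + ((1 - v) / 2) * exp (- t)"
    by (rule convex_onD) (use assms in auto)
  also have "(1 - (1 - v) / 2) *\<^sub>R t + ((1 - v) / 2) *\<^sub>R (- t) = t * v" by (simp add: field_simps)
  also have "(1 - (1 - v) / 2) * exp t + ((1 - v) / 2) * exp (- t) = cosh t + v * sinh t"
    by (simp add: cosh_def sinh_def field_simps)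
  also have "\<dots> = cosh t * (1 + tanh t * v)" by (simp add: tanh_def algebra_simps)
  finally show ?thesis .
qed

lemma exp_le_sum_riesz:
  assumes S: "finite S" "S \<noteq> {}" and X: "finite X" and A: "A > 0" and t: "t \<ge> 0"
    and large: "\<And>u. u \<in> X \<Longrightarrow> cmod (\<Sum>p\<in>S. e (real p * of_int u / real U)) \<ge> real (card S) / A"
  shows "\<exists>\<phi>. exp (t * real (card X) / A) \<le>
    exp (t\<^sup>2 * real (card X) / 2) / real (card S) * (\<Sum>p\<in>S. riesz U X (tanh t) \<phi> (int p))"
proof -
  define z where "z u = (\<Sum>p\<in>S. e (real p * of_int u / real U))" for u :: int
  \<comment> \<open>This phase rotates the exponential sum at u onto the nonnegative reals, so that
    it equals a sum of cosines.\<close>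
  define \<phi> where "\<phi> u = - Arg (z u) / (2 * pi)" for u
  define v where "v u p = cos (2 * pi * (of_int (int p * u) / real U + \<phi> u))" for u p
  have cardS: "real (card S) > 0" using S by (simp add: card_gt_0_iff)
  have v_sum: "(\<Sum>p\<in>S. v u p) = cmod (z u)" for u
  proof -
    have "(\<Sum>p\<in>S. v u p) = Re (\<Sum>p\<in>S. e (real p * of_int u / real U) * e (\<phi> u))"
      by (simp add: v_def e_add[symmetric]) (simp add: e_cis)
    also have "\<dots> = Re (z u * cis (- Arg (z u)))"
    proof -
      have "e (\<phi> u) = cis (- Arg (z u))" by (simp add: e_cis \<phi>_def)
      thus ?thesis by (simp only: z_def sum_distrib_right[symmetric])
    qed
    also have "z u * cis (- Arg (z u)) = of_real (cmod (z u))"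
    proof -
      have "w * cis (- a) = of_real r" if "w = of_real r * cis a" for w :: complex and a r
        by (simp add: that mult.assoc cis_mult)
      moreover have "z u = of_real (cmod (z u)) * cis (Arg (z u))" by (metis rcis_cmod_Arg rcis_def)
      ultimately show ?thesis by blast
    qed
    also have "Re (of_real (cmod (z u))) = cmod (z u)" by simp
    finally show ?thesis .
  qed
  define f where "f p = (\<Sum>u\<in>X. v u p)" for p
  define a where "a = real (card X) / A"
  have "(\<Sum>p\<in>S. f p) = (\<Sum>u\<in>X. cmod (z u))"
    unfolding f_def by (subst sum.swap) (simp add: v_sum)
  also have "\<dots> \<ge> (\<Sum>u\<in>X. real (card S) / A)"
    using large by (intro sum_mono) (simp add: z_def)
  finally have f_sum: "(\<Sum>p\<in>S. f p) \<ge> real (card S) * a" by (simp add: a_def mult.commute)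
  \<comment> \<open>Jensen's inequality by way of the tangent to exp at t a; it uses that the mean
    of f over S is at least a.\<close>
  have "real (card S) * exp (t * a) \<le> (\<Sum>p\<in>S. exp (t * a) * (1 + (t * f p - t * a)))"
  proof -
    have "(\<Sum>p\<in>S. exp (t * a) * (1 + (t * f p - t * a))) =
        exp (t * a) * (real (card S) + (t * (\<Sum>p\<in>S. f p) - t * (real (card S) * a)))"
      by (simp add: sum_distrib_left sum.distrib sum_subtractf algebra_simps)
    moreover have "t * (\<Sum>p\<in>S. f p) \<ge> t * (real (card S) * a)"
      using f_sum t by (intro mult_left_mono) auto
    hence "exp (t * a) * real (card S) \<le> exp (t * a) * (real (card S) + (t * (\<Sum>p\<in>S. f p) - t * (real (card S) * a)))"
      by (intro mult_left_mono) auto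
    ultimately show ?thesis by (simp add: mult.commute)
  qed
  also have "\<dots> \<le> (\<Sum>p\<in>S. exp (t * f p))"
  proof (intro sum_mono)
    fix p assume "p \<in> S"
    have "exp (t * a) * (1 + (t * f p - t * a)) \<le> exp (t * a) * exp (t * f p - t * a)"
      using exp_ge_add_one_self[of "t * f p - t * a"] by (intro mult_left_mono) auto
    thus "exp (t * a) * (1 + (t * f p - t * a)) \<le> exp (t * f p)" by (simp flip: exp_add)
  qed
  also have "\<dots> \<le> (\<Sum>p\<in>S. exp (t\<^sup>2 * real (card X) / 2) * riesz U X (tanh t) \<phi> (int p))"
  proof (intro sum_mono)
    fix p assume "p \<in> S"
    have pos: "0 \<le> 1 + tanh t * v u p" for u
    proof -
      have "0 \<le> exp (t * v u p)" by simp
      also have "\<dots> \<le> cosh t * (1 + tanh t * v u p)" by (intro exp_le_cosh_sinh) (simp add: v_def)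
      finally show ?thesis by (meson cosh_real_pos linorder_not_less mult_pos_neg)
    qed
    have "exp (t * f p) = (\<Prod>u\<in>X. exp (t * v u p))"
      using X by (simp add: f_def sum_distrib_left exp_sum)
    also have "\<dots> \<le> (\<Prod>u\<in>X. exp (t\<^sup>2 / 2) * (1 + tanh t * v u p))"
    proof (intro prod_mono conjI)
      fix u
      have "exp (t * v u p) \<le> cosh t * (1 + tanh t * v u p)"
        by (intro exp_le_cosh_sinh) (simp add: v_def)
      also have "\<dots> \<le> exp (t\<^sup>2 / 2) * (1 + tanh t * v u p)"
        using pos by (intro mult_right_mono cosh_le_exp)
      finally show "exp (t * v u p) \<le> exp (t\<^sup>2 / 2) * (1 + tanh t * v u p)" .
    qed simp
    also have "\<dots> = exp (t\<^sup>2 / 2) ^ card X * riesz U X (tanh t) \<phi> (int p)"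
      by (simp add: prod.distrib riesz_def v_def)
    also have "exp (t\<^sup>2 / 2) ^ card X = exp (t\<^sup>2 * real (card X) / 2)"
      by (simp add: mult_ac flip: exp_of_nat_mult)
    finally show "exp (t * f p) \<le> exp (t\<^sup>2 * real (card X) / 2) * riesz U X (tanh t) \<phi> (int p)" .
  qed
  also have "\<dots> = exp (t\<^sup>2 * real (card X) / 2) * (\<Sum>p\<in>S. riesz U X (tanh t) \<phi> (int p))"
    by (simp only: sum_distrib_left)
  finally have "exp (t * a) \<le> exp (t\<^sup>2 * real (card X) / 2) / real (card S) * (\<Sum>p\<in>S. riesz U X (tanh t) \<phi> (int p))"
    using cardS by (simp add: field_simps)
  thus ?thesis by (auto simp: a_def)
qed

text \<open>The product is nonnegative with period U and mean 1, and M div U + 1 full periods cover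
  the range.\<close>

lemma sum_riesz_interval_le:
  assumes "finite X" "U > 0" "dissociated (int U) X" "0 \<le> s" "s \<le> 1"
  shows "(\<Sum>n=1..M. riesz U X s \<phi> (int n)) \<le> real M + real U"
proof -
  have period: "riesz U X s \<phi> (int (j * U + n)) = riesz U X s \<phi> (int n)" for j n
    unfolding riesz_def
  proof (intro prod.cong refl)
    fix u assume "u \<in> X"
    have "2 * pi * (of_int (int (j * U + n) * u) / real U + \<phi> u) =
        2 * pi * (of_int (int n * u) / real U + \<phi> u) + 2 * pi * of_int (int j * u)"
      using assms(2) by (simp add: field_simps)
    thus "1 + s * cos (2 * pi * (of_int (int (j * U + n) * u) / real U + \<phi> u)) =
        1 + s * cos (2 * pi * (of_int (int n * u) / real U + \<phi> u))"
      by (simp only: cos_add cos_int_2pin sin_int_2pin) simp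
  qed
  define k where "k = M div U + 1"
  have "M < k * U" using assms(2) by (simp add: k_def dividend_less_div_times)
  hence "(\<Sum>n=1..M. riesz U X s \<phi> (int n)) \<le> (\<Sum>n<k * U. riesz U X s \<phi> (int n))"
    using assms by (intro sum_mono2 riesz_nonneg) auto
  also have "\<dots> = (\<Sum>j<k. \<Sum>n\<in>{j * U..<j * U + U}. riesz U X s \<phi> (int n))"
    by (rule sum.nat_group[symmetric])
  also have "\<dots> = (\<Sum>j<k. \<Sum>n<U. riesz U X s \<phi> (int n))"
  proof (rule sum.cong[OF refl])
    fix j
    have "(\<Sum>n\<in>{j * U..<j * U + U}. riesz U X s \<phi> (int n)) = (\<Sum>n\<in>{0..<U}. riesz U X s \<phi> (int (n + j * U)))"
      using sum.shift_bounds_nat_ivl[of "\<lambda>n. riesz U X s \<phi> (int n)" 0 "j * U" U] by (simp add: add.commute)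
    also have "\<dots> = (\<Sum>n<U. riesz U X s \<phi> (int n))"
      using period[of j] by (simp only: add.commute[of _ "j * U"] atLeast0LessThan)
    finally show "(\<Sum>n\<in>{j * U..<j * U + U}. riesz U X s \<phi> (int n)) = (\<Sum>n<U. riesz U X s \<phi> (int n))" .
  qed
  also have "\<dots> = real k * real U" using sum_riesz[OF assms(1-3)] by simp
  also have "\<dots> \<le> real M + real U"
  proof -
    have "(M div U) * U \<le> M" by simp
    hence "real (M div U) * real U \<le> real M" by (metis of_nat_le_iff of_nat_mult)
    thus ?thesis by (simp add: k_def algebra_simps)
  qed
  finally show ?thesis .
qed

lemma tanh_unit_interval: "t \<ge> 0 \<Longrightarrow> 0 \<le> tanh t \<and> tanh t \<le> (1::real)"
  using tanh_real_bounds[of t] by (simp add: less_imp_le)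

text \<open>For \<open>S\<close> dense in the primes up to \<open>M\<close> this loses a term \<open>2 A\<^sup>2 ln (ln M)\<close>.\<close>

lemma chang_bound:
  assumes "S \<subseteq> {1..M}" "S \<noteq> {}" "finite X" "U > 0" "dissociated (int U) X" "A \<ge> 1"
    and large: "\<And>u. u \<in> X \<Longrightarrow> cmod (\<Sum>p\<in>S. e (real p * of_int u / real U)) \<ge> real (card S) / A"
  shows "real (card X) \<le> 2 * A\<^sup>2 * ln ((real M + real U) / real (card S))"
proof -
  have S: "finite S" using assms(1) finite_subset by blast
  have cardS: "real (card S) > 0" using S assms(2) by (simp add: card_gt_0_iff)
  \<comment> \<open>The choice t = 1 / A maximises t / A - t^2 / 2, the exponent gained per element
    of X.\<close>
  obtain \<phi> where \<phi>: "exp (1 / A * real (card X) / A) \<le>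
    exp ((1 / A)\<^sup>2 * real (card X) / 2) / real (card S) * (\<Sum>p\<in>S. riesz U X (tanh (1 / A)) \<phi> (int p))"
    using exp_le_sum_riesz[OF S assms(2,3), of A "1 / A" U] assms(6) large by auto
  have t: "0 \<le> tanh (1 / A)" "tanh (1 / A) \<le> 1" using tanh_unit_interval[of "1 / A"] assms(6) by auto
  have "(\<Sum>p\<in>S. riesz U X (tanh (1 / A)) \<phi> (int p)) \<le> (\<Sum>n=1..M. riesz U X (tanh (1 / A)) \<phi> (int n))"
    using assms(1) t by (intro sum_mono2 riesz_nonneg) auto
  also have "\<dots> \<le> real M + real U"
    by (rule sum_riesz_interval_le) (use assms t in auto)
  finally have "exp ((1 / A)\<^sup>2 * real (card X) / 2) / real (card S) * (\<Sum>p\<in>S. riesz U X (tanh (1 / A)) \<phi> (int p)) \<le>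
      exp ((1 / A)\<^sup>2 * real (card X) / 2) / real (card S) * (real M + real U)"
    using cardS by (intro mult_left_mono) auto
  with \<phi> have "exp (real (card X) / A\<^sup>2) \<le> exp (real (card X) / A\<^sup>2 / 2) * ((real M + real U) / real (card S))"
    by (simp add: power2_eq_square)
  moreover have "exp (real (card X) / A\<^sup>2) = exp (real (card X) / A\<^sup>2 / 2) * exp (real (card X) / A\<^sup>2 / 2)"
    by (simp flip: exp_add)
  ultimately have "exp (real (card X) / A\<^sup>2 / 2) * exp (real (card X) / A\<^sup>2 / 2) \<le>
      exp (real (card X) / A\<^sup>2 / 2) * ((real M + real U) / real (card S))" by (simp only:)
  hence "exp (real (card X) / A\<^sup>2 / 2) \<le> (real M + real U) / real (card S)"
    by (simp only: mult_le_cancel_left_pos exp_gt_zero)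
  hence "ln (exp (real (card X) / A\<^sup>2 / 2)) \<le> ln ((real M + real U) / real (card S))"
    using assms(4) cardS by (subst ln_le_cancel_iff) (auto intro!: divide_pos_pos)
  thus ?thesis using assms(6) by (simp add: field_simps)
qed

section \<open>Chebyshev's upper bound for the number of primes\<close>

lemma binomial_le_four_power: "(2 * m + 1) choose m \<le> 4 ^ m"
proof -
  have "2 * ((2 * m + 1) choose m) = ((2 * m + 1) choose m) + ((2 * m + 1) choose (m + 1))"
    using binomial_symmetric[of m "2 * m + 1"] by simp
  also have "\<dots> = (\<Sum>k\<in>{m, m + 1}. (2 * m + 1) choose k)" by simp
  also have "\<dots> \<le> (\<Sum>k\<le>2 * m + 1. (2 * m + 1) choose k)" by (intro sum_mono2) auto
  also have "\<dots> = 2 ^ (2 * m + 1)" by (rule choose_row_sum)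
  finally show ?thesis by (simp add: power_mult)
qed

text \<open>Erdos's induction: for n = 2 m + 1 the primes from m + 2 to n all divide the binomial
  coefficient (n choose m), and the smaller ones are covered by the case m + 1. An even n > 2 is not
  prime.\<close>

lemma primorial_le: "\<Prod>{p. prime p \<and> p \<le> n} \<le> 4 ^ (n::nat)"
proof (induction n rule: less_induct)
  case (less n)
  have ps: "prime_set {p. prime p \<and> a < p \<and> p \<le> b}" for a b :: nat
    by (auto simp: prime_set_def)
  consider "n < 3" | "n \<ge> 3" "even n" | "n \<ge> 3" "odd n" by linarith
  thus ?case
  proof cases
    case 1
    show ?thesis
    proof (cases "n = 2")
      case True
      hence "{p. prime p \<and> p \<le> n} = {2}" by (auto dest: prime_ge_2_nat)
      thus ?thesis using True by simp
    next
      case False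
      hence "{p. prime p \<and> p \<le> n} = {}" using 1 by (auto dest: prime_ge_2_nat)
      thus ?thesis by (simp only: prod.empty) simp
    qed
  next
    case 2
    have "\<not> prime n" using 2 prime_odd_nat by (metis One_nat_def Suc_1 Suc_le_lessD eval_nat_numeral(3))
    hence "{p. prime p \<and> p \<le> n} = {p. prime p \<and> p \<le> n - 1}" using 2
      by (metis (no_types, opaque_lifting) One_nat_def diff_le_self le_trans nat_less_le Suc_pred less_Suc_eq_le le_eq_less_or_eq not_numeral_le_zero gr0I)
    hence "\<Prod>{p. prime p \<and> p \<le> n} \<le> 4 ^ (n - 1)" using less[of "n - 1"] 2 by simp
    also have "\<dots> \<le> 4 ^ n" by (intro power_increasing) auto
    finally show ?thesis .
  next
    case 3
    then obtain m where m: "n = 2 * m + 1" by (elim oddE)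
    have "m \<ge> 1" using 3 m by auto
    let ?A = "{p. prime p \<and> p \<le> m + 1}" and ?B = "{p. prime p \<and> m + 1 < p \<and> p \<le> n}"
    have "{p. prime p \<and> p \<le> n} = ?A \<union> ?B" using m by auto
    moreover have "\<Prod>(?A \<union> ?B) = \<Prod>?A * \<Prod>?B"
      by (intro prod.union_disjoint) auto
    moreover have "\<Prod>?A \<le> 4 ^ (m + 1)" using less[of "m + 1"] m \<open>m \<ge> 1\<close> by simp
    moreover have "\<Prod>?B \<le> (2 * m + 1) choose m"
    proof (rule dvd_imp_le)
      have "int (\<Prod>?B) dvd int ((2 * m + 1) choose m)"
      proof (subst int_prod_prime_set_dvd_iff[OF ps], safe)
        fix p assume p: "prime p" "m + 1 < p" "p \<le> n"
        have "fact m * fact (m + 1) * ((2 * m + 1) choose m) = (fact (2 * m + 1) :: nat)"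
          using binomial_fact_lemma[of m "2 * m + 1"] by simp
        moreover have "p dvd fact (2 * m + 1)" using p m by (simp add: prime_dvd_fact_iff del: fact_Suc)
        moreover have "\<not> p dvd fact m" "\<not> p dvd fact (m + 1)" using p by (simp_all add: prime_dvd_fact_iff del: fact_Suc)
        ultimately have "p dvd (2 * m + 1) choose m" using p(1) by (metis prime_dvd_mult_iff)
        thus "int p dvd int ((2 * m + 1) choose m)" by (simp only: int_dvd_int_iff)
      qed
      thus "\<Prod>?B dvd (2 * m + 1) choose m" by (simp only: int_dvd_int_iff)
    qed simp
    ultimately have "\<Prod>{p. prime p \<and> p \<le> n} \<le> 4 ^ (m + 1) * 4 ^ m"
      using binomial_le_four_power[of m] by (simp only:) (intro mult_mono; simp)
    also have "\<dots> = 4 ^ n" using m by (simp flip: power_add)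
    finally show ?thesis .
  qed
qed

text \<open>Primes beyond N^\<alpha> have logarithm at least \<alpha> ln N, while the logarithms of
  all primes up to N add up to at most N ln 4. The parameter trades the factor 1 / \<alpha> against
  the term N^\<alpha>.\<close>

lemma card_primes_le:
  fixes N \<alpha> :: real
  assumes S: "S \<subseteq> {p. prime p \<and> real p \<le> N}" and N: "N > 1" and \<alpha>: "\<alpha> > 0"
  shows "real (card S) \<le> N powr \<alpha> + ln 4 / \<alpha> * (N / ln N)"
proof -
  have lnN: "ln N > 0" using N by simp
  have "S \<subseteq> {..nat \<lfloor>N\<rfloor>}" using S by (auto simp: le_nat_floor)
  hence fin: "finite S" using finite_subset by blast
  define S1 where "S1 = {p\<in>S. real p \<le> N powr \<alpha>}"
  define S2 where "S2 = {p\<in>S. \<not> real p \<le> N powr \<alpha>}"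
  have "card S = card S1 + card S2"
    using fin by (subst card_Un_disjoint[symmetric]) (auto simp: S1_def S2_def intro: arg_cong[where f = card])
  moreover have "real (card S1) \<le> N powr \<alpha>"
  proof -
    have "S1 \<subseteq> {1..nat \<lfloor>N powr \<alpha>\<rfloor>}"
      using S by (auto simp: S1_def le_nat_floor Suc_le_eq prime_gt_0_nat)
    hence "card S1 \<le> nat \<lfloor>N powr \<alpha>\<rfloor>" using card_mono[of "{1..nat \<lfloor>N powr \<alpha>\<rfloor>}" S1] by simp
    hence "real (card S1) \<le> real (nat \<lfloor>N powr \<alpha>\<rfloor>)" by (simp only: of_nat_le_iff)
    also have "\<dots> \<le> N powr \<alpha>" by simp
    finally show ?thesis .
  qed
  moreover have "real (card S2) \<le> ln 4 / \<alpha> * (N / ln N)"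
  proof -
    let ?P = "{p. prime p \<and> p \<le> nat \<lfloor>N\<rfloor>}"
    have "real (card S2) * (\<alpha> * ln N) = (\<Sum>p\<in>S2. \<alpha> * ln N)" by simp
    also have "\<dots> \<le> (\<Sum>p\<in>S2. ln (real p))"
    proof (intro sum_mono)
      fix p assume "p \<in> S2"
      hence "N powr \<alpha> < real p" by (simp add: S2_def)
      moreover have "0 < N powr \<alpha>" using N by simp
      ultimately have "ln (N powr \<alpha>) \<le> ln (real p)" by (subst ln_le_cancel_iff) linarith+
      thus "\<alpha> * ln N \<le> ln (real p)" using N by (simp add: ln_powr)
    qed
    also have "\<dots> \<le> (\<Sum>p\<in>?P. ln (real p))"
    proof (intro sum_mono2)
      fix p assume "p \<in> ?P - S2"
      hence "1 \<le> real p" by (auto dest: prime_ge_1_nat)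
      thus "0 \<le> ln (real p)" by simp
    qed (use S in \<open>auto simp: S2_def le_nat_floor\<close>)
    also have "\<dots> = ln (real (\<Prod>?P))"
      by (subst of_nat_prod, subst ln_prod) (auto simp: prime_gt_0_nat)
    also have "\<dots> \<le> ln (4 ^ nat \<lfloor>N\<rfloor>)"
    proof (subst ln_le_cancel_iff)
      have "prime_set ?P" by (auto simp: prime_set_def)
      thus "0 < real (\<Prod>?P)" unfolding of_nat_0_less_iff by (rule prod_prime_set_pos)
      have "real (\<Prod>?P) \<le> real (4 ^ nat \<lfloor>N\<rfloor>)" by (intro of_nat_mono primorial_le)
      thus "real (\<Prod>?P) \<le> 4 ^ nat \<lfloor>N\<rfloor>" by simp
    qed simp
    also have "\<dots> = real (nat \<lfloor>N\<rfloor>) * ln 4" by (simp add: ln_realpow)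
    also have "\<dots> \<le> N * ln 4" using N by (intro mult_right_mono) auto
    finally show ?thesis using \<alpha> lnN by (simp add: field_simps)
  qed
  ultimately show ?thesis by simp
qed

section \<open>Dense sets of primes\<close>

lemma exp_partial_sum_le:
  fixes x :: real
  assumes "x \<ge> 0"
  shows "(\<Sum>k\<le>n. x ^ k / fact k) \<le> exp x"
proof -
  have "(\<lambda>k. x ^ k / fact k) sums exp x"
    using exp_converges[of x] by (simp add: field_simps)
  hence "(\<Sum>k\<le>n. x ^ k / fact k) \<le> (\<Sum>k. x ^ k / fact k)"
    using assms by (intro sum_le_suminf) (auto simp: sums_iff)
  also have "\<dots> = exp x" using \<open>(\<lambda>k. x ^ k / fact k) sums exp x\<close> by (simp add: sums_iff)
  finally show ?thesis .
qed

lemma power_fact_le_exp: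
  fixes x :: real
  assumes "x \<ge> 0"
  shows "x ^ k / fact k \<le> exp x"
proof -
  have "x ^ k / fact k \<le> (\<Sum>j\<le>k. x ^ j / fact j)"
    using assms by (intro member_le_sum) auto
  thus ?thesis using exp_partial_sum_le[OF assms, of k] by linarith
qed

text \<open>Cauchy--Schwarz against the geometric weights (2/3)^k, of total at most 3 with sqrt 3
  \<le> 7/4. The inverse ratio 3/2 multiplies x inside the exponential, and the root halves it to
  3/4.\<close>

lemma sum_sqrt_power_fact_le:
  fixes x :: real
  assumes "x \<ge> 0"
  shows "(\<Sum>k\<le>n. sqrt (x ^ k / fact k)) \<le> 7 / 4 * exp (3 / 4 * x)"
proof -
  let ?a = "\<lambda>k. sqrt ((3 / 2 * x) ^ k / fact k)" and ?b = "\<lambda>k. sqrt ((2 / 3) ^ k)"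
  have "(\<Sum>k\<le>n. sqrt (x ^ k / fact k)) = (\<Sum>k\<le>n. ?a k * ?b k)"
  proof (intro sum.cong refl)
    fix k
    have "(3 / 2 * x) ^ k * (2 / 3) ^ k = (3 / 2 * x * (2 / 3)) ^ k"
      by (rule power_mult_distrib[symmetric])
    also have "3 / 2 * x * (2 / 3) = x" by simp
    finally have "x ^ k / fact k = (3 / 2 * x) ^ k / fact k * (2 / 3) ^ k"
      by (simp only: times_divide_eq_left)
    thus "sqrt (x ^ k / fact k) = ?a k * ?b k" by (simp only: real_sqrt_mult)
  qed
  also have "\<dots> \<le> sqrt ((\<Sum>k\<le>n. (?a k)\<^sup>2) * (\<Sum>k\<le>n. (?b k)\<^sup>2))"
    by (intro real_le_rsqrt Cauchy_Schwarz_ineq_sum)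
  also have "\<dots> \<le> sqrt (exp (3 / 2 * x) * 3)"
  proof (intro real_sqrt_le_mono mult_mono)
    show "(\<Sum>k\<le>n. (?a k)\<^sup>2) \<le> exp (3 / 2 * x)"
      using assms exp_partial_sum_le[of "3 / 2 * x" n] by simp
    have "(\<Sum>k\<le>n. (2 / 3 :: real) ^ k) = 3 - 2 * (2 / 3) ^ n" by (induction n) simp_all
    thus "(\<Sum>k\<le>n. (?b k)\<^sup>2) \<le> 3" by simp
  qed (auto intro: sum_nonneg)
  also have "\<dots> \<le> sqrt ((7 / 4 * exp (3 / 4 * x))\<^sup>2)"
  proof (intro real_sqrt_le_mono)
    have "exp (3 / 2 * x) = exp (3 / 4 * x) ^ 2" by (simp flip: exp_of_nat_mult)
    thus "exp (3 / 2 * x) * 3 \<le> (7 / 4 * exp (3 / 4 * x))\<^sup>2" by (simp add: power_mult_distrib power_divide)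
  qed
  finally show ?thesis by simp
qed

text \<open>x^k / k! equals (e^2 x)^k / k! times exp(-2 k), so it is at most exp(e^2 x - 2 k). The
  root leaves exp(-k), and e^2 / 2 \<le> 37/10.\<close>

lemma sum_sqrt_power_fact_tail_le:
  fixes x :: real
  assumes "x \<ge> 0"
  shows "(\<Sum>k\<in>{k0<..n}. sqrt (x ^ k / fact k)) \<le> exp (37 / 10 * x - real k0)"
proof -
  have each: "sqrt (x ^ k / fact k) \<le> exp (37 / 10 * x) * exp (- real k)" for k
  proof -
    have e2: "exp (2::real) \<le> 74 / 10"
    proof -
      have "exp (2::real) = exp 1 ^ 2" by (simp flip: exp_of_nat_mult)
      also have "\<dots> \<le> (272 / 100) ^ 2" using e_less_272 by (intro power_mono) auto
      finally show ?thesis by (simp add: power_divide)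
    qed
    have "x ^ k / fact k = (exp 2 * x) ^ k / fact k * exp (- 2 * real k)"
    proof -
      have "exp (2::real) ^ k * exp (- 2 * real k) = 1"
        by (simp flip: exp_of_nat_mult exp_add)
      thus ?thesis by (simp add: power_mult_distrib mult.assoc)
    qed
    also have "\<dots> \<le> exp (exp 2 * x) * exp (- 2 * real k)"
      using assms by (intro mult_right_mono power_fact_le_exp) auto
    also have "\<dots> \<le> exp (74 / 10 * x) * exp (- 2 * real k)"
      using mult_right_mono[OF e2 assms] by (intro mult_right_mono) auto
    also have "\<dots> = (exp (37 / 10 * x) * exp (- real k))\<^sup>2"
      by (simp add: power_mult_distrib flip: exp_of_nat_mult)
    finally have "sqrt (x ^ k / fact k) \<le> sqrt ((exp (37 / 10 * x) * exp (- real k))\<^sup>2)"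
      by (rule real_sqrt_le_mono)
    thus ?thesis by simp
  qed
  \<comment> \<open>Subtracting the last term closes the induction, because twice exp(-(n + 1)) is
    at most exp(-n).\<close>
  have geo: "(\<Sum>k\<in>{k0<..n}. exp (- real k)) \<le> exp (- real k0) - (if k0 \<le> n then exp (- real n) else 0)"
  proof (induction n)
    case (Suc n)
    have half: "2 * exp (- real (Suc n)) \<le> exp (- real n)"
    proof -
      have "exp (- real n) = exp 1 * exp (- real (Suc n))" by (simp flip: exp_add)
      moreover have "2 * exp (- real (Suc n)) \<le> exp 1 * exp (- real (Suc n))"
        using exp_ge_add_one_self[of 1] by (intro mult_right_mono) auto
      ultimately show ?thesis by simp
    qed
    consider "k0 \<le> n" | "k0 = Suc n" | "k0 > Suc n" by linarith
    thus ?case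
    proof cases
      case 1
      hence "{k0<..Suc n} = insert (Suc n) {k0<..n}" by auto
      thus ?thesis using Suc 1 half by simp
    qed (auto)
  qed auto
  have "(\<Sum>k\<in>{k0<..n}. sqrt (x ^ k / fact k)) \<le> (\<Sum>k\<in>{k0<..n}. exp (37 / 10 * x) * exp (- real k))"
    by (intro sum_mono each)
  also have "\<dots> = exp (37 / 10 * x) * (\<Sum>k\<in>{k0<..n}. exp (- real k))" by (simp add: sum_distrib_left)
  also have "\<dots> \<le> exp (37 / 10 * x) * exp (- real k0)"
    using geo by (intro mult_left_mono) (auto split: if_splits intro: order_trans)
  finally show ?thesis by (simp flip: exp_add)
qed

lemma real_nat_ceiling_le:
  fixes v :: real
  assumes "v \<ge> 0"
  shows "real (nat \<lceil>v\<rceil>) \<le> v + 1"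
proof -
  have "0 \<le> \<lceil>v\<rceil>" using assms by (simp add: ceiling_mono[of 0 v, simplified])
  hence "real (nat \<lceil>v\<rceil>) = of_int \<lceil>v\<rceil>" by simp
  thus ?thesis using ceiling_correct[of v] by linarith
qed

lemma real_nat_floor_gt:
  fixes v :: real
  assumes "v \<ge> 0"
  shows "v < real (nat \<lfloor>v\<rfloor>) + 1"
proof -
  have "0 \<le> \<lfloor>v\<rfloor>" using assms by simp
  hence "real (nat \<lfloor>v\<rfloor>) = of_int \<lfloor>v\<rfloor>" by simp
  thus ?thesis using floor_correct[of v] by linarith
qed

lemma harm_le_ln:
  assumes "n \<ge> 1"
  shows "harm n \<le> ln (real n) + (1::real)"
  using assms
proof (induction n rule: dec_induct)
  case base
  show ?case by (simp add: harm_def)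
next
  case (step n)
  have "ln (real n / real (Suc n)) \<le> real n / real (Suc n) - 1"
    using step by (intro ln_le_minus_one) auto
  hence "ln (real n) - ln (real (Suc n)) \<le> - inverse (real (Suc n))"
    using step by (simp add: ln_div field_simps)
  thus ?case using step by (simp add: harm_Suc)
qed

lemma exp_1_ge: "2718 / 1000 \<le> exp (1::real)"
proof -
  have "5837465777 / 2147483648 - inverse (2 ^ 32) \<le> exp (1::real)"
    using e_approx_32 by (simp only: abs_le_iff) linarith
  moreover have "2718 / 1000 \<le> 5837465777 / 2147483648 - inverse (2 ^ 32 :: real)" by simp
  ultimately show ?thesis by (rule order_trans[rotated])
qed

lemma ln2_ge: "ln (2::real) \<ge> 11 / 16"
proof -
  have "exp (11 / 16 :: real) ^ 16 = exp 1 ^ 11" by (simp flip: exp_of_nat_mult)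
  also have "\<dots> \<le> (272 / 100) ^ 11" using e_less_272 by (intro power_mono) auto
  also have "\<dots> \<le> 2 ^ 16" by (simp add: power_divide)
  finally have "exp (11 / 16 :: real) \<le> 2" by (subst (asm) power_mono_iff) auto
  hence "ln (exp (11 / 16 :: real)) \<le> ln 2" by (subst ln_le_cancel_iff) auto
  thus ?thesis by simp
qed

text \<open>The left side is 6 (70 l^2 + 2)(17 l^2 + 1), six times the bound for the logarithm of
  Brun's level y^(2 m); the lemma keeps that level below exp(Z / 6) with Z = exp l. The threshold
  85/4 is 14 times 11/8 plus 2, the lower bound for l in the sieve range.\<close>

lemma quartic_le_exp:
  fixes l :: real
  assumes "l \<ge> 85 / 4"
  shows "7140 * l ^ 4 + 624 * l\<^sup>2 + 12 \<le> exp l"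
proof -
  define a :: real where "a = 85 / 4"
  have "(2718 / 1000) ^ 21 \<le> exp (1::real) ^ 21" by (intro power_mono exp_1_ge) auto
  moreover have "exp (1 / 4 :: real) \<ge> 5 / 4 + 1 / 32"
    using exp_lower_Taylor_quadratic[of "1 / 4"] by (simp add: power2_eq_square)
  ultimately have "(2718 / 1000) ^ 21 * (5 / 4 + 1 / 32) \<le> exp (1::real) ^ 21 * exp (1 / 4)"
    by (intro mult_mono) auto
  also have "\<dots> = exp a" by (simp add: a_def flip: exp_of_nat_mult exp_add)
  finally have "(2718 / 1000) ^ 21 * (5 / 4 + 1 / 32) \<le> exp a" .
  moreover have "7142 * a ^ 4 \<le> (2718 / 1000) ^ 21 * (5 / 4 + 1 / 32)" by (simp add: a_def power_divide)
  ultimately have base: "7142 * a ^ 4 \<le> exp a" by linarith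
  \<comment> \<open>Beyond a the claim follows by scaling: exp(a (r - 1)) \<ge> exp(r - 1)^4 \<ge>
    r^4.\<close>
  define r where "r = l / a"
  have r: "r \<ge> 1" using assms by (simp add: r_def a_def)
  have "exp l = exp a * exp (a * (r - 1))" by (simp add: r_def a_def algebra_simps flip: exp_add)
  also have "\<dots> \<ge> exp a * exp (4 * (r - 1))"
    using r by (intro mult_left_mono) (auto simp: a_def)
  also have "exp (4 * (r - 1)) = exp (r - 1) ^ 4" by (simp flip: exp_of_nat_mult)
  finally have "exp a * exp (r - 1) ^ 4 \<le> exp l" .
  moreover have "7142 * a ^ 4 * r ^ 4 \<le> exp a * exp (r - 1) ^ 4"
    using base r exp_ge_add_one_self[of "r - 1"] by (intro mult_mono power_mono) auto
  moreover have "7142 * a ^ 4 * r ^ 4 = 7142 * l ^ 4" by (simp add: r_def a_def power_divide)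
  ultimately have "7142 * l ^ 4 \<le> exp l" by linarith
  moreover have "7140 * l ^ 4 + 624 * l\<^sup>2 + 12 \<le> 7142 * l ^ 4"
  proof -
    have "21 * 21 \<le> l * l" using assms by (intro mult_mono) auto
    hence l2: "441 \<le> l\<^sup>2" by (simp add: power2_eq_square)
    hence "441 * l\<^sup>2 \<le> l\<^sup>2 * l\<^sup>2" by (intro mult_right_mono) auto
    hence "441 * l\<^sup>2 \<le> l ^ 4" by (simp flip: power_add)
    thus ?thesis using l2 by linarith
  qed
  ultimately show ?thesis by linarith
qed

text \<open>The bound for the range where ln(ln N) = l is large. The hypothesis on
  \<open>card X\<close> is 30 \<xi> + 1 for 14 \<xi> \<le> l - 2. It keeps t^2 L below 0.343 l, so
  that in high degrees the factorial beats the powers of ln N = exp l lost by the sieve.\<close>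

lemma exp_card_dissociated_le:
  fixes N A l :: real and U :: nat and X :: "int set"
  assumes N: "N = exp (exp l)" and l: "l \<ge> 85 / 4"
    and S: "S \<subseteq> {p. prime p \<and> N powr (1 / 4) \<le> real p \<and> real p \<le> N}" "S \<noteq> {}"
    and A: "A \<ge> 1" and X: "finite X" "dissociated (int U) X" and U: "U > 0" "real U \<le> l * N"
    and large: "\<And>u. u \<in> X \<Longrightarrow> cmod (\<Sum>p\<in>S. e (real p * of_int u / real U)) \<ge> real (card S) / A"
    and L: "real (card X) / A\<^sup>2 \<le> 15 / 7 * l - 23 / 7"
  shows "exp (real (card X) / (5 * A\<^sup>2)) \<le>
    5331 * (N / (real (card S) * exp l)) * exp (real U / (2 * N))"
proof -
  define Z where "Z = exp l"
  \<comment> \<open>Maximises t / A - 5 t^2 / 4: the loss is t^2 / 2 from cosh and 3 t^2 / 4 from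
    the sum over degrees.\<close>
  define t where "t = 2 / (5 * A)"
  define s where "s = tanh t"
  define x where "x = t\<^sup>2 * real (card X)"
  have l2: "441 \<le> l\<^sup>2" using power_mono[of 21 l 2] l by simp
  have quart: "7140 * l ^ 4 + 624 * l\<^sup>2 + 12 \<le> Z"
    unfolding Z_def by (rule quartic_le_exp[OF l])
  have l4: "l ^ 4 \<ge> 441 * l\<^sup>2"
    using mult_right_mono[OF l2, of "l\<^sup>2"] by (simp flip: power_add)
  have ll: "l * 21 \<le> l\<^sup>2" using l by (simp add: power2_eq_square)
  have Zl: "100 * l\<^sup>2 \<le> Z" "100 * l \<le> Z" "100 \<le> Z"
    using quart l4 l2 ll l by linarith+
  have N_exp: "N = exp Z" by (simp add: N Z_def)
  have N_ge: "N \<ge> 100" using exp_ge_add_one_self[of Z] Zl unfolding N_exp by linarith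
  have t: "t > 0" "t \<le> 2 / 5" using A by (auto simp: t_def field_simps)
  have s: "0 \<le> s" "s \<le> 1" "s \<le> t"
    using tanh_unit_interval[of t] t tanh_le_self[of t] by (auto simp: s_def)
  \<comment> \<open>A crude bound; it serves to replace s L by ln N in the low degree error.\<close>
  have card_le: "real (card X) \<le> 2 * Z"
  proof -
    have "2 ^ card X \<le> real U" by (rule power_two_card_le[OF X(1) U(1) X(2)])
    also have "\<dots> \<le> l * N" by (rule U(2))
    also have "\<dots> \<le> exp l * exp Z"
    proof -
      have "l \<le> exp l" using exp_ge_add_one_self[of l] by linarith
      thus ?thesis unfolding N_exp by (intro mult_right_mono) auto
    qed
    also have "\<dots> = exp (l + Z)" by (simp add: exp_add)
    finally have "ln ((2::real) ^ card X) \<le> ln (exp (l + Z))" by (subst ln_le_cancel_iff) auto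
    hence "real (card X) * ln 2 \<le> l + Z" by (simp add: ln_realpow)
    moreover have "real (card X) * (11 / 16) \<le> real (card X) * ln 2" using ln2_ge by (intro mult_left_mono) auto
    ultimately show ?thesis using Zl by linarith
  qed
  have sL: "s * real (card X) \<le> Z"
  proof -
    have "s * real (card X) \<le> 2 / 5 * (2 * Z)" using s t card_le by (intro mult_mono) auto
    thus ?thesis using Zl by linarith
  qed
  have x_eq: "x = 4 / 25 * (real (card X) / A\<^sup>2)" by (simp add: x_def t_def power2_eq_square)
  have x: "x \<ge> 0" "x \<le> 343 / 1000 * l"
  proof -
    show "x \<ge> 0" by (simp add: x_def)
    show "x \<le> 343 / 1000 * l" using L l unfolding x_eq by linarith
  qed

  \<comment> \<open>Degrees up to \<open>k0\<close> contribute at most \<open>Z ^ k0 = exp (16 l\<^sup>2)\<close> times the error \<open>\<kappa>\<close>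
    of order \<open>1 / y\<close>; larger degrees are small in mean square, and \<open>D\<close> stays below \<open>N\<^bsup>1/3\<^esup>\<close>.\<close>
  define y where "y = nat \<lceil>exp (17 * l\<^sup>2)\<rceil>"
  define m where "m = nat \<lceil>35 * l\<^sup>2\<rceil>"
  define z where "z = nat \<lfloor>exp (Z / 12)\<rfloor>"
  define D where "D = y ^ (2 * m) * z\<^sup>2"
  define T where "T = nat \<lceil>2 * N\<rceil>"
  define k0 where "k0 = nat \<lceil>16 * l\<rceil>"
  define M where "M = nat \<lfloor>N\<rfloor>"
  have y_ge: "real y \<ge> exp (17 * l\<^sup>2)" unfolding y_def by (rule real_nat_ceiling_ge)
  have y_le: "real y + 1 \<le> exp (17 * l\<^sup>2 + 1)"
  proof -
    have "real y \<le> exp (17 * l\<^sup>2) + 1" unfolding y_def by (rule real_nat_ceiling_le) simp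
    moreover have "exp (17 * l\<^sup>2) \<ge> 10" using exp_ge_add_one_self[of "17 * l\<^sup>2"] l2 by linarith
    moreover have "exp (17 * l\<^sup>2) * 2 \<le> exp (17 * l\<^sup>2) * exp 1"
      using exp_ge_add_one_self[of 1] by (intro mult_left_mono) auto
    moreover have "27 / 10 \<le> exp (1::real)" using exp_1_ge by linarith
    hence "exp (17 * l\<^sup>2) * (27 / 10) \<le> exp (17 * l\<^sup>2) * exp 1"
      by (intro mult_left_mono) auto
    ultimately show ?thesis unfolding exp_add by linarith
  qed
  have y4: "4 \<le> y"
  proof -
    have "real y \<ge> 4" using y_ge exp_ge_add_one_self[of "17 * l\<^sup>2"] l2 by linarith
    thus ?thesis by simp
  qed
  have m: "35 * l\<^sup>2 \<le> real m" "real m \<le> 35 * l\<^sup>2 + 1"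
    unfolding m_def using real_nat_ceiling_ge real_nat_ceiling_le by simp_all
  have z_le: "real z \<le> exp (Z / 12)" unfolding z_def by (simp add: of_nat_floor)
  have z1: "1 \<le> z" unfolding z_def using Zl by (simp add: le_nat_floor)
  have harm_z: "harm z \<ge> Z / 12"
  proof -
    have "exp (Z / 12) \<le> real z + 1" unfolding z_def by (rule less_imp_le[OF real_nat_floor_gt]) simp
    hence "ln (exp (Z / 12)) \<le> ln (real z + 1)" by (subst ln_le_cancel_iff) auto
    thus ?thesis using ln_le_harm[of z] by simp
  qed
  have D_le: "real D \<le> exp (Z / 3)"
  proof -
    have "real (y ^ (2 * m)) \<le> exp (Z / 6)"
    proof -
      have "real (y ^ (2 * m)) \<le> exp (17 * l\<^sup>2 + 1) ^ (2 * m)"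
        unfolding of_nat_power using y_le by (intro power_mono) auto
      also have "\<dots> = exp (real (2 * m) * (17 * l\<^sup>2 + 1))" by (simp only: exp_of_nat_mult)
      also have "\<dots> \<le> exp (Z / 6)"
      proof (subst exp_le_cancel_iff)
        have "real (2 * m) * (17 * l\<^sup>2 + 1) \<le> (70 * l\<^sup>2 + 2) * (17 * l\<^sup>2 + 1)"
          using m by (intro mult_right_mono) auto
        also have "\<dots> = 1190 * l ^ 4 + 104 * l\<^sup>2 + 2" by (simp add: algebra_simps flip: power_add)
        finally show "real (2 * m) * (17 * l\<^sup>2 + 1) \<le> Z / 6" using quart by linarith
      qed
      finally show ?thesis .
    qed
    moreover have "real (z\<^sup>2) \<le> exp (Z / 6)"
    proof -
      have "real (z\<^sup>2) \<le> exp (Z / 12) ^ 2" unfolding of_nat_power using z_le by (intro power_mono) auto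
      thus ?thesis by (simp flip: exp_of_nat_mult)
    qed
    ultimately have "real (y ^ (2 * m)) * real (z\<^sup>2) \<le> exp (Z / 6) * exp (Z / 6)" by (intro mult_mono) auto
    also have "\<dots> = exp (Z / 3)" by (simp flip: exp_add)
    finally show ?thesis by (simp add: D_def)
  qed
  have D1: "D \<ge> 1" using y4 z1 by (simp add: D_def Suc_le_eq)
  have harm_D: "harm D \<le> Z" "harm D \<ge> (0::real)"
  proof -
    have "harm D \<le> ln (real D) + (1::real)" using D1 by (rule harm_le_ln)
    also have "ln (real D) \<le> ln (exp (Z / 3))" using D_le D1 by (subst ln_le_cancel_iff) auto
    finally show "harm D \<le> Z" using Zl by simp
  qed (rule harm_nonneg)
  have T: "2 * N \<le> real T" "real T \<le> 201 / 100 * N" "T > 0"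
  proof -
    show "2 * N \<le> real T" unfolding T_def by (rule real_nat_ceiling_ge)
    have "real T \<le> 2 * N + 1" unfolding T_def using N_ge by (intro real_nat_ceiling_le) auto
    thus "real T \<le> 201 / 100 * N" using N_ge by linarith
    show "T > 0" using \<open>2 * N \<le> real T\<close> N_ge by (intro gr0I) auto
  qed
  define T' where "T' = real T + 4 * real D ^ 6 / real T"
  \<comment> \<open>As D \<le> exp(Z / 3) is the cube root of N, the decay term of the Farey sum is
    no larger than its peak.\<close>
  have T'_le: "T' \<le> 2 * real T"
  proof -
    have "real D ^ 6 \<le> exp (Z / 3) ^ 6" using D_le by (intro power_mono) auto
    also have "\<dots> = N\<^sup>2" unfolding N_exp by (simp flip: exp_of_nat_mult)
    finally have "4 * real D ^ 6 \<le> (2 * N) * (2 * N)" by (simp add: power2_eq_square)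
    also have "\<dots> \<le> real T * real T" using T N_ge by (intro mult_mono) auto
    finally show ?thesis using T by (simp add: T'_def divide_le_eq)
  qed
  have T'_pos: "T' > 0" using T by (simp add: T'_def add_pos_nonneg)

  interpret brun_selberg y z m using y4 z1 by unfold_locales
  define W :: real where "W = 1 / harm z"
  define \<kappa> :: real where "\<kappa> = real (y + 1) ^ 3 / 3 ^ (2 * m) + 4 * harm D ^ 5 / real y"
  have W: "0 \<le> W" "W \<le> 12 / Z"
  proof -
    show "0 \<le> W" by (simp add: W_def harm_nonneg)
    have "harm z > (0::real)" using harm_z Zl by linarith
    hence "W \<le> 1 / (Z / 12)" unfolding W_def using harm_z Zl by (intro divide_left_mono mult_pos_pos) auto
    thus "W \<le> 12 / Z" by simp
  qed
  have \<kappa>0: "0 \<le> \<kappa>" by (simp add: \<kappa>_def harm_nonneg)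
  \<comment> \<open>Brun's remainder: 9^m \<ge> exp(70 l^2) outweighs y^3, which is about exp(51
    l^2). Selberg's remainder: about (ln N)^5 / y = exp(5 l - 17 l^2).\<close>
  have \<kappa>_le: "\<kappa> \<le> exp (5 * l + 3 - 17 * l\<^sup>2)"
  proof -
    have "real (y + 1) ^ 3 / 3 ^ (2 * m) \<le> exp (51 * l\<^sup>2 + 3) / exp (70 * l\<^sup>2)"
    proof (intro frac_le)
      have "real (y + 1) ^ 3 \<le> exp (17 * l\<^sup>2 + 1) ^ 3" using y_le by (intro power_mono) auto
      thus "real (y + 1) ^ 3 \<le> exp (51 * l\<^sup>2 + 3)" by (simp flip: exp_of_nat_mult)
      have "exp (70 * l\<^sup>2) \<le> exp (real (2 * m))" using m by simp
      also have "\<dots> = exp 1 ^ (2 * m)" by (simp flip: exp_of_nat_mult)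
      also have "\<dots> \<le> 3 ^ (2 * m)" using exp_le by (intro power_mono) auto
      finally show "exp (70 * l\<^sup>2) \<le> 3 ^ (2 * m)" .
    qed auto
    also have "\<dots> = exp (3 - 19 * l\<^sup>2)" by (simp flip: exp_diff)
    also have "\<dots> \<le> exp (5 * l + 2 - 17 * l\<^sup>2)" using l l2 by simp
    finally have 1: "real (y + 1) ^ 3 / 3 ^ (2 * m) \<le> exp (5 * l + 2 - 17 * l\<^sup>2)" .
    have "4 * harm D ^ 5 / real y \<le> exp 2 * exp (5 * l) / exp (17 * l\<^sup>2)"
    proof (intro frac_le mult_mono)
      show "4 \<le> exp (2::real)"
      proof -
        have "(2::real) ^ 2 \<le> exp 1 ^ 2" using exp_ge_add_one_self[of 1] by (intro power_mono) auto
        thus ?thesis by (simp flip: exp_of_nat_mult)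
      qed
      have "harm D ^ 5 \<le> Z ^ 5" using harm_D by (intro power_mono)
      thus "harm D ^ 5 \<le> exp (5 * l)" by (simp add: Z_def flip: exp_of_nat_mult)
    qed (use y_ge harm_D in auto)
    also have "\<dots> = exp (5 * l + 2 - 17 * l\<^sup>2)" by (simp add: add.commute flip: exp_add exp_diff)
    finally have 2: "4 * harm D ^ 5 / real y \<le> exp (5 * l + 2 - 17 * l\<^sup>2)" .
    have "\<kappa> \<le> 2 * exp (5 * l + 2 - 17 * l\<^sup>2)" using 1 2 by (simp add: \<kappa>_def)
    also have "\<dots> \<le> exp 1 * exp (5 * l + 2 - 17 * l\<^sup>2)"
      using exp_ge_add_one_self[of 1] by (intro mult_right_mono) auto
    also have "\<dots> = exp (5 * l + 3 - 17 * l\<^sup>2)" by (simp flip: exp_add)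
    finally show ?thesis .
  qed

  obtain \<phi> where \<phi>: "exp (t * real (card X) / A) \<le>
      exp (t\<^sup>2 * real (card X) / 2) / real (card S) * (\<Sum>p\<in>S. riesz U X s \<phi> (int p))"
  proof -
    have "finite S"
    proof (rule finite_subset)
      show "S \<subseteq> {..M}" using S by (auto simp: M_def le_nat_floor)
    qed simp
    thus thesis
      using exp_le_sum_riesz[of S X A t U] S X A t large that by (auto simp: s_def)
  qed
  define c where "c = cesaro T (\<lambda>n. divisor_sum idx md cf n * riesz U X s \<phi> n)"
  have "c \<le> sqrt ((real T + real U) * T') * (2 * exp 3 * W * (\<Sum>k\<le>card X. sqrt ((s\<^sup>2 * real (card X)) ^ k / fact k)) +
      sqrt (harm D ^ 26) * (\<Sum>k\<in>{k0<..card X}. sqrt ((s\<^sup>2 * real (card X)) ^ k / fact k))) +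
      \<kappa> * T' * (\<Sum>k\<le>k0. (s * real (card X)) ^ k / fact k)"
    unfolding c_def T'_def
  proof (rule cesaro_riesz_sieve[where E = "Prod ` Pow (P1 \<union> P2)" and g = "\<lambda>d. 1 / real (totient d)"])
    show "Q = {q. \<exists>i\<in>idx. q dvd md i}" by (rule Q_def)
    show "Q \<subseteq> {1..D}" by (rule Q_subset) (simp add: D_def)
    show "\<bar>divisor_weight idx md cf q\<bar> \<le> W / real (totient q) + \<kappa>" if "q \<in> Q" for q
      unfolding W_def \<kappa>_def using that by (rule abs_divisor_weight_le) (simp add: D_def)
    show "(\<Sum>q\<in>Q. real (totient q) * (divisor_weight idx md cf q)\<^sup>2) \<le> harm D ^ 26"
      by (rule sum_totient_divisor_weight_le) (simp add: D_def)
    show "finite (Prod ` Pow (P1 \<union> P2))" using prime_set_finite[OF prime_set_P12] by simp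
    show "0 \<notin> Prod ` Pow (P1 \<union> P2)"
    proof
      assume "0 \<in> Prod ` Pow (P1 \<union> P2)"
      then obtain B where B: "B \<subseteq> P1 \<union> P2" "0 = \<Prod>B" by blast
      have "0 < \<Prod>B" by (rule prod_prime_set_pos[OF prime_set_subset[OF prime_set_P12 B(1)]])
      thus False unfolding B(2)[symmetric] by simp
    qed
    show "(\<Sum>d\<in>Prod ` Pow (P1 \<union> P2). 1 / real (totient d) / sqrt (real d)) \<le> exp 3"
      by (rule sum_inverse_totient_sqrt_le[OF prime_set_P12])
  qed (use finite_idx md_pos X U s T W \<kappa>0 Q_totient in auto)
  \<comment> \<open>The 3/2 bounds sqrt 2 from T' \<le> 2 T, 21 bounds exp 3 and 12 / Z bounds 1 /
    harm z. The main constant is 3/2 times 882 = 1323; rounding up to 1326 absorbs the two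
    remainders, and doubling with T \<le> 2.01 N gives 5331.\<close>
  also have "\<dots> \<le> (real T * (3 / 2 * exp (real U / (2 * N)))) * (2 * 21 * (12 / Z) * (7 / 4 * exp (3 / 4 * x)) + 1 / Z) + real T / Z"
  proof (intro add_mono mult_mono)
    show "sqrt ((real T + real U) * T') \<le> real T * (3 / 2 * exp (real U / (2 * N)))"
    proof (rule real_le_lsqrt)
      have "real T + real U \<le> real T * (1 + real U / N)"
      proof -
        have "real U * N \<le> real U * real T" using T N_ge by (intro mult_left_mono) auto
        hence "real U \<le> real T * (real U / N)" using N_ge by (simp add: field_simps)
        thus ?thesis by (simp add: distrib_left)
      qed
      also have "\<dots> \<le> real T * exp (real U / N)"
        using exp_ge_add_one_self[of "real U / N"] by (intro mult_left_mono) auto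
      finally have "(real T + real U) * T' \<le> (real T * exp (real U / N)) * (2 * real T)"
        using T'_le T'_pos by (intro mult_mono) auto
      also have "\<dots> \<le> (real T * (3 / 2 * exp (real U / (2 * N))))\<^sup>2"
      proof -
        have "exp (real U / N) = exp (real U / (2 * N)) ^ 2" by (simp flip: exp_of_nat_mult)
        thus ?thesis by (simp add: power2_eq_square mult_mono)
      qed
      finally show "(real T + real U) * T' \<le> (real T * (3 / 2 * exp (real U / (2 * N))))\<^sup>2" .
    qed (use T in auto)
    have mono: "sqrt ((s\<^sup>2 * real (card X)) ^ k / fact k) \<le> sqrt (x ^ k / fact k)" for k
      unfolding x_def using s t by (intro real_sqrt_le_mono divide_right_mono power_mono mult_right_mono) auto
    show "exp 3 \<le> (21::real)"
    proof -
      have "exp (3::real) = exp 1 ^ 3" by (simp flip: exp_of_nat_mult)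
      also have "\<dots> \<le> (272 / 100) ^ 3" using e_less_272 by (intro power_mono) auto
      finally show ?thesis by (simp add: power_divide)
    qed
    show "(\<Sum>k\<le>card X. sqrt ((s\<^sup>2 * real (card X)) ^ k / fact k)) \<le> 7 / 4 * exp (3 / 4 * x)"
      by (rule order_trans[OF sum_mono sum_sqrt_power_fact_le[OF x(1)]]) (rule mono)
    show "sqrt (harm D ^ 26) * (\<Sum>k\<in>{k0<..card X}. sqrt ((s\<^sup>2 * real (card X)) ^ k / fact k)) \<le> 1 / Z"
    proof -
      have "sqrt (harm D ^ 26) = harm D ^ 13"
        using harm_D by (intro real_sqrt_unique) (auto simp flip: power_mult)
      also have "\<dots> \<le> Z ^ 13" using harm_D by (intro power_mono)
      also have "\<dots> = exp (13 * l)" by (simp add: Z_def flip: exp_of_nat_mult)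
      finally have "sqrt (harm D ^ 26) \<le> exp (13 * l)" .
      moreover have "(\<Sum>k\<in>{k0<..card X}. sqrt ((s\<^sup>2 * real (card X)) ^ k / fact k)) \<le> exp (37 / 10 * x - real k0)"
        by (rule order_trans[OF sum_mono sum_sqrt_power_fact_tail_le[OF x(1)]]) (rule mono)
      ultimately have "sqrt (harm D ^ 26) * (\<Sum>k\<in>{k0<..card X}. sqrt ((s\<^sup>2 * real (card X)) ^ k / fact k)) \<le>
          exp (13 * l) * exp (37 / 10 * x - real k0)"
        using s by (intro mult_mono) (auto intro!: sum_nonneg)
      also have "\<dots> = exp (13 * l + (37 / 10 * x - real k0))" by (simp add: exp_add)
      also have "\<dots> \<le> exp (- l)"
      proof (subst exp_le_cancel_iff)
        \<comment> \<open>Needed are 13 l for the factor Z^13, less than 1.3 l for 37/10 x, and l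
          for the gain 1 / Z.\<close>
        have "real k0 \<ge> 16 * l" unfolding k0_def by (rule real_nat_ceiling_ge)
        thus "13 * l + (37 / 10 * x - real k0) \<le> - l" using x l by linarith
      qed
      finally show ?thesis by (simp add: Z_def exp_minus inverse_eq_divide)
    qed
    show "\<kappa> * T' * (\<Sum>k\<le>k0. (s * real (card X)) ^ k / fact k) \<le> real T / Z"
    proof -
      have k0: "real k0 \<le> 16 * l + 1" unfolding k0_def using l by (intro real_nat_ceiling_le) auto
      have "(\<Sum>k\<le>k0. (s * real (card X)) ^ k / fact k) \<le> (\<Sum>k\<le>k0. Z ^ k0)"
      proof (intro sum_mono)
        fix k assume k: "k \<in> {..k0}"
        have "(s * real (card X)) ^ k / fact k \<le> (s * real (card X)) ^ k / 1"
          using s by (intro divide_left_mono) auto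
        also have "\<dots> \<le> Z ^ k" using sL s by (simp add: power_mono)
        also have "\<dots> \<le> Z ^ k0" using k Zl by (intro power_increasing) auto
        finally show "(s * real (card X)) ^ k / fact k \<le> Z ^ k0" .
      qed
      also have "\<dots> = (real k0 + 1) * Z ^ k0" by simp
      also have "\<dots> \<le> exp l * exp (16 * l\<^sup>2 + l)"
      proof (intro mult_mono)
        show "real k0 + 1 \<le> exp l" using k0 Zl l by (simp add: Z_def)
        have "Z ^ k0 = exp (real k0 * l)" by (simp add: Z_def exp_of_nat_mult)
        moreover have "real k0 * l \<le> (16 * l + 1) * l" using k0 l by (intro mult_right_mono) auto
        ultimately show "Z ^ k0 \<le> exp (16 * l\<^sup>2 + l)" by (simp add: power2_eq_square algebra_simps)
      qed (auto simp: Z_def)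
      finally have "\<kappa> * T' * (\<Sum>k\<le>k0. (s * real (card X)) ^ k / fact k) \<le>
          exp (5 * l + 3 - 17 * l\<^sup>2) * (2 * real T) * (exp l * exp (16 * l\<^sup>2 + l))"
        using \<kappa>_le \<kappa>0 T'_le T'_pos s by (intro mult_mono) (auto intro!: sum_nonneg)
      also have "\<dots> = real T * (2 * exp (7 * l + 3 - l\<^sup>2))"
        by (simp add: mult_ac flip: exp_add)
      also have "\<dots> \<le> real T * (exp 1 * exp (7 * l + 3 - l\<^sup>2))"
        using exp_ge_add_one_self[of 1] by (intro mult_left_mono mult_right_mono) auto
      also have "\<dots> = real T * exp (7 * l + 4 - l\<^sup>2)" by (simp flip: exp_add)
      also have "\<dots> \<le> real T * exp (- l)" using ll l by (intro mult_left_mono) auto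
      finally show ?thesis by (simp add: Z_def exp_minus field_simps)
    qed
  qed (use W s Zl T in \<open>auto intro!: sum_nonneg mult_nonneg_nonneg add_nonneg_nonneg simp: harm_nonneg\<close>)
  also have "\<dots> \<le> 1326 * (real T / Z) * (exp (real U / (2 * N)) * exp (3 / 4 * x))"
  proof -
    define a where "a = exp (real U / (2 * N))"
    define b where "b = exp (3 / 4 * x)"
    have a: "a \<ge> 1" and b: "b \<ge> 1" using N_ge x by (auto simp: a_def b_def)
    have "1 * 1 \<le> a * b" using a b by (intro mult_mono) auto
    moreover have "a * 1 \<le> a * b" using a b by (intro mult_left_mono) auto
    ultimately have "1323 * (a * b) + 3 / 2 * a + 1 \<le> 1326 * (a * b)" by linarith
    moreover have "3 / 2 * a * (882 * b + 1) + 1 = 1323 * (a * b) + 3 / 2 * a + 1" by (simp add: algebra_simps)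
    ultimately have "3 / 2 * a * (882 * b + 1) + 1 \<le> 1326 * (a * b)" by (simp only:)
    hence "real T / Z * (3 / 2 * a * (882 * b + 1) + 1) \<le> real T / Z * (1326 * (a * b))"
      using Zl by (intro mult_left_mono) auto
    thus ?thesis using Zl unfolding a_def[symmetric] b_def[symmetric] by (simp add: field_simps)
  qed
  also have "\<dots> \<le> 1326 * (201 / 100 * N / Z) * (exp (real U / (2 * N)) * exp (3 / 4 * x))"
    using T Zl by (intro mult_right_mono mult_left_mono divide_right_mono) auto
  finally have c_le: "c \<le> 1326 * (201 / 100 * N / Z) * (exp (real U / (2 * N)) * exp (3 / 4 * x))" .

  \<comment> \<open>The primes in S are at least N^(1/4), beyond both y and z, so the majorant
    equals 1 there; being nonnegative elsewhere, it allows the sum to be extended to all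
    integers.\<close>
  have "(\<Sum>p\<in>S. riesz U X s \<phi> (int p)) = (\<Sum>p\<in>S. divisor_sum idx md cf (int p) * riesz U X s \<phi> (int p))"
  proof (intro sum.cong refl)
    fix p assume p: "p \<in> S"
    have "exp (Z / 4) = N powr (1 / 4)" unfolding N_exp powr_def by simp
    hence p4: "exp (Z / 4) \<le> real p" "prime p" using p S by auto
    have "exp (17 * l\<^sup>2 + 1) \<le> exp (Z / 4)" using Zl l2 by simp
    hence "p > y" using y_le p4 by linarith
    moreover have "exp (Z / 12) < exp (Z / 4)" using Zl by simp
    hence "p > z" using z_le p4 by linarith
    ultimately show "riesz U X s \<phi> (int p) = divisor_sum idx md cf (int p) * riesz U X s \<phi> (int p)"
      using divisor_sum_prime p4 by simp
  qed
  also have "\<dots> \<le> (\<Sum>n=1..M. divisor_sum idx md cf (int n) * riesz U X s \<phi> (int n))"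
  proof -
    have sub: "S \<subseteq> {1..M}"
    proof
      fix p assume "p \<in> S"
      hence "prime p" "real p \<le> N" using S by auto
      thus "p \<in> {1..M}" using prime_ge_1_nat[of p] by (simp add: M_def le_nat_floor)
    qed
    show ?thesis
      using s by (intro sum_mono2[OF _ sub] mult_nonneg_nonneg divisor_sum_nonneg riesz_nonneg) auto
  qed
  also have "\<dots> \<le> 2 * c"
    unfolding c_def
  proof (rule cesaro_ge)
    have "real M \<le> N" unfolding M_def using N_ge by (simp add: of_nat_floor)
    hence "real (2 * M) \<le> real T" using T(1) by simp
    thus "2 * M \<le> T" by (simp only: of_nat_le_iff)
  qed (use s in \<open>auto intro!: mult_nonneg_nonneg divisor_sum_nonneg riesz_nonneg\<close>)
  also have "\<dots> \<le> 5331 * (N / Z) * (exp (real U / (2 * N)) * exp (3 / 4 * x))"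
  proof -
    define a where "a = N / Z * (exp (real U / (2 * N)) * exp (3 / 4 * x))"
    have "a \<ge> 0" using N_ge Zl by (simp add: a_def)
    have "c \<le> 1326 * (201 / 100) * a" using c_le by (simp add: a_def)
    hence "2 * c \<le> 5331 * a" using \<open>a \<ge> 0\<close> by linarith
    thus ?thesis by (simp add: a_def mult.assoc)
  qed
  finally have "exp (x / 2) / real (card S) * (\<Sum>p\<in>S. riesz U X s \<phi> (int p)) \<le>
      exp (x / 2) / real (card S) * (5331 * (N / Z) * (exp (real U / (2 * N)) * exp (3 / 4 * x)))"
    by (intro mult_left_mono) auto
  with \<phi> have "exp (t * real (card X) / A) \<le>
      exp (x / 2) / real (card S) * (5331 * (N / Z) * (exp (real U / (2 * N)) * exp (3 / 4 * x)))"
    unfolding x_def by linarith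
  also have "\<dots> = exp (5 / 4 * x) * (5331 * (N / (real (card S) * Z)) * exp (real U / (2 * N)))"
  proof -
    have "exp (5 / 4 * x) = exp (x / 2) * exp (3 / 4 * x)" by (simp flip: exp_add)
    thus ?thesis by simp
  qed
  finally have "exp (t * real (card X) / A - 5 / 4 * x) \<le> 5331 * (N / (real (card S) * Z)) * exp (real U / (2 * N))"
    by (simp add: exp_diff divide_le_eq mult.commute)
  moreover have "t * real (card X) / A - 5 / 4 * x = real (card X) / (5 * A\<^sup>2)"
    unfolding x_eq by (simp add: t_def power2_eq_square field_simps)
  ultimately show ?thesis by (simp add: Z_def)
qed

section \<open>The spectrum of a set of primes\<close>

lemma carrier_residue_ring: "carrier (residue_ring m) = {0..m - 1}"
  by (simp add: residue_ring_def)

lemma prime_subset_interval: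
  assumes "S \<subseteq> {p. prime p \<and> N powr (1 / 4) \<le> real p \<and> real p \<le> N}"
  shows "S \<subseteq> {1..nat \<lfloor>N\<rfloor>}"
proof
  fix p assume "p \<in> S"
  hence "prime p" "real p \<le> N" using assms by auto
  thus "p \<in> {1..nat \<lfloor>N\<rfloor>}" using prime_ge_1_nat[of p] by (simp add: le_nat_floor)
qed

lemma ln4_le: "ln (4::real) \<le> 25 / 18"
proof -
  have "ln ((2::real) ^ 2) = 2 * ln 2" by (subst ln_realpow) simp_all
  thus ?thesis using ln2_le_25_over_36 by simp
qed

text \<open>Splitting at N^(1/2): 2 ln 4 \<le> 25/9 leaves 2/9 of N / ln N for the small
  primes.\<close>

lemma card_primes_le_third:
  fixes N :: real
  assumes "S \<subseteq> {p. prime p \<and> real p \<le> N}" and Z: "ln N > 7" and N: "N > 1"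
  shows "real (card S) \<le> 3 * (N / ln N)"
proof -
  define Z where "Z = ln N"
  have N_exp: "N = exp Z" using N by (simp add: Z_def)
  have Z7: "Z > 7" using Z by (simp add: Z_def)
  have "9 / 2 * Z \<le> exp (Z / 2)"
  proof -
    have "exp (7 / 2 :: real) \<ge> 65 / 2"
    proof -
      have "(2718 / 1000) ^ 3 \<le> exp (1::real) ^ 3" using exp_1_ge by (intro power_mono) auto
      moreover have "exp (1 / 2 :: real) \<ge> 13 / 8"
        using exp_lower_Taylor_quadratic[of "1 / 2"] by (simp add: power2_eq_square)
      ultimately have "(2718 / 1000) ^ 3 * (13 / 8) \<le> exp (1::real) ^ 3 * exp (1 / 2)" by (intro mult_mono) auto
      also have "\<dots> = exp (7 / 2)" by (simp flip: exp_of_nat_mult exp_add)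
      finally show ?thesis by (simp add: power_divide)
    qed
    hence "65 / 2 * (1 + (Z - 7) / 2) \<le> exp (7 / 2) * exp ((Z - 7) / 2)"
      using exp_ge_add_one_self[of "(Z - 7) / 2"] Z7 by (intro mult_mono) auto
    also have "\<dots> = exp (Z / 2)" by (simp add: diff_divide_distrib flip: exp_add)
    finally have "65 / 2 * (1 + (Z - 7) / 2) \<le> exp (Z / 2)" .
    moreover have "65 / 2 * (1 + (Z - 7) / 2) = 65 / 4 * Z - 325 / 4" by (simp add: field_simps)
    ultimately show ?thesis using Z7 by linarith
  qed
  hence "9 / 2 * Z * exp (Z / 2) \<le> exp (Z / 2) * exp (Z / 2)" by (intro mult_right_mono) auto
  also have "\<dots> = N" by (simp add: N_exp flip: exp_add)
  finally have root: "exp (Z / 2) \<le> 2 / 9 * (N / Z)" using Z7 by (simp add: field_simps)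
  have "real (card S) \<le> N powr (1 / 2) + ln 4 / (1 / 2) * (N / ln N)"
    using assms by (intro card_primes_le) auto
  also have "N powr (1 / 2) = exp (Z / 2)" unfolding N_exp powr_def by simp
  also have "ln 4 / (1 / 2) * (N / ln N) \<le> 25 / 9 * (N / Z)"
    unfolding Z_def[symmetric] using ln4_le Z7 N by (intro mult_right_mono) auto
  finally show ?thesis using root by (simp add: Z_def)
qed

text \<open>Splitting at N^(5/6): 6/5 ln 4 \<le> 5/3 leaves 1/3 of N / ln N for the small
  primes.\<close>

lemma card_primes_le_half:
  fixes N :: real
  assumes "S \<subseteq> {p. prime p \<and> real p \<le> N}" and Z: "ln N > 200" and N: "N > 1"
  shows "real (card S) \<le> 2 * (N / ln N)"
proof -
  define Z where "Z = ln N"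
  have N_exp: "N = exp Z" using N by (simp add: Z_def)
  have Z200: "Z > 200" using Z by (simp add: Z_def)
  have "3 * Z \<le> exp (Z / 6)"
  proof -
    have "200 * 200 \<le> Z * Z" using Z200 by (intro mult_mono) auto
    hence "(Z * Z) * Z \<ge> (200 * 200) * Z" using Z200 by (intro mult_right_mono) auto
    hence "3 * Z \<le> (Z / 18) ^ 3" using Z200 by (simp add: power3_eq_cube)
    also have "\<dots> \<le> exp (Z / 18) ^ 3"
    proof (intro power_mono)
      show "Z / 18 \<le> exp (Z / 18)" using exp_ge_add_one_self[of "Z / 18"] by linarith
    qed (use Z200 in auto)
    also have "\<dots> = exp (Z / 6)" by (simp flip: exp_of_nat_mult)
    finally show ?thesis .
  qed
  hence "3 * Z * exp (Z * 5 / 6) \<le> exp (Z / 6) * exp (Z * 5 / 6)" by (intro mult_right_mono) auto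
  also have "\<dots> = N" by (simp add: N_exp flip: exp_add)
  finally have root: "exp (Z * 5 / 6) \<le> 1 / 3 * (N / Z)" using Z200 by (simp add: field_simps)
  have "real (card S) \<le> N powr (5 / 6) + ln 4 / (5 / 6) * (N / ln N)"
    using assms by (intro card_primes_le) auto
  also have "N powr (5 / 6) = exp (Z * 5 / 6)" unfolding N_exp powr_def by (simp add: mult.commute)
  also have "ln 4 / (5 / 6) * (N / ln N) \<le> 5 / 3 * (N / Z)"
    unfolding Z_def[symmetric] using ln4_le Z200 N by (intro mult_right_mono) auto
  finally show ?thesis using root by (simp add: Z_def)
qed

lemma dissociated_spectrum_card_le:
  fixes N A K :: real and U :: nat and S :: "nat set" and X :: "int set"
  assumes N: "N \<ge> 2" and S: "S \<noteq> {}"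
    and S_sub: "S \<subseteq> {p. prime p \<and> N powr (1 / 4) \<le> real p \<and> real p \<le> N}"
    and A: "A \<ge> 1" and K: "K = N / (real (card S) * ln N)" and U: "U > 0"
    and X: "X \<subseteq> large_spectrum S A U" "dissociated (int U) X"
  shows "real (card X) \<le> 30 * A\<^sup>2 * ln (8 * K) * exp (real U / N)"
proof -
  define Z where "Z = ln N"
  define l where "l = ln Z"
  define u where "u = real U / N"
  define k where "k = ln (8 * K)"
  have sub: "S \<subseteq> {1..nat \<lfloor>N\<rfloor>}" by (rule prime_subset_interval[OF S_sub])
  have sub': "S \<subseteq> {p. prime p \<and> real p \<le> N}" using S_sub by auto
  have fin: "finite S" using sub finite_subset by blast
  have cardS: "real (card S) > 0" using fin S by (simp add: card_gt_0_iff)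
  have "X \<subseteq> {0..int U - 1}"
    using X(1) by (auto simp: large_spectrum_def carrier_residue_ring)
  hence finX: "finite X" by (rule finite_subset) simp
  have large: "cmod (\<Sum>p\<in>S. e (real p * of_int v / real U)) \<ge> real (card S) / A" if "v \<in> X" for v
    using that X(1) by (auto simp: large_spectrum_def)
  have Z: "Z > 0" using N by (simp add: Z_def)
  have KZ: "K * Z = N / real (card S)" and K0: "K > 0"
    using Z cardS N by (simp_all add: K Z_def)
  have u0: "u \<ge> 0" using N by (simp add: u_def)
  have E: "exp u \<ge> 1 + u" by (rule exp_ge_add_one_self)
  have lnK: "ln K = k - ln 8" using K0 by (simp add: k_def ln_mult)
  have ln8: "ln (8::real) \<ge> 2"
  proof -
    have "ln ((2::real) ^ 3) = 3 * ln 2" by (subst ln_realpow) simp_all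
    thus ?thesis using ln2_ge by simp
  qed
  have chang: "real (card X) \<le> 2 * A\<^sup>2 * (k - ln 8 + l + u)"
  proof -
    have "real (card X) \<le> 2 * A\<^sup>2 * ln ((real (nat \<lfloor>N\<rfloor>) + real U) / real (card S))"
      by (rule chang_bound[OF sub S finX U X(2) A large])
    also have "\<dots> \<le> 2 * A\<^sup>2 * ln (K * Z * exp u)"
    proof (intro mult_left_mono)
      have "real (nat \<lfloor>N\<rfloor>) + real U \<le> N + real U" using N by (simp add: of_nat_floor)
      also have "\<dots> = N * (1 + u)" using N by (simp add: u_def field_simps)
      also have "\<dots> \<le> N * exp u" using E N by (intro mult_left_mono) auto
      finally have "(real (nat \<lfloor>N\<rfloor>) + real U) / real (card S) \<le> K * Z * exp u"
        unfolding KZ using cardS by (simp add: divide_right_mono)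
      moreover have "0 < (real (nat \<lfloor>N\<rfloor>) + real U) / real (card S)"
        using U cardS by (intro divide_pos_pos add_nonneg_pos) auto
      ultimately show "ln ((real (nat \<lfloor>N\<rfloor>) + real U) / real (card S)) \<le> ln (K * Z * exp u)"
        by (subst ln_le_cancel_iff) linarith+
    qed auto
    also have "ln (K * Z * exp u) = k - ln 8 + l + u"
      using K0 Z by (simp add: ln_mult lnK l_def)
    finally show ?thesis .
  qed
  have close: ?thesis if "k - ln 8 + l + u \<le> 15 * (k * exp u)"
  proof -
    have "2 * A\<^sup>2 * (k - ln 8 + l + u) \<le> 2 * A\<^sup>2 * (15 * (k * exp u))"
      using that by (intro mult_left_mono) auto
    thus ?thesis using chang by (simp add: k_def u_def mult_ac)
  qed
  have kE: "k * exp u \<ge> k + k * u" if "k \<ge> 0"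
    using mult_left_mono[OF E that] by (simp add: distrib_left)
  \<comment> \<open>The bound \<open>chang\<close> can exceed the target only through l, or when k
    is too small to absorb l and u. For Z \<le> 7 the trivial |S| \<le> N gives k \<ge> ln 8 - l
    \<ge> 1/8; afterwards Chebyshev's bound gives K \<ge> 1/3 and then K \<ge> 1/2.\<close>
  consider "Z \<le> 7" | "Z > 7" "Z \<le> 200" | "Z > 200" by linarith
  thus ?thesis
  proof cases
    case 1
    have "card S \<le> nat \<lfloor>N\<rfloor>" using card_mono[OF _ sub] by simp
    hence "real (card S) \<le> N" using N by linarith
    hence "1 \<le> K * Z" unfolding KZ using cardS by simp
    hence "0 \<le> ln (K * Z)" by simp
    hence lnKZ: "0 \<le> ln K + l" using K0 Z by (simp add: ln_mult l_def)
    have "l \<le> ln 8 - 1 / 8"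
    proof -
      have "ln (Z / 8) \<le> Z / 8 - 1" using Z by (intro ln_le_minus_one) auto
      thus ?thesis using Z 1 by (simp add: ln_div l_def)
    qed
    hence k: "k \<ge> 1 / 8" using lnKZ lnK by linarith
    have "u \<le> 8 * (k * u)" using mult_right_mono[OF k u0] by simp
    moreover have "0 \<le> k * u" using k u0 by simp
    ultimately have "k - ln 8 + l + u \<le> 15 * (k * exp u)"
      using kE k \<open>l \<le> ln 8 - 1 / 8\<close> by linarith
    thus ?thesis by (rule close)
  next
    case 2
    have "real (card S) \<le> 3 * (N / Z)"
      unfolding Z_def by (rule card_primes_le_third[OF sub']) (use 2 N in \<open>auto simp: Z_def\<close>)
    hence "K \<ge> 1 / 3" using cardS Z N by (simp add: K Z_def[symmetric] field_simps)
    hence "ln (8 / 3) \<le> k" unfolding k_def by (subst ln_le_cancel_iff) auto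
    moreover have "ln (3 / 8 :: real) \<le> 3 / 8 - 1" by (intro ln_le_minus_one) auto
    hence "5 / 8 \<le> ln (8 / 3 :: real)" by (simp add: ln_div)
    ultimately have k: "k \<ge> 5 / 8" by linarith
    have "l \<le> 6"
    proof -
      have "(2718 / 1000) ^ 6 \<le> exp (1::real) ^ 6" using exp_1_ge by (intro power_mono) auto
      also have "\<dots> = exp 6" by (simp flip: exp_of_nat_mult)
      finally have "200 \<le> exp (6::real)" by (simp add: power_divide)
      hence "ln Z \<le> ln (exp 6)" using 2 Z by (subst ln_le_cancel_iff) auto
      thus ?thesis by (simp add: l_def)
    qed
    have "u \<le> 8 / 5 * (k * u)" using mult_right_mono[OF k u0] by simp
    moreover have "0 \<le> k * u" using k u0 by simp
    ultimately have "k - ln 8 + l + u \<le> 15 * (k * exp u)"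
      using kE k \<open>l \<le> 6\<close> ln8 by linarith
    thus ?thesis by (rule close)
  next
    case 3
    have "real (card S) \<le> 2 * (N / Z)"
      unfolding Z_def by (rule card_primes_le_half[OF sub']) (use 3 N in \<open>auto simp: Z_def\<close>)
    hence K_half: "K \<ge> 1 / 2" using cardS Z N by (simp add: K Z_def[symmetric] field_simps)
    hence "ln 4 \<le> k" unfolding k_def by (subst ln_le_cancel_iff) auto
    moreover have "ln ((2::real) ^ 2) = 2 * ln 2" by (subst ln_realpow) simp_all
    ultimately have k: "k \<ge> 11 / 8" using ln2_ge by simp
    show ?thesis
    proof (cases "k - ln 8 + l + u \<le> 15 * (k * exp u)")
      case True
      thus ?thesis by (rule close)
    next
      case False
      define \<xi> where "\<xi> = k * exp u"
      have uk: "u \<le> k * u" using mult_right_mono[of 1 k u] k u0 by simp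
      have \<xi>: "\<xi> \<ge> k + k * u" using kE k by (simp add: \<xi>_def)
      \<comment> \<open>One of the 15 copies of \<xi> absorbs k + u, and ln 8 \<ge> 2.\<close>
      have l_lower: "14 * \<xi> \<le> l - 2" using False \<xi> uk ln8 unfolding \<xi>_def[symmetric] by linarith
      have l: "l \<ge> 85 / 4" using l_lower \<xi> uk u0 k by linarith
      show ?thesis
      proof (rule ccontr)
        assume "\<not> ?thesis"
        hence many: "30 * A\<^sup>2 * \<xi> < real (card X)" by (simp add: \<xi>_def k_def u_def mult_ac)
        \<comment> \<open>X is trimmed to a subset just above the claimed bound, because the sieve
          estimate also needs an upper bound on the size.\<close>
        define L where "L = nat \<lfloor>30 * A\<^sup>2 * \<xi>\<rfloor> + 1"
        have pos: "0 \<le> 30 * A\<^sup>2 * \<xi>" using \<xi> k uk u0 by simp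
        have L: "30 * A\<^sup>2 * \<xi> < real L" "real L \<le> 30 * A\<^sup>2 * \<xi> + 1"
        proof -
          have "real L = real (nat \<lfloor>30 * A\<^sup>2 * \<xi>\<rfloor>) + 1" by (simp only: L_def of_nat_add of_nat_1)
          thus "30 * A\<^sup>2 * \<xi> < real L" "real L \<le> 30 * A\<^sup>2 * \<xi> + 1"
            using real_nat_floor_gt[OF pos] of_nat_floor[OF pos] by linarith+
        qed
        have "nat \<lfloor>30 * A\<^sup>2 * \<xi>\<rfloor> < card X"
        proof -
          have "real (nat \<lfloor>30 * A\<^sup>2 * \<xi>\<rfloor>) < real (card X)" using of_nat_floor[OF pos] many by linarith
          thus ?thesis by (simp only: of_nat_less_iff)
        qed
        hence "L \<le> card X" by (simp add: L_def)
        then obtain Y where Y: "Y \<subseteq> X" "card Y = L" "finite Y"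
          using obtain_subset_with_card_n by metis
        have A2: "A\<^sup>2 \<ge> 1" using A by simp
        have "exp (real (card Y) / (5 * A\<^sup>2)) \<le> 5331 * (N / (real (card S) * exp l)) * exp (real U / (2 * N))"
        proof (rule exp_card_dissociated_le[OF _ l S_sub S A Y(3) _ U])
          show "N = exp (exp l)" using N Z by (simp add: l_def Z_def)
          show "dissociated (int U) Y" using X(2) Y(1) by (rule dissociated_subset)
          have "u \<le> l" using \<xi> uk l_lower k u0 by linarith
          thus "real U \<le> l * N" using N by (simp add: u_def field_simps)
          show "cmod (\<Sum>p\<in>S. e (real p * of_int v / real U)) \<ge> real (card S) / A" if "v \<in> Y" for v
            using that Y(1) large by blast
          have "real L / A\<^sup>2 \<le> (30 * A\<^sup>2 * \<xi> + 1) / A\<^sup>2"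
            using L A2 by (intro divide_right_mono) auto
          also have "\<dots> = 30 * \<xi> + 1 / A\<^sup>2" using A by (simp add: add_divide_distrib)
          finally have "real L / A\<^sup>2 \<le> 30 * \<xi> + 1 / A\<^sup>2" .
          moreover have "1 / A\<^sup>2 \<le> 1" using A2 divide_le_eq_1_pos[of "A\<^sup>2" 1] by linarith
          ultimately show "real (card Y) / A\<^sup>2 \<le> 15 / 7 * l - 23 / 7"
            unfolding Y(2) using l_lower by linarith
        qed
        also have "N / (real (card S) * exp l) = K" using Z by (simp add: K l_def Z_def)
        also have "real U / (2 * N) = u / 2" by (simp add: u_def)
        finally have upper: "exp (real L / (5 * A\<^sup>2)) \<le> 5331 * K * exp (u / 2)" by (simp add: Y(2))
        \<comment> \<open>The exponent is 30 / 5 = 6 times \<xi>; cancelling exp u leaves (8 K)^6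
          \<le> 5331 K, against (8 K)^6 \<ge> 8192 K for K \<ge> 1/2.\<close>
        have "6 * k + u \<le> 6 * \<xi>" using \<xi> uk u0 by linarith
        also have "6 * \<xi> \<le> real L / (5 * A\<^sup>2)"
        proof (rule mult_imp_le_div_pos)
          have "6 * \<xi> * (5 * A\<^sup>2) = 30 * A\<^sup>2 * \<xi>" by simp
          thus "6 * \<xi> * (5 * A\<^sup>2) \<le> real L" using L(1) by linarith
        qed (use A2 in linarith)
        finally have "exp (6 * k + u) \<le> exp (real L / (5 * A\<^sup>2))" by simp
        also note upper
        also have "5331 * K * exp (u / 2) \<le> 5331 * K * exp u" using K0 u0 by (intro mult_left_mono) auto
        finally have "exp (6 * k) \<le> 5331 * K" by (simp add: exp_add)
        moreover have "exp (6 * k) = (8 * K) ^ 6"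
          using exp_of_nat_mult[of 6 k] K0 by (simp add: k_def)
        moreover have "(8 * K) ^ 6 \<ge> 8192 * K"
        proof -
          have "(1 / 2) ^ 5 * K \<le> K ^ 5 * K" using K_half by (intro mult_right_mono power_mono) auto
          hence "262144 * ((1 / 2) ^ 5 * K) \<le> 262144 * (K ^ 5 * K)" by (intro mult_left_mono) auto
          moreover have "(8 * K) ^ 6 = 262144 * (K ^ 5 * K)"
            by (simp add: power_mult_distrib power_numeral_reduce)
          ultimately show ?thesis by (simp add: power_divide)
        qed
        ultimately show False using K0 by linarith
      qed
    qed
  qed
qed

section \<open>Maximal dissociated sets and their lifts\<close>

lemma maximal_dissociated_covers:
  fixes m :: nat
  assumes B: "B \<subseteq> {0..int m - 1}"
  shows "\<exists>D\<subseteq>B. dissociated (int m) D \<and> B \<subseteq> signed_sums m D"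
proof -
  have finB: "finite B" using B finite_subset by blast
  let ?F = "{D. D \<subseteq> B \<and> dissociated (int m) D}"
  have "finite ?F" using finB by simp
  moreover have "{} \<in> ?F" by (simp add: dissociated_def)
  ultimately have "Max (card ` ?F) \<in> card ` ?F" by (intro Max_in) auto
  then obtain D where D: "D \<in> ?F" "card D = Max (card ` ?F)" by auto
  have D_max: "card D' \<le> card D" if "D' \<in> ?F" for D'
    unfolding D(2) using \<open>finite ?F\<close> that by (intro Max_ge) auto
  have finD: "finite D" using D finB finite_subset by blast
  have "b \<in> signed_sums m D" if b: "b \<in> B" for b
  proof (cases "b \<in> D")
    case True
    have "(\<Sum>a\<in>D. (if a = b then 1 else 0) * a) = b"
    proof -
      have "(\<Sum>a\<in>D. (if a = b then 1 else 0) * a) = (\<Sum>a\<in>D. if a = b then a else 0)"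
        by (intro sum.cong) auto
      thus ?thesis using finD True by (simp add: sum.delta)
    qed
    moreover have "b mod int m = b" using b B by (intro mod_pos_pos_trivial) auto
    ultimately have "b = (\<Sum>a\<in>D. (if a = b then 1 else 0) * a) mod int m" by simp
    thus ?thesis unfolding signed_sums_def by (auto intro!: exI[of _ "\<lambda>a. if a = b then 1 else 0"] split: if_splits)
  next
    case False
    \<comment> \<open>D has maximal size, so adjoining b creates a relation; it must involve b and
      can be solved for b.\<close>
    have "\<not> dissociated (int m) (insert b D)"
    proof
      assume "dissociated (int m) (insert b D)"
      hence "insert b D \<in> ?F" using D(1) b by simp
      from D_max[OF this] show False using False finD by simp
    qed
    then obtain A \<sigma> where A: "A \<subseteq> insert b D" "\<sigma> \<in> A \<rightarrow> {-1, 1}" "int m dvd (\<Sum>a\<in>A. \<sigma> a * a)" "A \<noteq> {}"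
      by (auto simp: dissociated_def)
    have finA: "finite A" using A(1) finD finite_subset by auto
    have bA: "b \<in> A"
    proof (rule ccontr)
      assume "b \<notin> A"
      hence "A \<subseteq> D" using A(1) by blast
      moreover have "dissociated (int m) D" using D(1) by simp
      ultimately have "A = {}" using A(2,3) by (intro dissociatedD)
      with A(4) show False by simp
    qed
    hence \<sigma>b: "\<sigma> b = -1 \<or> \<sigma> b = 1" using A(2) by blast
    \<comment> \<open>Multiplying the relation by -\<sigma>(b) gives b the coefficient -1, as
      \<sigma>(b)^2 = 1, so the remaining terms add up to b modulo m.\<close>
    define \<epsilon> where "\<epsilon> a = (if a \<in> A then - \<sigma> b * \<sigma> a else 0)" for a
    have \<epsilon>: "\<epsilon> \<in> D \<rightarrow> {-1, 0, 1}"
    proof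
      fix a assume "a \<in> D"
      show "\<epsilon> a \<in> {-1, 0, 1}"
      proof (cases "a \<in> A")
        case True
        hence "\<sigma> a = -1 \<or> \<sigma> a = 1" using A(2) by blast
        thus ?thesis using \<sigma>b True by (auto simp: \<epsilon>_def)
      qed (simp add: \<epsilon>_def)
    qed
    have "(\<Sum>a\<in>D. \<epsilon> a * a) = (\<Sum>a\<in>A - {b}. \<epsilon> a * a)"
      using A(1) False finD by (intro sum.mono_neutral_right) (auto simp: \<epsilon>_def)
    also have "\<dots> = - \<sigma> b * (\<Sum>a\<in>A - {b}. \<sigma> a * a)"
      unfolding sum_distrib_left by (intro sum.cong) (auto simp: \<epsilon>_def)
    also have "(\<Sum>a\<in>A - {b}. \<sigma> a * a) = (\<Sum>a\<in>A. \<sigma> a * a) - \<sigma> b * b"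
      using finA bA by (simp add: sum_diff1)
    finally have "(\<Sum>a\<in>D. \<epsilon> a * a) - b = - \<sigma> b * (\<Sum>a\<in>A. \<sigma> a * a) + (\<sigma> b * \<sigma> b - 1) * b"
      by (simp add: algebra_simps)
    also have "\<sigma> b * \<sigma> b - 1 = 0" using \<sigma>b by auto
    finally have "int m dvd (\<Sum>a\<in>D. \<epsilon> a * a) - b" using A(3) by simp
    hence "(\<Sum>a\<in>D. \<epsilon> a * a) mod int m = b mod int m" by (simp add: mod_eq_dvd_iff)
    also have "b mod int m = b" using b B by (intro mod_pos_pos_trivial) auto
    finally show ?thesis unfolding signed_sums_def using \<epsilon> by blast
  qed
  thus ?thesis using D(1) by blast
qed

text \<open>Because m divides n, a relation modulo n among the lifts reduces modulo m to one with
  the same signs in D.\<close>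

lemma dissociated_lift:
  fixes m n :: nat
  assumes "m dvd n" and D: "dissociated (int m) D" and g: "\<And>a. a \<in> D \<Longrightarrow> g a mod int m = a"
  shows "dissociated (int n) (g ` D)" "inj_on g D"
proof -
  show inj: "inj_on g D" using g by (intro inj_onI) metis
  show "dissociated (int n) (g ` D)"
    unfolding dissociated_def
  proof (intro allI ballI impI)
    fix A \<sigma> assume A: "A \<subseteq> g ` D" "\<sigma> \<in> A \<rightarrow> {-1, 1}" "int n dvd (\<Sum>u\<in>A. \<sigma> u * u)"
    define A' where "A' = {a\<in>D. g a \<in> A}"
    have AA': "A = g ` A'" using A(1) by (auto simp: A'_def)
    have inj': "inj_on g A'" using inj by (rule inj_on_subset) (auto simp: A'_def)
    have "int m dvd int n" using assms(1) by simp
    hence "int m dvd (\<Sum>u\<in>A. \<sigma> u * u)" using A(3) dvd_trans by blast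
    also have "(\<Sum>u\<in>A. \<sigma> u * u) = (\<Sum>a\<in>A'. \<sigma> (g a) * g a)"
      unfolding AA' using inj' by (simp add: sum.reindex)
    finally have 1: "int m dvd (\<Sum>a\<in>A'. \<sigma> (g a) * g a)" .
    have "int m dvd (\<Sum>a\<in>A'. \<sigma> (g a) * (g a - a))"
    proof (intro dvd_sum dvd_mult)
      fix a assume "a \<in> A'"
      hence "g a mod int m = a" using g by (simp add: A'_def)
      thus "int m dvd g a - a" by (metis minus_mod_eq_mult_div dvd_triv_left)
    qed
    from dvd_diff[OF 1 this] have "int m dvd (\<Sum>a\<in>A'. (\<sigma> \<circ> g) a * a)"
      by (simp add: sum_subtractf[symmetric] right_diff_distrib)
    moreover have "\<sigma> \<circ> g \<in> A' \<rightarrow> {-1, 1}" using A(2) by (auto simp: A'_def Pi_iff)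
    moreover have "A' \<subseteq> D" by (auto simp: A'_def)
    ultimately have "A' = {}" using D by (intro dissociatedD[of "int m" D A' "\<sigma> \<circ> g"])
    thus "A = {}" by (simp add: AA')
  qed
qed

text \<open>The maximal set is chosen in the projection, but its size is bounded through
  representatives in the spectrum modulo U, where the exponential sums are large.\<close>

lemma spectrum_projection_covered:
  fixes N A K :: real and U m :: nat and S :: "nat set"
  assumes "N \<ge> 2" "S \<noteq> {}"
    and "S \<subseteq> {p. prime p \<and> N powr (1/4) \<le> real p \<and> real p \<le> N}"
    and "A \<ge> 1" "K = N / (real (card S) * ln N)" "m > 0" "m dvd U" "U > 0"
  shows "\<exists>D. D \<subseteq> carrier (residue_ring (int m)) \<and>
    real (card D) \<le> 30 * A\<^sup>2 * ln (8 * K) * exp (real U / N) \<and>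
    (\<lambda>u. u mod int m) ` large_spectrum S A U \<subseteq> signed_sums m D"
proof -
  let ?B = "(\<lambda>u. u mod int m) ` large_spectrum S A U"
  have B: "?B \<subseteq> {0..int m - 1}" using assms(6) by auto
  obtain D where D: "D \<subseteq> ?B" "dissociated (int m) D" "?B \<subseteq> signed_sums m D"
    using maximal_dissociated_covers[OF B] by (elim exE conjE)
  have "\<forall>a\<in>D. \<exists>u. u \<in> large_spectrum S A U \<and> u mod int m = a" using D(1) by blast
  from bchoice[OF this] obtain g where g: "\<And>a. a \<in> D \<Longrightarrow> g a \<in> large_spectrum S A U" "\<And>a. a \<in> D \<Longrightarrow> g a mod int m = a"
    by blast
  have "real (card (g ` D)) \<le> 30 * A\<^sup>2 * ln (8 * K) * exp (real U / N)"
    using assms g dissociated_lift(1)[OF assms(7) D(2) g(2)]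
    by (intro dissociated_spectrum_card_le) auto
  moreover have "card (g ` D) = card D"
    using dissociated_lift(2)[OF assms(7) D(2) g(2)] by (simp add: card_image)
  ultimately have "real (card D) \<le> 30 * A\<^sup>2 * ln (8 * K) * exp (real U / N)" by simp
  thus ?thesis
    unfolding carrier_residue_ring using order_trans[OF D(1) B] D(3) by (intro exI[of _ D] conjI)
qed

theorem theorem1p4:
  fixes N A K :: real and U\<^sub>1 U\<^sub>2 U :: nat and S :: "nat set"
  assumes "N \<ge> 2"
    and "prime U\<^sub>1" and "prime U\<^sub>2" and "U\<^sub>1 \<noteq> U\<^sub>2"
    and "real U\<^sub>1 \<in> {N powr (1/4)..N powr (3/4)}"
    and "real U\<^sub>2 \<in> {N powr (1/4)..N powr (3/4)}"
    and "U = U\<^sub>1 * U\<^sub>2"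
    and "S \<noteq> {}"
    and "S \<subseteq> {p. prime p \<and> N powr (1/4) \<le> real p \<and> real p \<le> N}"
    and "A \<ge> 1"
    and "K = N / (real (card S) * ln N)"
  shows "\<exists>D\<^sub>1 D\<^sub>2.
           D\<^sub>1 \<subseteq> carrier (residue_ring (int U\<^sub>1)) \<and>
           D\<^sub>2 \<subseteq> carrier (residue_ring (int U\<^sub>2)) \<and>
           real (card D\<^sub>1) \<le> 30 * A\<^sup>2 * ln (8 * K) * exp (real U / N) \<and>
           real (card D\<^sub>2) \<le> 30 * A\<^sup>2 * ln (8 * K) * exp (real U / N) \<and>
           crt_map U\<^sub>1 U\<^sub>2 ` large_spectrum S A U
             \<subseteq> signed_sums U\<^sub>1 D\<^sub>1 \<times> signed_sums U\<^sub>2 D\<^sub>2"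
proof -
  have U: "U\<^sub>1 > 0" "U\<^sub>2 > 0" "U\<^sub>1 dvd U" "U\<^sub>2 dvd U" "U > 0"
    using assms by (auto simp: prime_gt_0_nat)
  obtain D\<^sub>1 where D1: "D\<^sub>1 \<subseteq> carrier (residue_ring (int U\<^sub>1))"
    "real (card D\<^sub>1) \<le> 30 * A\<^sup>2 * ln (8 * K) * exp (real U / N)"
    "(\<lambda>u. u mod int U\<^sub>1) ` large_spectrum S A U \<subseteq> signed_sums U\<^sub>1 D\<^sub>1"
    using spectrum_projection_covered[of N S A K "U\<^sub>1" U] assms U by blast
  obtain D\<^sub>2 where D2: "D\<^sub>2 \<subseteq> carrier (residue_ring (int U\<^sub>2))"
    "real (card D\<^sub>2) \<le> 30 * A\<^sup>2 * ln (8 * K) * exp (real U / N)"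
    "(\<lambda>u. u mod int U\<^sub>2) ` large_spectrum S A U \<subseteq> signed_sums U\<^sub>2 D\<^sub>2"
    using spectrum_projection_covered[of N S A K "U\<^sub>2" U] assms U by blast
  have "crt_map U\<^sub>1 U\<^sub>2 ` large_spectrum S A U \<subseteq> signed_sums U\<^sub>1 D\<^sub>1 \<times> signed_sums U\<^sub>2 D\<^sub>2"
    using D1(3) D2(3) by (auto simp: crt_map_def)
  with D1 D2 show ?thesis by blast
qed

end
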